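(* Let $\mathbb{K}$ be a topological field, $F$ a topological $\mathbb{K}$-vector space, $d\in\mathbb{N}$, $k\in\mathbb{N}_0\cup\{\infty\}$, and $U\subseteq\mathbb{K}^d$ a subset which is open or of the form $U_1\times\cdots\times U_d$ with $U_1,\ldots,U_d\subseteq\mathbb{K}$ having dense interior. Then $C^k(U,F)_{BGN}=C^k(U,F)_{SDS}$ as topological $\mathbb{K}$-vector spaces.
   Context: Topological fields are Hausdorff and non-discrete; vector spaces Hausdorff. $C^k_{BGN}$: for $V\subseteq E$ with dense interior, $V^{[1]}=\{(x,y,t)\in V\times E\times\mathbb{K}:x+ty\in V\}$, $V^{]1[}$ its subset with $t\neq0$, $g^{]1[}(x,y,t)=(g(x+ty)-g(x))/t$; $g$ is $C^0_{BGN}$ if continuous, $C^1_{BGN}$ if continuous and $g^{]1[}$ extends continuously to $g^{[1]}$ on $V^{[1]}$, $C^k_{BGN}$ if $C^1_{BGN}$ with $g^{[1]}$ $C^{k-1}_{BGN}$; $V^{[k]}=(V^{[1]})^{[k-1]}$, $g^{[k]}=(g^{[1]})^{[k-1]}$, $g^{[0]}=g$. $C^k_{SDS}$: for $\alpha\in\mathbb{N}_0^d$, write $x\in\mathbb{K}^{d+|\alpha|}$ as $(x^{(1)},\ldots,x^{(d)})$ with $x^{(i)}=(x^{(i)}_0,\ldots,x^{(i)}_{\alpha_i})$; $U^{<\alpha>}$: all $x$ with $(x^{(1)}_{i_1},\ldots,x^{(d)}_{i_d})\in U$ for all $0\le i_\ell\le\alpha_\ell$; $U^{>\alpha<}$: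 those with pairwise distinct entries inside each block $x^{(i)}$; $f^{>0<}=f$, $f^{>\alpha<}(x)=\sum_{j_1=0}^{\alpha_1}\cdots\sum_{j_d=0}^{\alpha_d}\big(\prod_{\ell}\prod_{k_\ell\ne j_\ell}(x^{(\ell)}_{j_\ell}-x^{(\ell)}_{k_\ell})^{-1}\big)f(x^{(1)}_{j_1},\ldots,x^{(d)}_{j_d})$. $f$ is $C^k_{SDS}$ if continuous and for each $1\le|\alpha|\le k$ the map $f^{>\alpha<}$ extends continuously to $f^{<\alpha>}\colon U^{<\alpha>}\to F$ ($f^{<0>}=f$). The $C^k_{BGN}$-maps $U\to F$ and the $C^k_{SDS}$-maps $U\to F$ are known to be the same; their common set is the vector space $C^k(U,F)$. $C^k(U,F)_{BGN}$ denotes $C^k(U,F)$ with the initial topology w.r.t. the maps $f\mapsto f^{[j]}\in C(U^{[j]},F)$ for $j\in\mathbb{N}_0$, $j\le k$; $C^k(U,F)_{SDS}$ denotes $C^k(U,F)$ with the initial topology w.r.t. the maps $f\mapsto f^{<\alpha>}\in C(U^{<\alpha>},F)$ for $\alpha\in\mathbb{N}_0^d$, $|\alpha|\le k$; all spaces of continuous maps carry the compact-open topology. *)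

theory Defs
  imports "HOL-Analysis.Analysis" "HOL-Library.Extended_Nat"
begin

definition topological_field :: "'k::field topology \<Rightarrow> bool" where
  "topological_field TK \<longleftrightarrow> topspace TK = UNIV \<and> Hausdorff_space TK
     \<and> TK \<noteq> discrete_topology UNIV
     \<and> continuous_map (prod_topology TK TK) TK (\<lambda>(a,b). a + b)
     \<and> continuous_map (prod_topology TK TK) TK (\<lambda>(a,b). a * b)
     \<and> continuous_map TK TK uminus
     \<and> continuous_map (subtopology TK (-{0})) TK inverse"

definition topological_vector_space ::
  "'k::field topology \<Rightarrow> ('k \<Rightarrow> 'f::ab_group_add \<Rightarrow> 'f) \<Rightarrow> 'f topology \<Rightarrow> bool" where
  "topological_vector_space TK sc TF \<longleftrightarrow> Vector_Spaces.vector_space sc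
     \<and> topspace TF = UNIV \<and> Hausdorff_space TF
     \<and> continuous_map (prod_topology TF TF) TF (\<lambda>(u,v). u + v)
     \<and> continuous_map (prod_topology TK TF) TF (\<lambda>(a,u). sc a u)"

text \<open>K^n is represented by functions nat => K on the index set {..<n} (undefined elsewhere),
  with the product topology.\<close>
definition Kpow :: "'k topology \<Rightarrow> nat \<Rightarrow> (nat \<Rightarrow> 'k) topology" where
  "Kpow TK n = product_topology (\<lambda>_. TK) {..<n}"

definition compact_open :: "'a topology \<Rightarrow> 'b topology \<Rightarrow> ('a \<Rightarrow> 'b) topology" where
  "compact_open X Y = topology_generated_by
     {{g. continuous_map X Y g \<and> g ` K \<subseteq> W} | K W. compactin X K \<and> openin Y W}"

definition initial_top :: "'a set \<Rightarrow> 'i set \<Rightarrow> ('i \<Rightarrow> 'b topology) \<Rightarrow> ('i \<Rightarrow> 'a \<Rightarrow> 'b) \<Rightarrow> 'a topology" where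
  "initial_top A I Y \<phi> = topology_generated_by
     (insert A (\<Union>i\<in>I. {A \<inter> \<phi> i -` W | W. openin (Y i) W}))"

text \<open>The point (x,y,t) of E x E x K with E = K^n is coded as an element of K^(2n+1).\<close>
definition cat3 :: "nat \<Rightarrow> (nat \<Rightarrow> 'k) \<Rightarrow> (nat \<Rightarrow> 'k) \<Rightarrow> 'k \<Rightarrow> (nat \<Rightarrow> 'k)" where
  "cat3 n x y t = (\<lambda>i. if i < n then x i else if i < 2*n then y (i - n)
                       else if i = 2*n then t else undefined)"

definition vadd :: "nat \<Rightarrow> (nat \<Rightarrow> 'k::field) \<Rightarrow> 'k \<Rightarrow> (nat \<Rightarrow> 'k) \<Rightarrow> (nat \<Rightarrow> 'k)" where
  "vadd n x t y = (\<lambda>i. if i < n then x i + t * y i else undefined)"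

definition BGN_V1 :: "'k::field topology \<Rightarrow> nat \<Rightarrow> (nat \<Rightarrow> 'k) set \<Rightarrow> (nat \<Rightarrow> 'k) set" where
  "BGN_V1 TK n V = {cat3 n x y t | x y t. x \<in> V \<and> y \<in> topspace (Kpow TK n) \<and> vadd n x t y \<in> V}"

definition BGN_ext :: "'k::field topology \<Rightarrow> 'f::ab_group_add topology \<Rightarrow> ('k \<Rightarrow> 'f \<Rightarrow> 'f)
   \<Rightarrow> nat \<Rightarrow> (nat \<Rightarrow> 'k) set \<Rightarrow> ((nat \<Rightarrow> 'k) \<Rightarrow> 'f) \<Rightarrow> ((nat \<Rightarrow> 'k) \<Rightarrow> 'f) \<Rightarrow> bool" where
  "BGN_ext TK TF sc n V g h \<longleftrightarrow>
     continuous_map (subtopology (Kpow TK (2*n+1)) (BGN_V1 TK n V)) TF h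
     \<and> (\<forall>x\<in>V. \<forall>y\<in>topspace (Kpow TK n). \<forall>t. t \<noteq> 0 \<and> vadd n x t y \<in> V \<longrightarrow>
          h (cat3 n x y t) = sc (inverse t) (g (vadd n x t y) - g x))"

definition BGN_g1 where
  "BGN_g1 TK TF sc n V g = (SOME h. BGN_ext TK TF sc n V g h)"

fun BGN_Ck :: "'k::field topology \<Rightarrow> 'f::ab_group_add topology \<Rightarrow> ('k \<Rightarrow> 'f \<Rightarrow> 'f)
   \<Rightarrow> nat \<Rightarrow> nat \<Rightarrow> (nat \<Rightarrow> 'k) set \<Rightarrow> ((nat \<Rightarrow> 'k) \<Rightarrow> 'f) \<Rightarrow> bool" where
  "BGN_Ck TK TF sc 0 n V g = continuous_map (subtopology (Kpow TK n) V) TF g"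
| "BGN_Ck TK TF sc (Suc k) n V g =
     (continuous_map (subtopology (Kpow TK n) V) TF g
      \<and> (\<exists>h. BGN_ext TK TF sc n V g h)
      \<and> BGN_Ck TK TF sc k (2*n+1) (BGN_V1 TK n V) (BGN_g1 TK TF sc n V g))"

fun BGN_dim :: "nat \<Rightarrow> nat \<Rightarrow> nat" where
  "BGN_dim 0 n = n"
| "BGN_dim (Suc j) n = BGN_dim j (2*n+1)"

fun BGN_Vk :: "'k::field topology \<Rightarrow> nat \<Rightarrow> nat \<Rightarrow> (nat \<Rightarrow> 'k) set \<Rightarrow> (nat \<Rightarrow> 'k) set" where
  "BGN_Vk TK 0 n V = V"
| "BGN_Vk TK (Suc j) n V = BGN_Vk TK j (2*n+1) (BGN_V1 TK n V)"

fun BGN_gk :: "'k::field topology \<Rightarrow> 'f::ab_group_add topology \<Rightarrow> ('k \<Rightarrow> 'f \<Rightarrow> 'f)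
   \<Rightarrow> nat \<Rightarrow> nat \<Rightarrow> (nat \<Rightarrow> 'k) set \<Rightarrow> ((nat \<Rightarrow> 'k) \<Rightarrow> 'f) \<Rightarrow> ((nat \<Rightarrow> 'k) \<Rightarrow> 'f)" where
  "BGN_gk TK TF sc 0 n V g = g"
| "BGN_gk TK TF sc (Suc j) n V g =
     BGN_gk TK TF sc j (2*n+1) (BGN_V1 TK n V) (BGN_g1 TK TF sc n V g)"

text \<open>Maps U -> F are represented by functions vanishing outside U.\<close>
definition is_BGN :: "'k::field topology \<Rightarrow> 'f::ab_group_add topology \<Rightarrow> ('k \<Rightarrow> 'f \<Rightarrow> 'f)
   \<Rightarrow> enat \<Rightarrow> nat \<Rightarrow> (nat \<Rightarrow> 'k) set \<Rightarrow> ((nat \<Rightarrow> 'k) \<Rightarrow> 'f) \<Rightarrow> bool" where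
  "is_BGN TK TF sc k d U f \<longleftrightarrow> (\<forall>x. x \<notin> U \<longrightarrow> f x = 0)
     \<and> (\<forall>m. enat m \<le> k \<longrightarrow> BGN_Ck TK TF sc m d U f)"

definition BGN_top where
  "BGN_top TK TF sc k d U = initial_top {f. is_BGN TK TF sc k d U f} {j. enat j \<le> k}
     (\<lambda>j. compact_open (subtopology (Kpow TK (BGN_dim j d)) (BGN_Vk TK j d U)) TF)
     (\<lambda>j f. BGN_gk TK TF sc j d U f)"

definition multi_idx :: "nat \<Rightarrow> (nat \<Rightarrow> nat) set" where
  "multi_idx d = {\<alpha>. \<forall>l\<ge>d. \<alpha> l = 0}"

definition mabs :: "nat \<Rightarrow> (nat \<Rightarrow> nat) \<Rightarrow> nat" where
  "mabs d \<alpha> = (\<Sum>l<d. \<alpha> l)"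

text \<open>Offset of block x^(l) (of length alpha_l + 1) inside x in K^(d+|alpha|).\<close>
definition blk_off :: "(nat \<Rightarrow> nat) \<Rightarrow> nat \<Rightarrow> nat" where
  "blk_off \<alpha> l = (\<Sum>i<l. Suc (\<alpha> i))"

definition sel_pt :: "nat \<Rightarrow> (nat \<Rightarrow> nat) \<Rightarrow> (nat \<Rightarrow> 'k) \<Rightarrow> (nat \<Rightarrow> nat) \<Rightarrow> (nat \<Rightarrow> 'k)" where
  "sel_pt d \<alpha> x \<iota> = (\<lambda>l. if l < d then x (blk_off \<alpha> l + \<iota> l) else undefined)"

definition U_low :: "'k topology \<Rightarrow> nat \<Rightarrow> (nat \<Rightarrow> nat) \<Rightarrow> (nat \<Rightarrow> 'k) set \<Rightarrow> (nat \<Rightarrow> 'k) set" where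
  "U_low TK d \<alpha> U = {x \<in> topspace (Kpow TK (d + mabs d \<alpha>)).
      \<forall>\<iota>. (\<forall>l<d. \<iota> l \<le> \<alpha> l) \<longrightarrow> sel_pt d \<alpha> x \<iota> \<in> U}"

definition U_high :: "'k topology \<Rightarrow> nat \<Rightarrow> (nat \<Rightarrow> nat) \<Rightarrow> (nat \<Rightarrow> 'k) set \<Rightarrow> (nat \<Rightarrow> 'k) set" where
  "U_high TK d \<alpha> U = {x \<in> U_low TK d \<alpha> U. \<forall>l<d. \<forall>j\<le>\<alpha> l. \<forall>m\<le>\<alpha> l.
      j \<noteq> m \<longrightarrow> x (blk_off \<alpha> l + j) \<noteq> x (blk_off \<alpha> l + m)}"

definition dd_high :: "('k::field \<Rightarrow> 'f::ab_group_add \<Rightarrow> 'f) \<Rightarrow> nat \<Rightarrow> (nat \<Rightarrow> nat)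
   \<Rightarrow> ((nat \<Rightarrow> 'k) \<Rightarrow> 'f) \<Rightarrow> (nat \<Rightarrow> 'k) \<Rightarrow> 'f" where
  "dd_high sc d \<alpha> f x = (\<Sum>\<iota>\<in>PiE {..<d} (\<lambda>l. {..\<alpha> l}).
      sc (\<Prod>l<d. \<Prod>m\<in>{..\<alpha> l} - {\<iota> l}.
               inverse (x (blk_off \<alpha> l + \<iota> l) - x (blk_off \<alpha> l + m)))
            (f (sel_pt d \<alpha> x \<iota>)))"

definition SDS_ext where
  "SDS_ext TK TF sc d U \<alpha> f h \<longleftrightarrow>
     continuous_map (subtopology (Kpow TK (d + mabs d \<alpha>)) (U_low TK d \<alpha> U)) TF h
     \<and> (\<forall>x\<in>U_high TK d \<alpha> U. h x = dd_high sc d \<alpha> f x)"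

definition SDS_fa where
  "SDS_fa TK TF sc d U \<alpha> f =
     (if mabs d \<alpha> = 0 then f else (SOME h. SDS_ext TK TF sc d U \<alpha> f h))"

definition is_SDS :: "'k::field topology \<Rightarrow> 'f::ab_group_add topology \<Rightarrow> ('k \<Rightarrow> 'f \<Rightarrow> 'f)
   \<Rightarrow> enat \<Rightarrow> nat \<Rightarrow> (nat \<Rightarrow> 'k) set \<Rightarrow> ((nat \<Rightarrow> 'k) \<Rightarrow> 'f) \<Rightarrow> bool" where
  "is_SDS TK TF sc k d U f \<longleftrightarrow> (\<forall>x. x \<notin> U \<longrightarrow> f x = 0)
     \<and> continuous_map (subtopology (Kpow TK d) U) TF f
     \<and> (\<forall>\<alpha>\<in>multi_idx d. 1 \<le> mabs d \<alpha> \<and> enat (mabs d \<alpha>) \<le> k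
           \<longrightarrow> (\<exists>h. SDS_ext TK TF sc d U \<alpha> f h))"

definition SDS_top where
  "SDS_top TK TF sc k d U = initial_top {f. is_SDS TK TF sc k d U f}
     {\<alpha>\<in>multi_idx d. enat (mabs d \<alpha>) \<le> k}
     (\<lambda>\<alpha>. compact_open (subtopology (Kpow TK (d + mabs d \<alpha>)) (U_low TK d \<alpha> U)) TF)
     (\<lambda>\<alpha> f. SDS_fa TK TF sc d U \<alpha> f)"

end

(* The n-fold iterate of the difference quotient construction is compared with divided
   differences one step at a time, and for families f |-> Phi f of functions rather than for single
   functions: "continuous" is replaced throughout by "continuous as a map from a space T of
   parameters f into a space of maps with the compact-open topology". Running the comparison for the
   family f |-> f, once over C^k_BGN and once over C^k_SDS, yields the equality of the sets and
   the continuity of the identity in both directions simultaneously.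

   One step is as follows. Divided differences of order beta of the first-order divided difference in
   the variable x_i are divided differences of f of order |beta| + 1, at the same vector, the block
   of x_i being cut in two. From BGN to SDS, the first-order divided difference in x_i is g^[1] after
   an affine substitution. From SDS to BGN, telescoping along the points that mix coordinates of x
   and x + ty writes g^[1](x,y,t) as a sum of y_i times first-order divided differences wherever
   the mixed points lie in U; elsewhere t is nonzero and g^[1] is given by its defining quotient. The
   two parts are relatively open, and C^k_BGN families can be glued, multiplied by polynomials,
   divided by nonvanishing polynomials and composed with polynomial maps. *)

theory Submission
  imports Defs
begin

section \<open>Maps into spaces with the compact-open topology\<close>

text \<open>Both constructions are recursive in the function, so continuity of f |-> f^[j] cannot be
  read off a single quotient; with the parameter carried along, one induction covers all orders. No
  local compactness is available. It is replaced by the fact that a compact set in a Hausdorff space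
  is itself regular and can be cut into finitely many arbitrarily small compact pieces.

  Three facts about the domains shape the rest. In a non-discrete Hausdorff field, points with
  pairwise distinct nonzero coordinates are dense in every set with dense interior, so continuous
  extensions are unique and the values chosen by \<open>SOME\<close> are determined where they
  matter. Points of V^[1] with t = 0 have equal base and end point; a point of V^[1] missed by the
  pieces of an open cover of V therefore has t nonzero, and there the quotient formula is available.
  Finally, passing from U to U^{<e_i>} preserves both permitted shapes of U and trades one unit of
  order for one more variable, which is why the inductions on k let the dimension vary.\<close>

lemma topspace_compact_open: "topspace (compact_open X Y) = {g. continuous_map X Y g}"
proof
  show "{g. continuous_map X Y g} \<subseteq> topspace (compact_open X Y)"
    unfolding compact_open_def topology_generated_by_topspace
    by (rule subsetI, rule UnionI[where X="{g. continuous_map X Y g \<and> g ` {} \<subseteq> {}}"])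
       (auto intro!: exI[of _ "{}"])
qed (auto simp: compact_open_def topology_generated_by_topspace)

lemma continuous_map_compact_open_iff:
  "continuous_map T (compact_open X Y) \<Phi> \<longleftrightarrow>
     (\<forall>f\<in>topspace T. continuous_map X Y (\<Phi> f)) \<and>
     (\<forall>K W. compactin X K \<and> openin Y W \<longrightarrow> openin T {f\<in>topspace T. \<Phi> f ` K \<subseteq> W})"
   (is "?L \<longleftrightarrow> ?C \<and> ?O")
proof -
  have *: "?L \<longleftrightarrow> (\<forall>K W. compactin X K \<and> openin Y W \<longrightarrow>
        openin T (\<Phi> -` {g. continuous_map X Y g \<and> g ` K \<subseteq> W} \<inter> topspace T)) \<and> ?C"
  proof -
    have "\<Union> {{g. continuous_map X Y g \<and> g ` K \<subseteq> W} | K W. compactin X K \<and> openin Y W}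
       = {g. continuous_map X Y g}"
      using topspace_compact_open[of X Y] unfolding compact_open_def topology_generated_by_topspace .
    moreover have "(\<forall>V. V \<in> {S K W | K W. P K W} \<longrightarrow> Q V) \<longleftrightarrow> (\<forall>K W. P K W \<longrightarrow> Q (S K W))"
      for S :: "'b set \<Rightarrow> 'c set \<Rightarrow> ('b \<Rightarrow> 'c) set" and P Q by blast
    ultimately show ?thesis
      unfolding compact_open_def continuous_on_generated_topo_iff
      by (simp only: image_subset_iff mem_Collect_eq)
  qed
  have "\<Phi> -` {g. continuous_map X Y g \<and> g ` K \<subseteq> W} \<inter> topspace T = {f\<in>topspace T. \<Phi> f ` K \<subseteq> W}"
    if ?C for K W
    using that by blast
  with * show ?thesis by (metis (no_types, lifting))
qed

text \<open>The subspace on \<open>C\<close> is compact Hausdorff, hence regular: each point has a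
  closed, thus compact, neighbourhood inside its \<open>N\<close>, and finitely many of these cover
  \<open>C\<close>. A property of compact sets that is stable under unions thus only has to be
  checked on small pieces, whether or not \<open>X\<close> is locally compact.\<close>

lemma compactin_local_induct:
  assumes X: "Hausdorff_space X" and C: "compactin X C"
    and loc: "\<And>p. p \<in> C \<Longrightarrow> \<exists>N. openin X N \<and> p \<in> N \<and>
            (\<forall>C'. compactin X C' \<longrightarrow> C' \<subseteq> C \<inter> N \<longrightarrow> P C')"
    and un: "\<And>A B. P A \<Longrightarrow> P B \<Longrightarrow> P (A \<union> B)" and emp: "P {}"
  shows "P C"
proof -
  define Y where "Y = subtopology X C"
  have tY: "topspace Y = C" using compactin_subset_topspace[OF C] by (auto simp: Y_def)
  have cY: "compact_space Y" using C by (simp add: Y_def compact_space_subtopology)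
  have "Hausdorff_space Y" using X by (simp add: Y_def Hausdorff_space_subtopology)
  then have "regular_space Y" using cY by (simp add: compact_Hausdorff_imp_regular_space)
  then have nb: "neighbourhood_base_of (closedin Y) Y" by (simp add: neighbourhood_base_of_closedin)
  have "\<exists>O' D. openin Y O' \<and> p \<in> O' \<and> O' \<subseteq> D \<and> D \<subseteq> C \<and> P D" if p: "p \<in> C" for p
  proof -
    obtain N where N: "openin X N" "p \<in> N" "\<And>C'. compactin X C' \<Longrightarrow> C' \<subseteq> C \<inter> N \<Longrightarrow> P C'"
      using loc[OF p] by blast
    have "openin Y (C \<inter> N)" using N(1) by (auto simp: Y_def openin_subtopology)
    then obtain O' D where D: "openin Y O'" "closedin Y D" "p \<in> O'" "O' \<subseteq> D" "D \<subseteq> C \<inter> N"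
      using nb p N(2) unfolding neighbourhood_base_of by (metis IntI)
    have "compactin Y D" using D(2) cY closedin_compact_space by blast
    then have "compactin X D" by (simp add: Y_def compactin_subtopology)
    then show ?thesis using D N(3) by blast
  qed
  then obtain O' D where OD: "\<And>p. p \<in> C \<Longrightarrow> openin Y (O' p) \<and> p \<in> O' p \<and> O' p \<subseteq> D p \<and> D p \<subseteq> C \<and> P (D p)"
    by metis
  obtain F where F: "finite F" "F \<subseteq> O' ` C" "C \<subseteq> \<Union>F"
  proof -
    have "(\<forall>U\<in>O' ` C. openin Y U) \<and> topspace Y \<subseteq> \<Union>(O' ` C)" using OD tY by auto
    then show ?thesis using cY tY that unfolding compact_space_def compactin_def by (metis )
  qed
  obtain G where G: "finite G" "G \<subseteq> C" "F = O' ` G" using F finite_subset_image by metis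
  have "\<forall>p\<in>G. P (D p)" using G(2) OD by blast
  with \<open>finite G\<close> have "P (\<Union>p\<in>G. D p)" by (induction G) (auto intro: un emp)
  moreover have "(\<Union>p\<in>G. D p) = C"
  proof
    show "(\<Union>p\<in>G. D p) \<subseteq> C" using OD G(2) by (meson UN_least subsetD)
    have "\<Union>F \<subseteq> (\<Union>p\<in>G. D p)" unfolding G(3) by (rule UN_mono[OF order_refl]) (use OD G(2) in blast)
    then show "C \<subseteq> (\<Union>p\<in>G. D p)" using F(3) by (rule subset_trans[rotated])
  qed
  ultimately show ?thesis by simp
qed

text \<open>On a small compact piece of the domain, the condition on \<open>G\<close> follows from
  two subbasic conditions, one on each family. The explicit dependence of \<open>G\<close> on the
  point of \<open>X\<close> allows multiplication by a scalar function of that point.\<close>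

lemma co_continuous_combine:
  assumes X: "Hausdorff_space X"
    and \<Phi>: "continuous_map T (compact_open X Y1) \<Phi>"
    and \<Psi>: "continuous_map T (compact_open X Y2) \<Psi>"
    and G: "continuous_map (prod_topology X (prod_topology Y1 Y2)) Z G"
  shows "continuous_map T (compact_open X Z) (\<lambda>f x. G (x, \<Phi> f x, \<Psi> f x))"
  unfolding continuous_map_compact_open_iff
proof (intro conjI ballI allI impI)
  have cont: "continuous_map X Y1 (\<Phi> f)" "continuous_map X Y2 (\<Psi> f)" if "f \<in> topspace T" for f
    using \<Phi> \<Psi> that unfolding continuous_map_compact_open_iff by auto
  have sub: "openin T {f\<in>topspace T. \<Phi> f ` K \<subseteq> W}" if "compactin X K" "openin Y1 W" for K W
    using \<Phi> that unfolding continuous_map_compact_open_iff by auto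
  have sub2: "openin T {f\<in>topspace T. \<Psi> f ` K \<subseteq> W}" if "compactin X K" "openin Y2 W" for K W
    using \<Psi> that unfolding continuous_map_compact_open_iff by auto
  show "continuous_map X Z (\<lambda>x. G (x, \<Phi> f x, \<Psi> f x))" if "f \<in> topspace T" for f
  proof -
    have "continuous_map X (prod_topology X (prod_topology Y1 Y2)) (\<lambda>x. (x, \<Phi> f x, \<Psi> f x))"
      using cont[OF that] by (intro continuous_map_pairedI) auto
    from continuous_map_compose[OF this G] show ?thesis by (simp add: o_def)
  qed
  fix C W assume CW: "compactin X C \<and> openin Z W"
  have CX: "C \<subseteq> topspace X" using CW compactin_subset_topspace by blast
  let ?S = "{f \<in> topspace T. (\<lambda>x. G (x, \<Phi> f x, \<Psi> f x)) ` C \<subseteq> W}"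
  show "openin T ?S"
  proof (subst openin_subopen, intro ballI)
    fix f0 assume f0: "f0 \<in> ?S"
    \<comment> \<open>The parameter \<open>f0\<close> is fixed, so a union of two pieces is treated
      by intersecting the two neighbourhoods of \<open>f0\<close>.\<close>
    define P where "P C' \<longleftrightarrow> (\<exists>Q. openin T Q \<and> f0 \<in> Q \<and> (\<forall>f\<in>Q. (\<lambda>x. G (x, \<Phi> f x, \<Psi> f x)) ` C' \<subseteq> W))" for C'
    have "P C"
    proof (rule compactin_local_induct[OF X])
      show "compactin X C" using CW by simp
      show "P {}" unfolding P_def using f0 by (intro exI[of _ "topspace T"]) auto
      show "P (A \<union> B)" if A: "P A" and B: "P B" for A B
      proof -
        obtain Q R where "openin T Q" "f0 \<in> Q" "\<forall>f\<in>Q. (\<lambda>x. G (x, \<Phi> f x, \<Psi> f x)) ` A \<subseteq> W"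
           "openin T R" "f0 \<in> R" "\<forall>f\<in>R. (\<lambda>x. G (x, \<Phi> f x, \<Psi> f x)) ` B \<subseteq> W"
          using A B unfolding P_def by blast
        then show ?thesis unfolding P_def by (intro exI[of _ "Q \<inter> R"]) (simp add: image_Un openin_Int)
      qed
      fix p assume p: "p \<in> C"
      have "openin (prod_topology X (prod_topology Y1 Y2))
              {z \<in> topspace (prod_topology X (prod_topology Y1 Y2)). G z \<in> W}" (is "openin _ ?O")
        using openin_continuous_map_preimage[OF G] CW by blast
      moreover have "(p, \<Phi> f0 p, \<Psi> f0 p) \<in> ?O"
        using f0 p CX cont[of f0] by (auto simp: continuous_map_def)
      ultimately obtain N0 N1 where N: "openin X N0" "openin (prod_topology Y1 Y2) N1" "p \<in> N0"
          "(\<Phi> f0 p, \<Psi> f0 p) \<in> N1" "N0 \<times> N1 \<subseteq> ?O"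
        unfolding openin_prod_topology_alt[of X] by meson
      obtain B1 B2 where B: "openin Y1 B1" "openin Y2 B2" "\<Phi> f0 p \<in> B1" "\<Psi> f0 p \<in> B2" "B1 \<times> B2 \<subseteq> N1"
        using N(2,4) unfolding openin_prod_topology_alt by meson
      \<comment> \<open>Besides \<open>N0\<close>, the preimages under the two functions at
        \<open>f0\<close> are intersected, so that on every compact piece inside \<open>?N\<close>
        the parameter \<open>f0\<close> itself satisfies the conditions defining
        \<open>?Q\<close>.\<close>
      let ?N = "N0 \<inter> {x\<in>topspace X. \<Phi> f0 x \<in> B1} \<inter> {x\<in>topspace X. \<Psi> f0 x \<in> B2}"
      have "openin X ?N" using N B f0 cont[of f0] by (intro openin_Int openin_continuous_map_preimage) auto
      moreover have "p \<in> ?N" using N B p CX by auto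
      moreover have "P C'" if C': "compactin X C'" "C' \<subseteq> C \<inter> ?N" for C'
      proof -
        let ?Q = "{f\<in>topspace T. \<Phi> f ` C' \<subseteq> B1} \<inter> {f\<in>topspace T. \<Psi> f ` C' \<subseteq> B2}"
        have "openin T ?Q" using sub[OF C'(1) B(1)] sub2[OF C'(1) B(2)] by auto
        moreover have "f0 \<in> ?Q" using f0 C' by auto
        moreover have "G (x, \<Phi> f x, \<Psi> f x) \<in> W" if "f \<in> ?Q" "x \<in> C'" for f x
        proof -
          have "(x, \<Phi> f x, \<Psi> f x) \<in> N0 \<times> N1" using that C'(2) B(5) by (auto simp: image_subset_iff subset_iff)
          then show ?thesis using N(5) by auto
        qed
        ultimately show ?thesis unfolding P_def by blast
      qed
      ultimately show "\<exists>N. openin X N \<and> p \<in> N \<and> (\<forall>C'. compactin X C' \<longrightarrow> C' \<subseteq> C \<inter> N \<longrightarrow> P C')"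
        by blast
    qed
    then obtain Q where "openin T Q" "f0 \<in> Q" "\<forall>f\<in>Q. (\<lambda>x. G (x, \<Phi> f x, \<Psi> f x)) ` C \<subseteq> W"
      unfolding P_def by blast
    then show "\<exists>Q. openin T Q \<and> f0 \<in> Q \<and> Q \<subseteq> ?S"
      using openin_subset by (intro exI[of _ Q]) blast
  qed
qed

text \<open>A compact set need not lie in \<open>A\<close> or in \<open>B\<close>, but it is a
  finite union of compact pieces that do, and a subbasic condition on a union is an intersection of
  conditions on the pieces.\<close>

lemma co_continuous_local:
  assumes X: "Hausdorff_space X" and A: "openin X A" and B: "openin X B"
    and AB: "topspace X \<subseteq> A \<union> B"
    and \<Phi>A: "continuous_map T (compact_open (subtopology X A) Y) \<Phi>"
    and \<Phi>B: "continuous_map T (compact_open (subtopology X B) Y) \<Phi>"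
  shows "continuous_map T (compact_open X Y) \<Phi>"
  unfolding continuous_map_compact_open_iff
proof (intro conjI ballI allI impI)
  fix f assume f: "f \<in> topspace T"
  then have "continuous_map (subtopology X A) Y (\<Phi> f)" "continuous_map (subtopology X B) Y (\<Phi> f)"
    using \<Phi>A \<Phi>B unfolding continuous_map_compact_open_iff by auto
  with A B AB show "continuous_map X Y (\<Phi> f)"
    by - (rule pasting_lemma[where I="{A,B}" and T="\<lambda>S. S" and f="\<lambda>_. \<Phi> f"], auto)
next
  fix C W assume CW: "compactin X C \<and> openin Y W"
  let ?P = "\<lambda>C'. openin T {f \<in> topspace T. \<Phi> f ` C' \<subseteq> W}"
  show "?P C"
  proof (rule compactin_local_induct[OF X])
    show "compactin X C" using CW by simp
    show "?P {}" by simp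
    show "?P (S \<union> S')" if "?P S" "?P S'" for S S'
    proof -
      have "{f \<in> topspace T. \<Phi> f ` (S \<union> S') \<subseteq> W} = {f \<in> topspace T. \<Phi> f ` S \<subseteq> W} \<inter> {f \<in> topspace T. \<Phi> f ` S' \<subseteq> W}"
        by auto
      then show ?thesis using that by (simp add: openin_Int)
    qed
    fix p assume "p \<in> C"
    then consider "p \<in> A" | "p \<in> B" using CW AB compactin_subset_topspace[of X C] by blast
    then show "\<exists>N. openin X N \<and> p \<in> N \<and> (\<forall>C'. compactin X C' \<longrightarrow> C' \<subseteq> C \<inter> N \<longrightarrow> ?P C')"
    proof cases
      case 1
      then show ?thesis using \<Phi>A A CW unfolding continuous_map_compact_open_iff
        by (intro exI[of _ A]) (auto simp: compactin_subtopology)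
    next
      case 2
      then show ?thesis using \<Phi>B B CW unfolding continuous_map_compact_open_iff
        by (intro exI[of _ B]) (auto simp: compactin_subtopology)
    qed
  qed
qed

text \<open>The image of a compact set under \<open>\<psi>\<close> is compact, so a subbasic
  condition on the composite is one on the given family.\<close>

lemma co_continuous_compose:
  assumes "continuous_map T (compact_open X Y) \<Phi>" "continuous_map Z X \<psi>"
  shows "continuous_map T (compact_open Z Y) (\<lambda>f z. \<Phi> f (\<psi> z))"
  unfolding continuous_map_compact_open_iff
proof (intro conjI ballI allI impI)
  show "continuous_map Z Y (\<lambda>z. \<Phi> f (\<psi> z))" if "f \<in> topspace T" for f
    using assms(1) continuous_map_compose[OF assms(2), of Y "\<Phi> f"] that
    unfolding continuous_map_compact_open_iff by (simp add: o_def)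
  show "openin T {f \<in> topspace T. (\<lambda>z. \<Phi> f (\<psi> z)) ` K \<subseteq> W}" if "compactin Z K \<and> openin Y W" for K W
    using assms(1) image_compactin[OF _ assms(2), of K] that
    unfolding continuous_map_compact_open_iff by (simp add: image_image[symmetric])
qed

lemma co_continuous_cong:
  assumes "continuous_map T (compact_open X Y) \<Phi>"
    and "\<And>f x. f \<in> topspace T \<Longrightarrow> x \<in> topspace X \<Longrightarrow> \<Phi> f x = \<Psi> f x"
  shows "continuous_map T (compact_open X Y) \<Psi>"
  unfolding continuous_map_compact_open_iff
proof (intro conjI ballI allI impI)
  fix f assume "f \<in> topspace T"
  then show "continuous_map X Y (\<Psi> f)"
    using assms continuous_map_eq[of X Y "\<Phi> f" "\<Psi> f"] unfolding continuous_map_compact_open_iff by auto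
next
  fix K W assume KW: "compactin X K \<and> openin Y W"
  then have "{f \<in> topspace T. \<Psi> f ` K \<subseteq> W} = {f \<in> topspace T. \<Phi> f ` K \<subseteq> W}"
    using assms(2) compactin_subset_topspace[of X K] by (auto simp: image_subset_iff subset_iff)
  then show "openin T {f \<in> topspace T. \<Psi> f ` K \<subseteq> W}"
    using assms(1) KW unfolding continuous_map_compact_open_iff by auto
qed

section \<open>Initial topologies\<close>

lemma topspace_initial_top [simp]: "topspace (initial_top A I Y \<phi>) = A"
  unfolding initial_top_def topology_generated_by_topspace Union_insert by (rule Un_absorb2) blast

lemma continuous_map_from_initial_top:
  assumes "i \<in> I" "\<And>f. f \<in> A \<Longrightarrow> \<phi> i f \<in> topspace (Y i)"
  shows "continuous_map (initial_top A I Y \<phi>) (Y i) (\<phi> i)"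
  unfolding continuous_map_def
proof (intro conjI allI impI)
  show "\<phi> i \<in> topspace (initial_top A I Y \<phi>) \<rightarrow> topspace (Y i)" using assms by auto
  fix W assume "openin (Y i) W"
  then have "openin (initial_top A I Y \<phi>) (A \<inter> \<phi> i -` W)"
    unfolding initial_top_def by (intro topology_generated_by_Basis) (use assms in auto)
  moreover have "A \<inter> \<phi> i -` W = {x \<in> topspace (initial_top A I Y \<phi>). \<phi> i x \<in> W}" by auto
  ultimately show "openin (initial_top A I Y \<phi>) {x \<in> topspace (initial_top A I Y \<phi>). \<phi> i x \<in> W}" by simp
qed

lemma continuous_map_id_initial_top:
  assumes "topspace T = A" "\<And>i. i \<in> I \<Longrightarrow> continuous_map T (Y i) (\<phi> i)"
  shows "continuous_map T (initial_top A I Y \<phi>) (\<lambda>f. f)"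
  unfolding initial_top_def continuous_on_generated_topo_iff
proof (intro conjI allI impI)
  fix S assume "S \<in> insert A (\<Union>i\<in>I. {A \<inter> \<phi> i -` W | W. openin (Y i) W})"
  then consider "S = A" | i W where "i \<in> I" "openin (Y i) W" "S = A \<inter> \<phi> i -` W" by auto
  then show "openin T ((\<lambda>f. f) -` S \<inter> topspace T)"
  proof cases
    case 1 then show ?thesis using assms(1) by (metis inf.idem openin_topspace vimage_ident)
  next
    case 2
    have "openin T {x \<in> topspace T. \<phi> i x \<in> W}" using openin_continuous_map_preimage[OF assms(2)] 2 by blast
    moreover have "(\<lambda>f. f) -` S \<inter> topspace T = {x \<in> topspace T. \<phi> i x \<in> W}" using 2 assms(1) by auto
    ultimately show ?thesis by simp
  qed
qed (use assms(1) in auto)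

lemma topology_eq_id:
  assumes "continuous_map S T (\<lambda>x. x)" "continuous_map T S (\<lambda>x. x)"
  shows "S = T"
proof -
  have "topspace S = topspace T" using assms unfolding continuous_map_def by auto
  moreover have "openin S U" if "openin T U" for U
  proof -
    have "{x \<in> topspace S. x \<in> U} = U" using openin_subset[OF that] calculation by blast
    then show ?thesis using openin_continuous_map_preimage[OF assms(1) that] by simp
  qed
  moreover have "openin T U" if "openin S U" for U
  proof -
    have "{x \<in> topspace T. x \<in> U} = U" using openin_subset[OF that] calculation by blast
    then show ?thesis using openin_continuous_map_preimage[OF assms(2) that] by simp
  qed
  ultimately show ?thesis by (auto simp: topology_eq)
qed

section \<open>Polynomial maps and sets with dense interior\<close>

text \<open>Generation by constants, coordinates, sums and products gives continuity and polynomial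
  difference quotients by induction. The functions live on all of
  \<open>nat \<Rightarrow> 'k\<close> but read only the coordinates below \<open>n\<close>, so they
  can be applied to longer vectors without restricting them.\<close>

inductive poly_fun :: "nat \<Rightarrow> ((nat \<Rightarrow> 'k::field) \<Rightarrow> 'k) \<Rightarrow> bool" for n where
  const: "poly_fun n (\<lambda>_. c)"
| var: "i < n \<Longrightarrow> poly_fun n (\<lambda>x. x i)"
| add: "poly_fun n p \<Longrightarrow> poly_fun n q \<Longrightarrow> poly_fun n (\<lambda>x. p x + q x)"
| mult: "poly_fun n p \<Longrightarrow> poly_fun n q \<Longrightarrow> poly_fun n (\<lambda>x. p x * q x)"

lemma poly_fun_uminus: "poly_fun n p \<Longrightarrow> poly_fun n (\<lambda>x. - p x)"
  using poly_fun.mult[OF poly_fun.const[of n "-1"], of p] by simp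

lemma poly_fun_diff: "poly_fun n p \<Longrightarrow> poly_fun n q \<Longrightarrow> poly_fun n (\<lambda>x. p x - q x)"
  using poly_fun.add[OF _ poly_fun_uminus, of n p q] by simp

lemmas poly_fun_intros = poly_fun.intros poly_fun_uminus poly_fun_diff

lemma poly_fun_agree: "poly_fun n p \<Longrightarrow> (\<And>i. i < n \<Longrightarrow> x i = y i) \<Longrightarrow> p x = p y"
  by (induction rule: poly_fun.induct) auto

lemma poly_fun_mono: "poly_fun n p \<Longrightarrow> n \<le> m \<Longrightarrow> poly_fun m p"
  by (induction rule: poly_fun.induct) (auto intro: poly_fun.intros)

lemma poly_fun_subst:
  "poly_fun n p \<Longrightarrow> (\<And>i. i < n \<Longrightarrow> poly_fun m (\<lambda>x. \<psi> x i)) \<Longrightarrow> poly_fun m (\<lambda>x. p (\<psi> x))"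
  by (induction rule: poly_fun.induct) (auto intro: poly_fun.intros)

lemma cat3_simps [simp]:
  "i < n \<Longrightarrow> cat3 n x y t i = x i"
  "i < n \<Longrightarrow> cat3 n x y t (n + i) = y i"
  "cat3 n x y t (2 * n) = t" "cat3 n x y t (n * 2) = t"
  by (auto simp: cat3_def)

text \<open>The difference quotient of a polynomial is again a polynomial in (x,y,t), also at t = 0.
  For products this is the exact rule (pq)^[1] = p q^[1] + p^[1] q + t p^[1] q^[1].\<close>

lemma poly_fun_tangent:
  "poly_fun n p \<Longrightarrow> \<exists>q. poly_fun (2*n+1) q \<and> (\<forall>x y t. p (vadd n x t y) = p x + t * q (cat3 n x y t))"
proof (induction rule: poly_fun.induct)
  case (const c)
  show ?case by (rule exI[of _ "\<lambda>_. 0"]) (auto intro: poly_fun.intros)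
next
  case (var i)
  then show ?case by (intro exI[of _ "\<lambda>z. z (n + i)"]) (auto intro: poly_fun.intros simp: vadd_def)
next
  case (add p q)
  then obtain p' q' where "poly_fun (2*n+1) p'" "\<forall>x y t. p (vadd n x t y) = p x + t * p' (cat3 n x y t)"
    "poly_fun (2*n+1) q'" "\<forall>x y t. q (vadd n x t y) = q x + t * q' (cat3 n x y t)" by blast
  then show ?case by (intro exI[of _ "\<lambda>z. p' z + q' z"]) (auto intro: poly_fun.intros simp: algebra_simps)
next
  case (mult p q)
  then obtain p' q' where H: "poly_fun (2*n+1) p'" "\<forall>x y t. p (vadd n x t y) = p x + t * p' (cat3 n x y t)"
    "poly_fun (2*n+1) q'" "\<forall>x y t. q (vadd n x t y) = q x + t * q' (cat3 n x y t)" by blast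
  \<comment> \<open>The first \<open>n\<close> coordinates of the coded triple are those of
    \<open>x\<close>, and no others are read.\<close>
  have [simp]: "p (cat3 n x y t) = p x" "q (cat3 n x y t) = q x" for x y t
    using mult.hyps by (auto intro: poly_fun_agree)
  have "poly_fun (2*n+1) p" "poly_fun (2*n+1) q" using mult.hyps by (auto intro: poly_fun_mono)
  then show ?case using H
    by (intro exI[of _ "\<lambda>z. p z * q' z + p' z * q z + z (2*n) * (p' z * q' z)"])
      (auto intro!: poly_fun.intros simp: algebra_simps)
qed

definition poly_map :: "nat \<Rightarrow> nat \<Rightarrow> ((nat \<Rightarrow> 'k::field) \<Rightarrow> nat \<Rightarrow> 'k) \<Rightarrow> bool" where
  "poly_map n m \<psi> \<longleftrightarrow> (\<forall>x. \<psi> x \<in> extensional {..<m}) \<and> (\<forall>i<m. poly_fun n (\<lambda>x. \<psi> x i))"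

lemma poly_map_agree: "poly_map n m \<psi> \<Longrightarrow> (\<And>i. i < n \<Longrightarrow> x i = y i) \<Longrightarrow> \<psi> x = \<psi> y"
  unfolding poly_map_def by (rule extensionalityI[of _ "{..<m}"]) (auto intro: poly_fun_agree)

lemma poly_map_mono: "poly_map n m \<psi> \<Longrightarrow> n \<le> n' \<Longrightarrow> poly_map n' m \<psi>"
  unfolding poly_map_def using poly_fun_mono by blast

lemma poly_map_cat3:
  "poly_map n m \<psi> \<Longrightarrow> poly_map n m \<eta> \<Longrightarrow> poly_fun n r \<Longrightarrow>
   poly_map n (2*m+1) (\<lambda>z. cat3 m (\<psi> z) (\<eta> z) (r z))"
  unfolding poly_map_def
proof (intro conjI allI impI)
  fix i assume H: "(\<forall>x. \<psi> x \<in> extensional {..<m}) \<and> (\<forall>i<m. poly_fun n (\<lambda>x. \<psi> x i))"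
    "(\<forall>x. \<eta> x \<in> extensional {..<m}) \<and> (\<forall>i<m. poly_fun n (\<lambda>x. \<eta> x i))" "poly_fun n r" "i < 2*m+1"
  consider "i < m" | "\<not> i < m" "i < 2*m" | "i = 2*m" using H(4) by linarith
  then show "poly_fun n (\<lambda>z. cat3 m (\<psi> z) (\<eta> z) (r z) i)"
    using H by cases (auto simp: cat3_def)
qed (auto simp: cat3_def extensional_def)

text \<open>The map \<open>\<eta>\<close> is the difference quotient of \<open>\<psi>\<close>.
  Together with \<open>\<psi>\<close> and t it forms the substitution (x,y,t) |-> (\<psi>(x),
  \<eta>(x,y,t), t) of the chain rule.\<close>

lemma poly_map_tangent:
  assumes "poly_map n m \<psi>"
  obtains \<eta> where "poly_map (2*n+1) m \<eta>"
    "\<And>x y t. vadd m (\<psi> x) t (\<eta> (cat3 n x y t)) = \<psi> (vadd n x t y)"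
proof -
  have "\<forall>i. \<exists>q. i < m \<longrightarrow> poly_fun (2*n+1) q \<and>
      (\<forall>x y t. \<psi> (vadd n x t y) i = \<psi> x i + t * q (cat3 n x y t))"
    using assms poly_fun_tangent[of n "\<lambda>x. \<psi> x _"] unfolding poly_map_def by meson
  then obtain q where q: "\<And>i. i < m \<Longrightarrow> poly_fun (2*n+1) (q i)"
     "\<And>i x y t. i < m \<Longrightarrow> \<psi> (vadd n x t y) i = \<psi> x i + t * q i (cat3 n x y t)" by metis
  show ?thesis
  proof (rule that[of "\<lambda>z. \<lambda>i\<in>{..<m}. q i z"])
    show "poly_map (2*n+1) m (\<lambda>z. \<lambda>i\<in>{..<m}. q i z)" using q by (auto simp: poly_map_def)
    show "vadd m (\<psi> x) t (\<lambda>i\<in>{..<m}. q i (cat3 n x y t)) = \<psi> (vadd n x t y)" for x y t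
      by (rule extensionalityI[of _ "{..<m}"])
        (use assms q(2) in \<open>auto simp: vadd_def extensional_def poly_map_def\<close>)
  qed
qed

section \<open>Reading base point, direction and end point off a coded triple\<close>

definition base_part :: "nat \<Rightarrow> (nat \<Rightarrow> 'k) \<Rightarrow> (nat \<Rightarrow> 'k)" where
  "base_part n z = restrict z {..<n}"

definition dir_part :: "nat \<Rightarrow> (nat \<Rightarrow> 'k) \<Rightarrow> (nat \<Rightarrow> 'k)" where
  "dir_part n z = (\<lambda>i\<in>{..<n}. z (n + i))"

definition end_point :: "nat \<Rightarrow> (nat \<Rightarrow> 'k::field) \<Rightarrow> (nat \<Rightarrow> 'k)" where
  "end_point n z = vadd n (base_part n z) (z (2*n)) (dir_part n z)"

lemma poly_map_base: "poly_map (2*n+1) n (base_part n)"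
  by (auto simp: poly_map_def base_part_def intro!: poly_fun.intros)

lemma poly_map_end: "poly_map (2*n+1) n (end_point n :: (nat \<Rightarrow> 'k::field) \<Rightarrow> _)"
  unfolding poly_map_def
proof (intro conjI allI impI)
  show "end_point n x \<in> extensional {..<n}" for x :: "nat \<Rightarrow> 'k"
    by (simp add: end_point_def vadd_def extensional_def)
  show "poly_fun (2*n+1) (\<lambda>x :: nat \<Rightarrow> 'k. end_point n x i)" if "i < n" for i
    using that by (auto simp: end_point_def base_part_def dir_part_def vadd_def intro!: poly_fun.intros)
qed

lemma topspace_Kpow: "topspace TK = UNIV \<Longrightarrow> topspace (Kpow TK n) = extensional {..<n}"
  by (auto simp: Kpow_def PiE_def)

lemma cat3_parts:
  assumes "x \<in> extensional {..<n}" "y \<in> extensional {..<n}"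
  shows "base_part n (cat3 n x y t) = x" "dir_part n (cat3 n x y t) = y"
    "end_point n (cat3 n x y t) = vadd n x t y"
proof -
  show 1: "base_part n (cat3 n x y t) = x" using assms
    by (auto simp: base_part_def extensional_def fun_eq_iff cat3_def)
  show 2: "dir_part n (cat3 n x y t) = y" using assms
    by (auto simp: dir_part_def extensional_def fun_eq_iff cat3_def)
  show "end_point n (cat3 n x y t) = vadd n x t y" unfolding end_point_def 1 2 by simp
qed

lemma cat3_collapse:
  assumes "z \<in> extensional {..<2*n+1}"
  shows "cat3 n (base_part n z) (dir_part n z) (z (2*n)) = z"
proof
  fix i
  consider "i < n" | "\<not> i < n" "i < 2*n" | "i = 2*n" | "i > 2*n" by linarith
  then show "cat3 n (base_part n z) (dir_part n z) (z (2*n)) i = z i"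
    using assms by cases (auto simp: cat3_def base_part_def dir_part_def extensional_def)
qed

section \<open>Topology of K^n, sets with dense interior, uniqueness of continuous
  extensions\<close>

locale top_field =
  fixes TK :: "'k::field topology"
  assumes TK: "topological_field TK"
begin

lemma topspace_TK [simp]: "topspace TK = UNIV"
  using TK by (simp add: topological_field_def)

lemma topspace_Kn [simp]: "topspace (Kpow TK n) = extensional {..<n}"
  by (rule topspace_Kpow) simp

lemma Hausdorff_Kn: "Hausdorff_space (Kpow TK n)"
  using TK by (simp add: topological_field_def Kpow_def Hausdorff_space_product_topology)

lemma continuous_poly_fun: "poly_fun n p \<Longrightarrow> continuous_map (Kpow TK n) TK p"
proof (induction rule: poly_fun.induct)
  case (const c) then show ?case by simp
next
  case (var i) then show ?case unfolding Kpow_def by (intro continuous_map_product_projection) simp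
next
  case (add p q)
  then have "continuous_map (Kpow TK n) (prod_topology TK TK) (\<lambda>x. (p x, q x))"
    by (intro continuous_map_pairedI)
  from continuous_map_compose[OF this, of TK "\<lambda>(a,b). a + b"] TK
  show ?case by (simp add: o_def topological_field_def)
next
  case (mult p q)
  then have "continuous_map (Kpow TK n) (prod_topology TK TK) (\<lambda>x. (p x, q x))"
    by (intro continuous_map_pairedI)
  from continuous_map_compose[OF this, of TK "\<lambda>(a,b). a * b"] TK
  show ?case by (simp add: o_def topological_field_def)
qed

lemma continuous_poly_map: "poly_map n m \<psi> \<Longrightarrow> continuous_map (Kpow TK n) (Kpow TK m) \<psi>"
  unfolding poly_map_def Kpow_def[of _ m]
  by (intro continuous_map_coordinatewise_then_product) (auto intro: continuous_poly_fun simp: extensional_def)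

lemma openin_compl_0: "openin TK (-{0})"
proof -
  have "closedin TK {0}" using TK
    by (simp add: topological_field_def Hausdorff_imp_t1_space closedin_t1_singleton)
  then show ?thesis by (simp add: closedin_def Compl_eq_Diff_UNIV)
qed

lemma openin_last_nonzero: "openin (Kpow TK (2*n+1)) {z \<in> extensional {..<2*n+1}. z (2*n) \<noteq> 0}"
  using openin_continuous_map_preimage[OF continuous_poly_fun openin_compl_0, of "2*n+1" "\<lambda>z. z (2*n)"]
  by (simp add: poly_fun.var)

text \<open>This presents V^[1] as an intersection of preimages under two polynomial maps; openness
  in V^[1] and inclusions between such sets are then settled at the base point and the end point
  separately.\<close>

lemma mem_V1_iff:
  assumes "V \<subseteq> extensional {..<n}"
  shows "z \<in> BGN_V1 TK n V \<longleftrightarrow> z \<in> extensional {..<2*n+1} \<and> base_part n z \<in> V \<and> end_point n z \<in> V"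
proof
  assume "z \<in> BGN_V1 TK n V"
  then obtain x y t where "z = cat3 n x y t" "x \<in> V" "y \<in> extensional {..<n}" "vadd n x t y \<in> V"
    by (auto simp: BGN_V1_def)
  moreover have "cat3 n x y t \<in> extensional {..<2*n+1}" by (auto simp: cat3_def extensional_def)
  ultimately show "z \<in> extensional {..<2*n+1} \<and> base_part n z \<in> V \<and> end_point n z \<in> V"
    using assms by (auto simp: cat3_parts)
next
  assume z: "z \<in> extensional {..<2*n+1} \<and> base_part n z \<in> V \<and> end_point n z \<in> V"
  then have "z = cat3 n (base_part n z) (dir_part n z) (z (2*n))" by (simp add: cat3_collapse)
  moreover have "dir_part n z \<in> topspace (Kpow TK n)" by (simp add: dir_part_def)
  ultimately show "z \<in> BGN_V1 TK n V" using z unfolding BGN_V1_def end_point_def by blast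
qed

lemma V1_extensional: "BGN_V1 TK n V \<subseteq> extensional {..<2*n+1}"
  by (auto simp: BGN_V1_def cat3_def extensional_def)

lemma V1_mono: "V \<subseteq> W \<Longrightarrow> BGN_V1 TK n V \<subseteq> BGN_V1 TK n W"
  by (auto simp: BGN_V1_def)

text \<open>For \<open>V\<close> inside K^n this says that \<open>V\<close> lies in the closure of
  its interior, in the form in which a given point is moved into a small open part of
  \<open>V\<close>.\<close>

definition dense_interior :: "nat \<Rightarrow> (nat \<Rightarrow> 'k) set \<Rightarrow> bool" where
  "dense_interior n V \<longleftrightarrow> V \<subseteq> extensional {..<n} \<and>
     (\<forall>O'. openin (Kpow TK n) O' \<and> V \<inter> O' \<noteq> {} \<longrightarrow>
        (\<exists>O''. openin (Kpow TK n) O'' \<and> O'' \<noteq> {} \<and> O'' \<subseteq> V \<inter> O'))"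

text \<open>Nonempty open subsets of K are infinite, so inside a basic box the coordinates can be
  chosen one after the other, each avoiding 0 and its predecessors.\<close>

lemma open_point_distinct:
  assumes "openin (Kpow TK n) O'" "O' \<noteq> {}"
  shows "\<exists>x\<in>O'. inj_on x {..<n} \<and> (\<forall>i<n. x i \<noteq> 0)"
proof -
  obtain x0 where x0: "x0 \<in> O'" using assms by auto
  obtain B where B: "\<forall>i<n. openin TK (B i)" "x0 \<in> Pi\<^sub>E {..<n} B" "Pi\<^sub>E {..<n} B \<subseteq> O'"
    using assms(1) x0 unfolding Kpow_def openin_product_topology_alt by (metis lessThan_iff)
  \<comment> \<open>A finite open set would, by T1, contain an open singleton; its translates would
    make all singletons open, contrary to non-discreteness.\<close>
  have inf: "infinite W" if W: "openin TK W" "a \<in> W" for W a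
  proof
    assume fin: "finite W"
    have t1: "t1_space TK" using TK by (simp add: topological_field_def Hausdorff_imp_t1_space)
    have "finite (W - {a})" using fin by simp
    then have "closedin TK (W - {a})" using t1 by (simp add: t1_space_closedin_finite)
    then have "openin TK (W - (W - {a}))" using W by (intro openin_diff)
    moreover have "W - (W - {a}) = {a}" using W by auto
    ultimately have a: "openin TK {a}" by simp
    have "openin TK {b}" for b
    proof -
      have c: "continuous_map TK (prod_topology TK TK) (\<lambda>x. (x, a - b))"
        by (intro continuous_map_pairedI) auto
      have "continuous_map TK TK (\<lambda>x. x + (a - b))"
        using continuous_map_compose[OF c, of TK "\<lambda>(a,b). a + b"] TK
        by (simp add: o_def topological_field_def)
      from openin_continuous_map_preimage[OF this a] have "openin TK {x. x + (a - b) = a}" by simp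
      moreover have "{x. x + (a - b) = a} = {b}" by (auto simp: algebra_simps)
      ultimately show ?thesis by simp
    qed
    then have "TK = discrete_topology UNIV" using discrete_topology_unique[of UNIV TK] by auto
    then show False using TK by (simp add: topological_field_def)
  qed
  have "\<exists>y. inj_on y {..<m} \<and> (\<forall>i<m. y i \<noteq> 0 \<and> y i \<in> B i)" if "m \<le> n" for m
    using that
  proof (induction m)
    case 0 then show ?case by auto
  next
    case (Suc m)
    then obtain y where y: "inj_on y {..<m}" "\<forall>i<m. y i \<noteq> 0 \<and> y i \<in> B i" by auto
    have "infinite (B m)" using B Suc.prems inf[of "B m" "x0 m"] by (auto simp: PiE_iff)
    then have "infinite (B m - insert 0 (y ` {..<m}))" by simp
    then obtain b where b: "b \<in> B m - insert 0 (y ` {..<m})" using infinite_imp_nonempty by blast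
    have "inj_on (y(m := b)) {..<Suc m}"
      using y(1) b by (auto simp: inj_on_def less_Suc_eq)
    moreover have "\<forall>i<Suc m. (y(m := b)) i \<noteq> 0 \<and> (y(m := b)) i \<in> B i"
      using y(2) b by (auto simp: less_Suc_eq)
    ultimately show ?case by blast
  qed
  from this[of n] obtain y where y: "inj_on y {..<n}" "\<forall>i<n. y i \<noteq> 0 \<and> y i \<in> B i" by auto
  have "restrict y {..<n} \<in> Pi\<^sub>E {..<n} B" using y(2) by (auto simp: PiE_iff)
  then have "restrict y {..<n} \<in> O'" using B(3) by blast
  moreover have "inj_on (restrict y {..<n}) {..<n}" using y(1) by (auto simp: inj_on_def)
  ultimately show ?thesis using y(2) by (intro bexI[of _ "restrict y {..<n}"]) auto
qed

lemma dense_interior_closure: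
  assumes V: "dense_interior n V"
    and P: "\<And>x. x \<in> V \<Longrightarrow> inj_on x {..<n} \<Longrightarrow> (\<And>i. i < n \<Longrightarrow> x i \<noteq> 0) \<Longrightarrow> P x"
  shows "V \<subseteq> subtopology (Kpow TK n) V closure_of {x\<in>V. P x}"
proof -
  have "x \<in> Kpow TK n closure_of {x\<in>V. P x}" if x: "x \<in> V" for x
    unfolding in_closure_of
  proof (intro conjI allI impI)
    show "x \<in> topspace (Kpow TK n)" using x V by (auto simp: dense_interior_def)
    fix O' assume "x \<in> O' \<and> openin (Kpow TK n) O'"
    then obtain O'' where O: "openin (Kpow TK n) O''" "O'' \<noteq> {}" "O'' \<subseteq> V \<inter> O'"
      using V x unfolding dense_interior_def by blast
    from open_point_distinct[OF O(1,2)] obtain y where "y \<in> O''" "inj_on y {..<n}" "\<forall>i<n. y i \<noteq> 0"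
      by blast
    then show "\<exists>y. y \<in> {x\<in>V. P x} \<and> y \<in> O'" using O P by blast
  qed
  then show ?thesis unfolding closure_of_subtopology by (auto simp: Collect_conj_eq Int_absorb1)
qed

text \<open>One density principle with two uses: nonzero coordinates give t nonzero for difference
  quotients, and distinct coordinates give distinct nodes for divided differences.\<close>

lemma dense_interior_unique:
  assumes "dense_interior n V"
    and "\<And>x. x \<in> V \<Longrightarrow> inj_on x {..<n} \<Longrightarrow> (\<And>i. i < n \<Longrightarrow> x i \<noteq> 0) \<Longrightarrow> g x = h x"
    and "Hausdorff_space Y" "continuous_map (subtopology (Kpow TK n) V) Y g"
      "continuous_map (subtopology (Kpow TK n) V) Y h" and x: "x \<in> V"
  shows "g x = h x"
proof (rule forall_in_closure_of_eq[OF _ assms(3-5)])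
  show "x \<in> subtopology (Kpow TK n) V closure_of {x\<in>V. g x = h x}"
    using dense_interior_closure[OF assms(1), of "\<lambda>x. g x = h x"] assms(2) x by blast
qed auto

lemma dense_interior_Int_open:
  assumes "dense_interior n V" "openin (Kpow TK n) O'"
  shows "dense_interior n (V \<inter> O')"
  unfolding dense_interior_def
proof (intro conjI allI impI)
  show "V \<inter> O' \<subseteq> extensional {..<n}" using assms(1) by (auto simp: dense_interior_def)
  fix Q assume "openin (Kpow TK n) Q \<and> V \<inter> O' \<inter> Q \<noteq> {}"
  then have "openin (Kpow TK n) (O' \<inter> Q) \<and> V \<inter> (O' \<inter> Q) \<noteq> {}" using assms(2) by (auto simp: Int_assoc)
  then have "\<exists>O''. openin (Kpow TK n) O'' \<and> O'' \<noteq> {} \<and> O'' \<subseteq> V \<inter> (O' \<inter> Q)"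
    using assms(1) unfolding dense_interior_def by blast
  then show "\<exists>O''. openin (Kpow TK n) O'' \<and> O'' \<noteq> {} \<and> O'' \<subseteq> V \<inter> O' \<inter> Q" by (simp add: Int_assoc)
qed

lemma openin_poly_preimage:
  assumes "poly_map n m \<psi>" "openin (Kpow TK m) W"
  shows "openin (Kpow TK n) {x \<in> extensional {..<n}. \<psi> x \<in> W}"
  using openin_continuous_map_preimage[OF continuous_poly_map[OF assms(1)] assms(2)] by simp

text \<open>A given point of V^[1] is moved so that its base point and end point both lie in open
  parts of \<open>V\<close>. If t = 0 it suffices to move x, since the end point follows. If t is
  nonzero, t is kept, x and w = x + ty are moved independently, and y = (w - x)/t is
  recovered.\<close>

lemma dense_interior_V1:
  assumes V: "dense_interior n V"
  shows "dense_interior (2*n+1) (BGN_V1 TK n V)"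
  unfolding dense_interior_def
proof (intro conjI allI impI)
  show "BGN_V1 TK n V \<subseteq> extensional {..<2*n+1}" by (rule V1_extensional)
  have Ve: "V \<subseteq> extensional {..<n}" using V by (simp add: dense_interior_def)
  fix Q assume Q: "openin (Kpow TK (2*n+1)) Q \<and> BGN_V1 TK n V \<inter> Q \<noteq> {}"
  then obtain x y t where z: "cat3 n x y t \<in> Q" "x \<in> V" "y \<in> extensional {..<n}" "vadd n x t y \<in> V"
    by (auto simp: BGN_V1_def)
  let ?I = "\<lambda>O1 O2. {z \<in> extensional {..<2*n+1}. base_part n z \<in> O1} \<inter> {z \<in> extensional {..<2*n+1}. end_point n z \<in> O2}"
  have open_I: "openin (Kpow TK (2*n+1)) (?I O1 O2 \<inter> Q)"
    if "openin (Kpow TK n) O1" "openin (Kpow TK n) O2" for O1 O2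
    by (rule openin_Int[OF openin_Int[OF openin_poly_preimage[OF poly_map_base that(1)]
          openin_poly_preimage[OF poly_map_end that(2)]] conjunct1[OF Q]])
  \<comment> \<open>For open \<open>O1\<close> and \<open>O2\<close> inside \<open>V\<close> the set
    \<open>?I O1 O2\<close> is open and contained in V^[1], so only a point of it in
    \<open>Q\<close> has to be produced.\<close>
  have "\<exists>O1 O2. openin (Kpow TK n) O1 \<and> openin (Kpow TK n) O2 \<and> O1 \<subseteq> V \<and> O2 \<subseteq> V \<and> ?I O1 O2 \<inter> Q \<noteq> {}"
  proof (cases "t = 0")
    case True
    \<comment> \<open>The \<open>restrict\<close> is the identity on K^n; it only makes all values
      extensional, as \<open>poly_map\<close> demands of every argument.\<close>
    have p: "poly_map n (2*n+1) (\<lambda>x'. cat3 n (restrict x' {..<n}) y 0)"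
      using z(3) by (intro poly_map_cat3) (auto simp: poly_map_def intro: poly_fun.intros)
    let ?Q = "{x' \<in> extensional {..<n}. cat3 n (restrict x' {..<n}) y 0 \<in> Q}"
    have rx: "restrict x' {..<n} = x'" if "x' \<in> extensional {..<n}" for x' :: "nat \<Rightarrow> 'k"
      using that by (simp add: extensional_restrict)
    have "x \<in> V \<inter> ?Q" using z Ve True rx by auto
    then obtain O1 where O1: "openin (Kpow TK n) O1" "O1 \<noteq> {}" "O1 \<subseteq> V \<inter> ?Q"
      using V openin_poly_preimage[OF p, of Q] Q unfolding dense_interior_def by blast
    then obtain x' where x': "x' \<in> O1" by auto
    then have e: "x' \<in> extensional {..<n}" using O1 by auto
    have "vadd n x' 0 y = x'" using e by (auto simp: vadd_def extensional_def)
    then have "cat3 n x' y 0 \<in> ?I O1 O1 \<inter> Q"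
      using x' O1 e z(3) rx[OF e] by (auto simp: cat3_parts) (auto simp: cat3_def extensional_def)
    then show ?thesis using O1 by blast
  next
    case False
    define w where "w = vadd n x t y"
    have p: "poly_map n (2*n+1) (\<lambda>x'. cat3 n (restrict x' {..<n}) (\<lambda>i\<in>{..<n}. (w i - x' i) * inverse t) t)"
      by (intro poly_map_cat3) (auto simp: poly_map_def intro!: poly_fun_intros)
    let ?Q = "{x' \<in> extensional {..<n}. cat3 n (restrict x' {..<n}) (\<lambda>i\<in>{..<n}. (w i - x' i) * inverse t) t \<in> Q}"
    have rx: "restrict x' {..<n} = x'" if "x' \<in> extensional {..<n}" for x' :: "nat \<Rightarrow> 'k"
      using that by (simp add: extensional_restrict)
    have "(\<lambda>i\<in>{..<n}. (w i - x i) * inverse t) = y"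
      using z(3) False by (auto simp: w_def vadd_def fun_eq_iff extensional_def)
    then have "x \<in> V \<inter> ?Q" using z Ve rx by auto
    then obtain O1 where O1: "openin (Kpow TK n) O1" "O1 \<noteq> {}" "O1 \<subseteq> V \<inter> ?Q"
      using V openin_poly_preimage[OF p, of Q] Q unfolding dense_interior_def by blast
    then obtain x' where x': "x' \<in> O1" by auto
    then have e: "x' \<in> extensional {..<n}" using O1 by auto
    \<comment> \<open>The second move keeps the new base point \<open>x'\<close> fixed and varies
      the end point.\<close>
    have p2: "poly_map n (2*n+1) (\<lambda>w. cat3 n x' (\<lambda>i\<in>{..<n}. (w i - x' i) * inverse t) t)"
      using e by (intro poly_map_cat3) (auto simp: poly_map_def intro!: poly_fun_intros)
    let ?Q2 = "{w \<in> extensional {..<n}. cat3 n x' (\<lambda>i\<in>{..<n}. (w i - x' i) * inverse t) t \<in> Q}"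
    have "w \<in> V \<inter> ?Q2" using z x' O1 Ve rx[OF e] by (auto simp: w_def)
    then obtain O2 where O2: "openin (Kpow TK n) O2" "O2 \<noteq> {}" "O2 \<subseteq> V \<inter> ?Q2"
      using V openin_poly_preimage[OF p2, of Q] Q unfolding dense_interior_def by blast
    then obtain w' where w': "w' \<in> O2" by auto
    then have e': "w' \<in> extensional {..<n}" using O2 by auto
    let ?y = "\<lambda>i\<in>{..<n}. (w' i - x' i) * inverse t"
    have "a + t * ((b - a) * inverse t) = b" for a b using False by (simp add: field_simps)
    then have "vadd n x' t ?y = w'" using e' by (simp add: vadd_def extensional_def fun_eq_iff)
    then have "cat3 n x' ?y t \<in> ?I O1 O2 \<inter> Q"
      using x' w' O2 e by (auto simp: cat3_parts) (auto simp: cat3_def extensional_def)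
    then show ?thesis using O1 O2 by blast
  qed
  then obtain O1 O2 where O: "openin (Kpow TK n) O1" "openin (Kpow TK n) O2" "O1 \<subseteq> V" "O2 \<subseteq> V" "?I O1 O2 \<inter> Q \<noteq> {}"
    by blast
  have "?I O1 O2 \<subseteq> BGN_V1 TK n V" using O(3,4) by (auto simp: mem_V1_iff[OF Ve])
  then show "\<exists>O''. openin (Kpow TK (2*n+1)) O'' \<and> O'' \<noteq> {} \<and> O'' \<subseteq> BGN_V1 TK n V \<inter> Q"
    using open_I[OF O(1,2)] O(5) by (intro exI[of _ "?I O1 O2 \<inter> Q"]) blast
qed

end

section \<open>Families of functions of class BGN\<close>

locale top_vec = top_field TK for TK :: "'k::field topology" +
  fixes TF :: "'f::ab_group_add topology" and sc :: "'k \<Rightarrow> 'f \<Rightarrow> 'f"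
  assumes TF: "topological_vector_space TK sc TF"
begin

sublocale vector_space sc
  using TF by (simp add: topological_vector_space_def)

lemma topspace_TF [simp]: "topspace TF = UNIV"
  using TF by (simp add: topological_vector_space_def)

lemma Hausdorff_TF: "Hausdorff_space TF"
  using TF by (simp add: topological_vector_space_def)

abbreviation Ksub :: "nat \<Rightarrow> (nat \<Rightarrow> 'k) set \<Rightarrow> (nat \<Rightarrow> 'k) topology" where
  "Ksub n V \<equiv> subtopology (Kpow TK n) V"

lemma Hausdorff_Ksub: "Hausdorff_space (Ksub n V)"
  by (intro Hausdorff_space_subtopology Hausdorff_Kn)

lemma co_continuous_add:
  assumes "Hausdorff_space X" "continuous_map T (compact_open X TF) \<Phi>" "continuous_map T (compact_open X TF) \<Psi>"
  shows "continuous_map T (compact_open X TF) (\<lambda>f x. \<Phi> f x + \<Psi> f x)"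
proof -
  have "continuous_map (prod_topology X (prod_topology TF TF)) TF ((\<lambda>(u,v). u + v) \<circ> snd)"
    using TF by (intro continuous_map_compose[OF continuous_map_snd]) (simp add: topological_vector_space_def)
  from co_continuous_combine[OF assms this] show ?thesis by simp
qed

lemma co_continuous_scale:
  assumes "Hausdorff_space X" "continuous_map X TK r" "continuous_map T (compact_open X TF) \<Phi>"
  shows "continuous_map T (compact_open X TF) (\<lambda>f x. sc (r x) (\<Phi> f x))"
proof -
  let ?P = "prod_topology X (prod_topology TF TF)"
  have 1: "continuous_map ?P TK (r \<circ> fst)"
    by (rule continuous_map_compose[OF continuous_map_fst assms(2)])
  have 2: "continuous_map ?P TF (fst \<circ> snd)"
    by (rule continuous_map_compose[OF continuous_map_snd continuous_map_fst])
  have "continuous_map ?P TF ((\<lambda>(a,u). sc a u) \<circ> (\<lambda>p. ((r \<circ> fst) p, (fst \<circ> snd) p)))"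
    using TF by (intro continuous_map_compose[OF continuous_map_pairedI[OF 1 2]])
      (simp add: topological_vector_space_def)
  from co_continuous_combine[OF assms(1,3,3) this] show ?thesis by simp
qed

lemma cat3_in_V1:
  "x \<in> V \<Longrightarrow> y \<in> extensional {..<n} \<Longrightarrow> vadd n x t y \<in> V \<Longrightarrow> cat3 n x y t \<in> BGN_V1 TK n V"
  unfolding BGN_V1_def by auto

text \<open>Written without division, the condition also makes sense (and is void) at \<open>t = 0\<close>.\<close>

definition quotient_ext :: "nat \<Rightarrow> (nat \<Rightarrow> 'k) set \<Rightarrow> ((nat \<Rightarrow> 'k) \<Rightarrow> 'f) \<Rightarrow> ((nat \<Rightarrow> 'k) \<Rightarrow> 'f) \<Rightarrow> bool" where
  "quotient_ext n V g h \<longleftrightarrow> (\<forall>x\<in>V. \<forall>y\<in>extensional {..<n}. \<forall>t. vadd n x t y \<in> V \<longrightarrow>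
     sc t (h (cat3 n x y t)) = g (vadd n x t y) - g x)"

lemma vadd_0: "x \<in> extensional {..<n} \<Longrightarrow> vadd n x 0 y = x"
  by (auto simp: vadd_def extensional_def)

lemma BGN_ext_iff:
  assumes "V \<subseteq> extensional {..<n}"
  shows "BGN_ext TK TF sc n V g h \<longleftrightarrow>
    continuous_map (Ksub (2*n+1) (BGN_V1 TK n V)) TF h \<and> quotient_ext n V g h"
proof -
  have "sc t (h (cat3 n x y t)) = g (vadd n x t y) - g x \<longleftrightarrow>
      (t \<noteq> 0 \<longrightarrow> h (cat3 n x y t) = sc (inverse t) (g (vadd n x t y) - g x))" if "x \<in> V" for x y t
  proof (cases "t = 0")
    case True
    have "x \<in> extensional {..<n}" using that assms by blast
    then show ?thesis using True by (simp add: vadd_0)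
  next
    case False
    then show ?thesis
      by (metis left_inverse right_inverse scale_one scale_scale)
  qed
  then show ?thesis unfolding BGN_ext_def quotient_ext_def by auto
qed

text \<open>The points with t nonzero are dense in V^[1], and there the quotient is forced. This is
  what pins down the chosen \<open>BGN_g1\<close> on V^[1].\<close>

lemma quotient_ext_unique:
  assumes V: "dense_interior n V"
    and "continuous_map (Ksub (2*n+1) (BGN_V1 TK n V)) TF h" "quotient_ext n V g h"
    and "continuous_map (Ksub (2*n+1) (BGN_V1 TK n V)) TF h'" "quotient_ext n V g h'"
    and z: "z \<in> BGN_V1 TK n V"
  shows "h z = h' z"
proof (rule dense_interior_unique[OF dense_interior_V1[OF V] _ Hausdorff_TF assms(2,4) z])
  fix z assume z: "z \<in> BGN_V1 TK n V" and nz: "\<And>i. i < 2*n+1 \<Longrightarrow> z i \<noteq> 0"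
  then obtain x y t where z': "z = cat3 n x y t" "x \<in> V" "y \<in> extensional {..<n}" "vadd n x t y \<in> V"
    by (auto simp: BGN_V1_def)
  have "t \<noteq> 0" using nz[of "2*n"] z' by simp
  moreover have "sc t (h z) = sc t (h' z)" using assms(3,5) z' unfolding quotient_ext_def by simp
  ultimately show "h z = h' z" by simp
qed

text \<open>The family version of the class C^k_BGN over an arbitrary parameter space
  \<open>T\<close>. The quotient family is an existential witness instead of the chosen
  \<open>BGN_g1\<close>, so explicit formulas can be supplied for it; its continuity is contained in
  the recursive clause.\<close>

fun Ck_family :: "'a topology \<Rightarrow> nat \<Rightarrow> nat \<Rightarrow> (nat \<Rightarrow> 'k) set \<Rightarrow> ('a \<Rightarrow> (nat \<Rightarrow> 'k) \<Rightarrow> 'f) \<Rightarrow> bool" where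
  "Ck_family T 0 n V \<Phi> \<longleftrightarrow> continuous_map T (compact_open (Ksub n V) TF) \<Phi>"
| "Ck_family T (Suc k) n V \<Phi> \<longleftrightarrow> continuous_map T (compact_open (Ksub n V) TF) \<Phi> \<and>
     (\<exists>\<Phi>1. (\<forall>f\<in>topspace T. quotient_ext n V (\<Phi> f) (\<Phi>1 f)) \<and>
           Ck_family T k (2*n+1) (BGN_V1 TK n V) \<Phi>1)"

lemma Ck_family_SucI:
  assumes "continuous_map T (compact_open (Ksub n V) TF) \<Phi>"
    and "\<And>f. f \<in> topspace T \<Longrightarrow> quotient_ext n V (\<Phi> f) (\<Phi>1 f)"
    and "Ck_family T k (2*n+1) (BGN_V1 TK n V) \<Phi>1"
  shows "Ck_family T (Suc k) n V \<Phi>"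
  using assms unfolding Ck_family.simps by blast

lemma Ck_family_continuous: "Ck_family T k n V \<Phi> \<Longrightarrow> continuous_map T (compact_open (Ksub n V) TF) \<Phi>"
  by (cases k) auto

lemma Ck_family_Suc: "Ck_family T (Suc k) n V \<Phi> \<Longrightarrow> Ck_family T k n V \<Phi>"
proof (induction k arbitrary: n V \<Phi>)
  case (Suc k)
  obtain \<Phi>1 where \<Phi>1: "\<And>f. f\<in>topspace T \<Longrightarrow> quotient_ext n V (\<Phi> f) (\<Phi>1 f)"
    "Ck_family T (Suc k) (2*n+1) (BGN_V1 TK n V) \<Phi>1"
    using Suc.prems unfolding Ck_family.simps(2)[of T "Suc k" n V \<Phi>] by blast
  show ?case
    by (rule Ck_family_SucI[OF Ck_family_continuous[OF Suc.prems] \<Phi>1(1) Suc.IH[OF \<Phi>1(2)]])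
qed simp

section \<open>Calculus of families: composition, restriction, sums, products, quotients,
  gluing\<close>

lemma Ck_family_cong:
  assumes "Ck_family T k n V \<Phi>" "\<And>f x. f \<in> topspace T \<Longrightarrow> x \<in> V \<Longrightarrow> \<Phi> f x = \<Psi> f x"
  shows "Ck_family T k n V \<Psi>"
proof -
  have "continuous_map T (compact_open (Ksub n V) TF) \<Psi>"
    by (rule co_continuous_cong[OF Ck_family_continuous[OF assms(1)]]) (use assms(2) in auto)
  moreover have "quotient_ext n V (\<Psi> f) h" if "quotient_ext n V (\<Phi> f) h" "f \<in> topspace T" for f h
    using that assms(2) unfolding quotient_ext_def by auto
  ultimately show ?thesis using assms(1) by (cases k) auto
qed

text \<open>Chain rule: the quotient of the composite is \<Phi>^[1] composed with the polynomial map
  (x,y,t) |-> (\<psi>(x), \<psi>^[1](x,y,t), t), to which the induction hypothesis applies.\<close>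

lemma Ck_family_compose:
  assumes "Ck_family T k m V \<Phi>" "poly_map n m \<psi>" "W \<subseteq> extensional {..<n}" "\<psi> ` W \<subseteq> V"
  shows "Ck_family T k n W (\<lambda>f x. \<Phi> f (\<psi> x))"
  using assms
proof (induction k arbitrary: n m V W \<Phi> \<psi>)
  have base: "continuous_map T (compact_open (Ksub n W) TF) (\<lambda>f x. \<Phi> f (\<psi> x))"
    if "continuous_map T (compact_open (Ksub m V) TF) \<Phi>" "poly_map n m \<psi>" "\<psi> ` W \<subseteq> V"
    for n m V W \<psi> and \<Phi> :: "'a \<Rightarrow> (nat \<Rightarrow> 'k) \<Rightarrow> 'f"
  proof (rule co_continuous_compose[OF that(1)])
    show "continuous_map (Ksub n W) (Ksub m V) \<psi>"
      using that by (intro continuous_map_into_subtopology continuous_map_from_subtopology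
            continuous_poly_map) auto
  qed
  {
    case 0 then show ?case using base by auto
  next
    case (Suc k)
    from Suc.prems obtain \<Phi>1 where \<Phi>1: "\<And>f. f\<in>topspace T \<Longrightarrow> quotient_ext m V (\<Phi> f) (\<Phi>1 f)"
      "Ck_family T k (2*m+1) (BGN_V1 TK m V) \<Phi>1" unfolding Ck_family.simps by blast
    obtain \<eta> where \<eta>: "poly_map (2*n+1) m \<eta>"
      "\<And>x y t. vadd m (\<psi> x) t (\<eta> (cat3 n x y t)) = \<psi> (vadd n x t y)"
      using poly_map_tangent[OF Suc.prems(2)] by metis
    have \<psi>z: "\<psi> (cat3 n x y t) = \<psi> x" for x y t
      by (rule poly_map_agree[OF Suc.prems(2)]) simp
    have \<eta>e: "\<eta> z \<in> extensional {..<m}" for z using \<eta>(1) by (auto simp: poly_map_def)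
    let ?\<psi> = "\<lambda>z. cat3 m (\<psi> z) (\<eta> z) (z (2*n))"
    have "Ck_family T k (2*n+1) (BGN_V1 TK n W) (\<lambda>f z. \<Phi>1 f (?\<psi> z))"
    proof (rule Suc.IH[OF \<Phi>1(2)])
      show "poly_map (2*n+1) (2*m+1) ?\<psi>"
        using poly_map_mono[OF Suc.prems(2)] \<eta>(1) by (intro poly_map_cat3) (auto intro: poly_fun.intros)
      show "?\<psi> ` BGN_V1 TK n W \<subseteq> BGN_V1 TK m V"
      proof
        fix w assume "w \<in> ?\<psi> ` BGN_V1 TK n W"
        then obtain x y t where "w = ?\<psi> (cat3 n x y t)" "x \<in> W" "vadd n x t y \<in> W"
          by (auto simp: BGN_V1_def)
        then show "w \<in> BGN_V1 TK m V"
          using \<eta>(2)[of x t y] \<eta>e[of "cat3 n x y t"] Suc.prems(4)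
          by (auto simp: \<psi>z image_subset_iff intro!: cat3_in_V1)
      qed
    qed (rule V1_extensional)
    moreover have "quotient_ext n W (\<lambda>x. \<Phi> f (\<psi> x)) (\<lambda>z. \<Phi>1 f (?\<psi> z))" if "f \<in> topspace T" for f
      using \<Phi>1(1)[OF that] Suc.prems(4) \<eta>(2) \<eta>e unfolding quotient_ext_def \<psi>z
      by (auto simp: image_subset_iff)
    moreover have "continuous_map T (compact_open (Ksub n W) TF) (\<lambda>f x. \<Phi> f (\<psi> x))"
      using Suc.prems base by auto
    ultimately show ?case by (intro Ck_family_SucI[of T n W _ "\<lambda>f z. \<Phi>1 f (?\<psi> z)"])
  }
qed

text \<open>Restriction of the domain is composition with the identity, written as
  \<open>restrict\<close> to have extensional values.\<close>

lemma Ck_family_subset: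
  assumes "Ck_family T k n V \<Phi>" "W \<subseteq> V" "W \<subseteq> extensional {..<n}"
  shows "Ck_family T k n W \<Phi>"
proof -
  have r: "restrict x {..<n} = x" if "x \<in> W" for x using that assms(3) by (auto simp: extensional_restrict)
  have "Ck_family T k n W (\<lambda>f x. \<Phi> f (restrict x {..<n}))"
    by (rule Ck_family_compose[OF assms(1)])
      (use assms r in \<open>auto simp: poly_map_def intro: poly_fun.intros\<close>)
  then show ?thesis by (rule Ck_family_cong) (simp add: r)
qed

lemma Ck_family_base:
  assumes "Ck_family T k n V \<Phi>" "V \<subseteq> extensional {..<n}"
  shows "Ck_family T k (2*n+1) (BGN_V1 TK n V) (\<lambda>f z. \<Phi> f (base_part n z))"
  using assms by (intro Ck_family_compose[OF _ poly_map_base V1_extensional]) (auto simp: mem_V1_iff)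

lemma Ck_family_end:
  assumes "Ck_family T k n V \<Phi>" "V \<subseteq> extensional {..<n}"
  shows "Ck_family T k (2*n+1) (BGN_V1 TK n V) (\<lambda>f z. \<Phi> f (end_point n z))"
  using assms by (intro Ck_family_compose[OF _ poly_map_end V1_extensional]) (auto simp: mem_V1_iff)

lemma Ck_family_add:
  assumes "Ck_family T k n V \<Phi>" "Ck_family T k n V \<Psi>"
  shows "Ck_family T k n V (\<lambda>f x. \<Phi> f x + \<Psi> f x)"
  using assms
proof (induction k arbitrary: n V \<Phi> \<Psi>)
  case 0 then show ?case using co_continuous_add[OF Hausdorff_Ksub] by simp
next
  case (Suc k)
  from Suc.prems obtain \<Phi>1 \<Psi>1 where H: "\<And>f. f\<in>topspace T \<Longrightarrow> quotient_ext n V (\<Phi> f) (\<Phi>1 f)"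
      "Ck_family T k (2*n+1) (BGN_V1 TK n V) \<Phi>1"
      "\<And>f. f\<in>topspace T \<Longrightarrow> quotient_ext n V (\<Psi> f) (\<Psi>1 f)"
      "Ck_family T k (2*n+1) (BGN_V1 TK n V) \<Psi>1" unfolding Ck_family.simps by blast
  have "quotient_ext n V (\<lambda>x. \<Phi> f x + \<Psi> f x) (\<lambda>x. \<Phi>1 f x + \<Psi>1 f x)" if "f \<in> topspace T" for f
    using H(1,3)[OF that] unfolding quotient_ext_def by (simp add: scale_right_distrib)
  then show ?case using Suc.IH[OF H(2,4)] Suc.prems
    by (intro Ck_family_SucI[of T n V _ "\<lambda>f x. \<Phi>1 f x + \<Psi>1 f x"] co_continuous_add[OF Hausdorff_Ksub]) auto
qed

lemma continuous_poly_fun_Ksub: "poly_fun n p \<Longrightarrow> continuous_map (Ksub n V) TK p"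
  by (intro continuous_map_from_subtopology continuous_poly_fun)

lemma Ck_family_scale:
  assumes "Ck_family T k n V \<Phi>" "poly_fun n p" "V \<subseteq> extensional {..<n}"
  shows "Ck_family T k n V (\<lambda>f x. sc (p x) (\<Phi> f x))"
  using assms
proof (induction k arbitrary: n V \<Phi> p)
  case 0 then show ?case
    using co_continuous_scale[OF Hausdorff_Ksub continuous_poly_fun_Ksub] by simp
next
  case (Suc k)
  from Suc.prems obtain \<Phi>1 where H: "\<And>f. f\<in>topspace T \<Longrightarrow> quotient_ext n V (\<Phi> f) (\<Phi>1 f)"
      "Ck_family T k (2*n+1) (BGN_V1 TK n V) \<Phi>1" unfolding Ck_family.simps by blast
  obtain p1 where p1: "poly_fun (2*n+1) p1" "\<And>x y t. p (vadd n x t y) = p x + t * p1 (cat3 n x y t)"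
    using poly_fun_tangent[OF Suc.prems(2)] by blast
  have pe: "poly_fun (2*n+1) (\<lambda>z. p (end_point n z))"
    using poly_map_end Suc.prems(2) unfolding poly_map_def by (blast intro: poly_fun_subst)
  \<comment> \<open>Product rule with \<open>p\<close> taken at the end point and \<Phi> at the base
    point; this asymmetric form has no extra term with a factor t.\<close>
  let ?\<Phi>1 = "\<lambda>f z. sc (p (end_point n z)) (\<Phi>1 f z) + sc (p1 z) (\<Phi> f (base_part n z))"
  have "Ck_family T k (2*n+1) (BGN_V1 TK n V) ?\<Phi>1"
    by (intro Ck_family_add Suc.IH H(2) pe p1(1) V1_extensional Ck_family_base
        Ck_family_Suc[OF Suc.prems(1)] Suc.prems(3))
  moreover have "quotient_ext n V (\<lambda>x. sc (p x) (\<Phi> f x)) (?\<Phi>1 f)" if f: "f \<in> topspace T" for f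
    unfolding quotient_ext_def
  proof (intro ballI allI impI)
    fix x y t assume x: "x \<in> V" and y: "y \<in> extensional {..<n}" and w: "vadd n x t y \<in> V"
    have "sc t (\<Phi>1 f (cat3 n x y t)) = \<Phi> f (vadd n x t y) - \<Phi> f x"
      using H(1)[OF f] x y w unfolding quotient_ext_def by blast
    moreover have "base_part n (cat3 n x y t) = x" "end_point n (cat3 n x y t) = vadd n x t y"
      using x y Suc.prems(3) by (auto simp: cat3_parts)
    moreover have "sc t (sc a u) = sc a (sc t u)" for a u by (simp add: mult.commute)
    ultimately have "sc t (?\<Phi>1 f (cat3 n x y t)) =
        sc (p (vadd n x t y)) (\<Phi> f (vadd n x t y) - \<Phi> f x) + sc (t * p1 (cat3 n x y t)) (\<Phi> f x)"
      by (simp only: scale_right_distrib) simp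
    also have "t * p1 (cat3 n x y t) = p (vadd n x t y) - p x" using p1(2) by simp
    finally show "sc t (?\<Phi>1 f (cat3 n x y t)) = sc (p (vadd n x t y)) (\<Phi> f (vadd n x t y)) - sc (p x) (\<Phi> f x)"
      by (simp add: scale_right_diff_distrib scale_left_diff_distrib)
  qed
  ultimately show ?case
    using co_continuous_scale[OF Hausdorff_Ksub continuous_poly_fun_Ksub[OF Suc.prems(2)]
        Ck_family_continuous[OF Suc.prems(1)]] by (intro Ck_family_SucI[of T n V _ ?\<Phi>1]) auto
qed

lemma Ck_family_diff:
  assumes "Ck_family T k n V \<Phi>" "Ck_family T k n V \<Psi>" "V \<subseteq> extensional {..<n}"
  shows "Ck_family T k n V (\<lambda>f x. \<Phi> f x - \<Psi> f x)"
  using Ck_family_add[OF assms(1) Ck_family_scale[OF assms(2) poly_fun.const[of n "-1"] assms(3)]] by simp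

text \<open>The family \<open>\<Psi>\<close> serves the empty sum: the zero family is obtained as
  \<Psi> - \<Psi>.\<close>

lemma Ck_family_sum:
  assumes "V \<subseteq> extensional {..<n}" "finite I" "\<And>i. i \<in> I \<Longrightarrow> Ck_family T k n V (\<Phi> i)"
    "Ck_family T k n V \<Psi>"
  shows "Ck_family T k n V (\<lambda>f x. \<Sum>i\<in>I. \<Phi> i f x)"
  using assms(2,3)
proof (induction I)
  case empty
  show ?case using Ck_family_diff[OF assms(4,4,1)] by simp
next
  case (insert i I)
  then show ?case using Ck_family_add[of T k n V "\<Phi> i" "\<lambda>f x. \<Sum>i\<in>I. \<Phi> i f x"] by simp
qed

lemma continuous_inverse_poly:
  assumes "poly_fun n q" "\<And>x. x \<in> V \<Longrightarrow> q x \<noteq> 0"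
  shows "continuous_map (Ksub n V) TK (\<lambda>x. inverse (q x))"
proof -
  have "continuous_map (Ksub n V) (subtopology TK (-{0})) q"
    using assms by (intro continuous_map_into_subtopology continuous_poly_fun_Ksub) auto
  from continuous_map_compose[OF this, of TK inverse] TK show ?thesis
    by (simp add: o_def topological_field_def)
qed

text \<open>Quotient rule with denominator q(x+ty) q(x). This is again a polynomial without zeros on
  V^[1], so the induction hypothesis divides by it, while the numerator uses only products and
  differences.\<close>

lemma Ck_family_divide:
  assumes "Ck_family T k n V \<Phi>" "poly_fun n q" "\<And>x. x \<in> V \<Longrightarrow> q x \<noteq> 0" "V \<subseteq> extensional {..<n}"
  shows "Ck_family T k n V (\<lambda>f x. sc (inverse (q x)) (\<Phi> f x))"
  using assms
proof (induction k arbitrary: n V \<Phi> q)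
  case 0
  then show ?case
    using co_continuous_scale[OF Hausdorff_Ksub continuous_inverse_poly[OF 0(2,3)]] by simp
next
  case (Suc k)
  from Suc.prems obtain \<Phi>1 where H: "\<And>f. f\<in>topspace T \<Longrightarrow> quotient_ext n V (\<Phi> f) (\<Phi>1 f)"
      "Ck_family T k (2*n+1) (BGN_V1 TK n V) \<Phi>1" unfolding Ck_family.simps by blast
  obtain q1 where q1: "poly_fun (2*n+1) q1" "\<And>x y t. q (vadd n x t y) = q x + t * q1 (cat3 n x y t)"
    using poly_fun_tangent[OF Suc.prems(2)] by blast
  have qe: "poly_fun (2*n+1) (\<lambda>z. q (end_point n z))"
    using poly_map_end Suc.prems(2) unfolding poly_map_def by (blast intro: poly_fun_subst)
  have qb: "poly_fun (2*n+1) (\<lambda>z. q (base_part n z))"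
    using poly_map_base Suc.prems(2) unfolding poly_map_def by (blast intro: poly_fun_subst)
  let ?\<Phi>1 = "\<lambda>f z. sc (inverse (q (end_point n z) * q (base_part n z)))
      (sc (q (base_part n z)) (\<Phi>1 f z) - sc (q1 z) (\<Phi> f (base_part n z)))"
  have "Ck_family T k (2*n+1) (BGN_V1 TK n V) ?\<Phi>1"
  proof (rule Suc.IH)
    show "Ck_family T k (2*n+1) (BGN_V1 TK n V)
      (\<lambda>f z. sc (q (base_part n z)) (\<Phi>1 f z) - sc (q1 z) (\<Phi> f (base_part n z)))"
      by (intro Ck_family_diff Ck_family_scale H(2) qb q1(1) V1_extensional Ck_family_base
          Ck_family_Suc[OF Suc.prems(1)] Suc.prems(4))
    show "poly_fun (2*n+1) (\<lambda>z. q (end_point n z) * q (base_part n z))" by (intro poly_fun.mult qe qb)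
    show "q (end_point n z) * q (base_part n z) \<noteq> 0" if "z \<in> BGN_V1 TK n V" for z
      using that Suc.prems(3,4) by (simp add: mem_V1_iff)
  qed (rule V1_extensional)
  moreover have "quotient_ext n V (\<lambda>x. sc (inverse (q x)) (\<Phi> f x)) (?\<Phi>1 f)" if f: "f \<in> topspace T" for f
    unfolding quotient_ext_def
  proof (intro ballI allI impI)
    fix x y t assume x: "x \<in> V" and y: "y \<in> extensional {..<n}" and w: "vadd n x t y \<in> V"
    let ?w = "vadd n x t y"
    have 1: "sc t (\<Phi>1 f (cat3 n x y t)) = \<Phi> f ?w - \<Phi> f x"
      using H(1)[OF f] x y w unfolding quotient_ext_def by blast
    have 2: "base_part n (cat3 n x y t) = x" "end_point n (cat3 n x y t) = ?w"
      using x y Suc.prems(4) by (auto simp: cat3_parts)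
    have 3: "sc t (sc a u) = sc a (sc t u)" for a u by (simp add: mult.commute)
    have "sc t (?\<Phi>1 f (cat3 n x y t)) = sc (inverse (q ?w * q x))
        (sc (q x) (\<Phi> f ?w - \<Phi> f x) - sc (t * q1 (cat3 n x y t)) (\<Phi> f x))"
      unfolding 2 3 scale_right_diff_distrib 1 by (simp add: scale_right_diff_distrib)
    also have "t * q1 (cat3 n x y t) = q ?w - q x" using q1(2) by simp
    also have "sc (q x) (\<Phi> f ?w - \<Phi> f x) - sc (q ?w - q x) (\<Phi> f x) = sc (q x) (\<Phi> f ?w) - sc (q ?w) (\<Phi> f x)"
      by (simp add: scale_right_diff_distrib scale_left_diff_distrib)
    also have "sc (inverse (q ?w * q x)) \<dots> = sc (inverse (q ?w)) (\<Phi> f ?w) - sc (inverse (q x)) (\<Phi> f x)"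
      using Suc.prems(3)[OF x] Suc.prems(3)[OF w] by (simp add: scale_right_diff_distrib mult.assoc)
    finally show "sc t (?\<Phi>1 f (cat3 n x y t)) = sc (inverse (q ?w)) (\<Phi> f ?w) - sc (inverse (q x)) (\<Phi> f x)" .
  qed
  ultimately show ?case
    using co_continuous_scale[OF Hausdorff_Ksub continuous_inverse_poly[OF Suc.prems(2,3)]
        Ck_family_continuous[OF Suc.prems(1)]] by (intro Ck_family_SucI[of T n V _ ?\<Phi>1]) auto
qed

text \<open>The difficulty is that V^[1] is larger than the union of the two sets belonging to V
  \<inter> P and V \<inter> Q: a base point in one part may have its end point in the other. Such
  points have t nonzero unless they already lie in that union, so the set where t is nonzero
  completes an open cover, and there \<Phi>^[1] is a quotient of known families.\<close>

lemma Ck_family_local: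
  assumes "dense_interior n V" "openin (Kpow TK n) P" "openin (Kpow TK n) Q" "V \<subseteq> P \<union> Q"
    "Ck_family T k n (V \<inter> P) \<Phi>" "Ck_family T k n (V \<inter> Q) \<Phi>"
  shows "Ck_family T k n V \<Phi>"
  using assms
proof (induction k arbitrary: n V P Q \<Phi>)
  have base: "continuous_map T (compact_open (Ksub n V) TF) \<Phi>"
    if "openin (Kpow TK n) P" "openin (Kpow TK n) Q" "V \<subseteq> P \<union> Q"
      "continuous_map T (compact_open (Ksub n (V \<inter> P)) TF) \<Phi>"
      "continuous_map T (compact_open (Ksub n (V \<inter> Q)) TF) \<Phi>"
    for n V P Q and \<Phi> :: "'a \<Rightarrow> (nat \<Rightarrow> 'k) \<Rightarrow> 'f"
  proof (rule co_continuous_local[OF Hausdorff_Ksub, of n V "V \<inter> P" "V \<inter> Q"])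
    show "topspace (Ksub n V) \<subseteq> V \<inter> P \<union> V \<inter> Q" using that(3) by auto
  qed (use that in \<open>auto simp: subtopology_subtopology openin_subtopology\<close>)
  {
    case 0 then show ?case using base by auto
  next
    case (Suc k)
    note V = Suc.prems(1) and P = Suc.prems(2) and Q = Suc.prems(3)
    have Ve: "V \<subseteq> extensional {..<n}" using V by (simp add: dense_interior_def)
    have VPe: "V \<inter> P \<subseteq> extensional {..<n}" and VQe: "V \<inter> Q \<subseteq> extensional {..<n}" using Ve by auto
    let ?V1 = "BGN_V1 TK n V"
    obtain \<Phi>P where \<Phi>P: "\<And>f. f\<in>topspace T \<Longrightarrow> quotient_ext n (V \<inter> P) (\<Phi> f) (\<Phi>P f)"
        "Ck_family T k (2*n+1) (BGN_V1 TK n (V \<inter> P)) \<Phi>P" using Suc.prems(5) unfolding Ck_family.simps by blast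
    obtain \<Phi>Q where \<Phi>Q: "\<And>f. f\<in>topspace T \<Longrightarrow> quotient_ext n (V \<inter> Q) (\<Phi> f) (\<Phi>Q f)"
        "Ck_family T k (2*n+1) (BGN_V1 TK n (V \<inter> Q)) \<Phi>Q" using Suc.prems(6) unfolding Ck_family.simps by blast
    have \<Phi>: "Ck_family T k n V \<Phi>"
      by (rule Suc.IH[OF Suc.prems(1-4) Ck_family_Suc[OF Suc.prems(5)] Ck_family_Suc[OF Suc.prems(6)]])
    \<comment> \<open>The last branch is reached on V^[1] only with t nonzero; on the overlap of the
      first two, the choices agree by uniqueness of the quotient over V \<inter> P \<inter>
      Q.\<close>
    define \<Phi>1 where "\<Phi>1 f z = (if z \<in> BGN_V1 TK n (V \<inter> P) then \<Phi>P f z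
        else if z \<in> BGN_V1 TK n (V \<inter> Q) then \<Phi>Q f z
        else sc (inverse (z (2*n))) (\<Phi> f (end_point n z) - \<Phi> f (base_part n z)))" for f z
    have on_Q: "\<Phi>1 f z = \<Phi>Q f z" if f: "f \<in> topspace T" and z: "z \<in> BGN_V1 TK n (V \<inter> Q)" for f z
    proof (cases "z \<in> BGN_V1 TK n (V \<inter> P)")
      case True
      have int: "BGN_V1 TK n (V \<inter> P) \<inter> BGN_V1 TK n (V \<inter> Q) = BGN_V1 TK n (V \<inter> P \<inter> Q)"
        using VPe VQe by (auto simp: mem_V1_iff le_infI1)
      have "continuous_map (Ksub (2*n+1) (BGN_V1 TK n (V \<inter> P \<inter> Q))) TF (\<Phi>P f)"
        by (rule continuous_map_from_subtopology_mono[OF _ V1_mono[of _ "V \<inter> P"]])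
          (use Ck_family_continuous[OF \<Phi>P(2)] f in \<open>auto simp: continuous_map_compact_open_iff\<close>)
      moreover have "continuous_map (Ksub (2*n+1) (BGN_V1 TK n (V \<inter> P \<inter> Q))) TF (\<Phi>Q f)"
        by (rule continuous_map_from_subtopology_mono[OF _ V1_mono[of _ "V \<inter> Q"]])
          (use Ck_family_continuous[OF \<Phi>Q(2)] f in \<open>auto simp: continuous_map_compact_open_iff\<close>)
      moreover have "quotient_ext n (V \<inter> P \<inter> Q) (\<Phi> f) (\<Phi>P f)" "quotient_ext n (V \<inter> P \<inter> Q) (\<Phi> f) (\<Phi>Q f)"
        using \<Phi>P(1)[OF f] \<Phi>Q(1)[OF f] unfolding quotient_ext_def by auto
      moreover have "dense_interior n (V \<inter> P \<inter> Q)" using V P Q by (intro dense_interior_Int_open)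
      moreover have "z \<in> BGN_V1 TK n (V \<inter> P \<inter> Q)" using int True z by blast
      ultimately have "\<Phi>P f z = \<Phi>Q f z" by (intro quotient_ext_unique[of n "V \<inter> P \<inter> Q"])
      then show ?thesis using True by (simp add: \<Phi>1_def)
    qed (use z in \<open>simp add: \<Phi>1_def\<close>)
    have q1: "sc t (\<Phi>1 f (cat3 n x y t)) = \<Phi> f (vadd n x t y) - \<Phi> f x"
      if f: "f \<in> topspace T" and x: "x \<in> V" and y: "y \<in> extensional {..<n}" and w: "vadd n x t y \<in> V" for f x y t
    proof -
      have x': "x \<in> extensional {..<n}" using x Ve by auto
      let ?z = "cat3 n x y t"
      have b: "base_part n ?z = x" "end_point n ?z = vadd n x t y" using x' y by (auto simp: cat3_parts)
      have z: "?z \<in> extensional {..<2*n+1}" using cat3_in_V1[OF x y w] V1_extensional by blast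
      consider "?z \<in> BGN_V1 TK n (V \<inter> P)" | "?z \<in> BGN_V1 TK n (V \<inter> Q)"
        | "?z \<notin> BGN_V1 TK n (V \<inter> P)" "?z \<notin> BGN_V1 TK n (V \<inter> Q)" by blast
      then show ?thesis
      proof cases
        case 1
        then have "x \<in> V \<inter> P" "vadd n x t y \<in> V \<inter> P" unfolding mem_V1_iff[OF VPe] b by auto
        then have "sc t (\<Phi>P f ?z) = \<Phi> f (vadd n x t y) - \<Phi> f x"
          using \<Phi>P(1)[OF f] y unfolding quotient_ext_def by blast
        then show ?thesis using 1 by (simp add: \<Phi>1_def)
      next
        case 2
        then have "x \<in> V \<inter> Q" "vadd n x t y \<in> V \<inter> Q" unfolding mem_V1_iff[OF VQe] b by auto
        then have "sc t (\<Phi>Q f ?z) = \<Phi> f (vadd n x t y) - \<Phi> f x"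
          using \<Phi>Q(1)[OF f] y unfolding quotient_ext_def by blast
        then show ?thesis using on_Q[OF f 2] by simp
      next
        case 3
        have "t \<noteq> 0"
        proof
          assume "t = 0"
          then have "vadd n x t y = x" using x' by (simp add: vadd_0)
          then show False using 3 z x w Suc.prems(4) unfolding mem_V1_iff[OF VPe] mem_V1_iff[OF VQe] b by auto
        qed
        then show ?thesis using 3 b by (simp add: \<Phi>1_def)
      qed
    qed
    then have ext: "quotient_ext n V (\<Phi> f) (\<Phi>1 f)" if "f \<in> topspace T" for f
      using that unfolding quotient_ext_def by blast
    let ?I = "\<lambda>P. {z \<in> extensional {..<2*n+1}. base_part n z \<in> P} \<inter> {z \<in> extensional {..<2*n+1}. end_point n z \<in> P}"
    let ?R = "{z \<in> extensional {..<2*n+1}. z (2*n) \<noteq> 0}"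
    have oI: "openin (Kpow TK (2*n+1)) (?I P)" if "openin (Kpow TK n) P" for P
      using that by (intro openin_Int openin_poly_preimage[OF poly_map_base] openin_poly_preimage[OF poly_map_end])
    have oR: "openin (Kpow TK (2*n+1)) ?R" by (rule openin_last_nonzero)
    have V1P: "?V1 \<inter> ?I P = BGN_V1 TK n (V \<inter> P)" for P
      using mem_V1_iff[OF Ve] mem_V1_iff[of "V \<inter> P" n] Ve by auto
    have oU: "openin (Kpow TK (2*n+1)) (?I P \<union> ?I Q)" using oI P Q by blast
    have fP: "Ck_family T k (2*n+1) (BGN_V1 TK n (V \<inter> P)) \<Phi>1"
      by (rule Ck_family_cong[OF \<Phi>P(2)]) (simp add: \<Phi>1_def)
    have fQ: "Ck_family T k (2*n+1) (BGN_V1 TK n (V \<inter> Q)) \<Phi>1"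
      by (rule Ck_family_cong[OF \<Phi>Q(2)]) (simp add: on_Q)
    \<comment> \<open>First use of the induction hypothesis: glue over the points whose base and end
      point lie in the same part. This union is relatively open in V^[1], hence has dense
      interior.\<close>
    have "Ck_family T k (2*n+1) (?V1 \<inter> (?I P \<union> ?I Q)) \<Phi>1"
    proof (rule Suc.IH[OF _ oI[OF P] oI[OF Q]])
      show "dense_interior (2*n+1) (?V1 \<inter> (?I P \<union> ?I Q))"
        by (rule dense_interior_Int_open[OF dense_interior_V1[OF V] oU])
      have "?V1 \<inter> (?I P \<union> ?I Q) \<inter> ?I P = BGN_V1 TK n (V \<inter> P)" "?V1 \<inter> (?I P \<union> ?I Q) \<inter> ?I Q = BGN_V1 TK n (V \<inter> Q)"
        unfolding V1P[symmetric] by blast+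
      then show "Ck_family T k (2*n+1) (?V1 \<inter> (?I P \<union> ?I Q) \<inter> ?I P) \<Phi>1"
        "Ck_family T k (2*n+1) (?V1 \<inter> (?I P \<union> ?I Q) \<inter> ?I Q) \<Phi>1" using fP fQ by simp_all
    qed blast
    moreover have "Ck_family T k (2*n+1) (?V1 \<inter> ?R) \<Phi>1"
    proof -
      have e: "?V1 \<inter> ?R \<subseteq> extensional {..<2*n+1}" by auto
      have "Ck_family T k (2*n+1) (?V1 \<inter> ?R) (\<lambda>f z. \<Phi> f (end_point n z) - \<Phi> f (base_part n z))"
        by (rule Ck_family_subset[OF Ck_family_diff[OF Ck_family_end[OF \<Phi> Ve] Ck_family_base[OF \<Phi> Ve] V1_extensional] _ e])
          blast
      then have "Ck_family T k (2*n+1) (?V1 \<inter> ?R)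
          (\<lambda>f z. sc (inverse (z (2*n))) (\<Phi> f (end_point n z) - \<Phi> f (base_part n z)))"
        by (rule Ck_family_divide) (use e in \<open>auto intro: poly_fun.intros\<close>)
      then show ?thesis
      proof (rule Ck_family_cong)
        fix f z assume f: "f \<in> topspace T" and z: "z \<in> ?V1 \<inter> ?R"
        then obtain x y t where z': "z = cat3 n x y t" "x \<in> V" "y \<in> extensional {..<n}" "vadd n x t y \<in> V"
          by (auto simp: BGN_V1_def)
        have b: "base_part n z = x" "end_point n z = vadd n x t y" using z' Ve by (auto simp: cat3_parts)
        have "z (2*n) = t" "t \<noteq> 0" using z z' by auto
        then show "sc (inverse (z (2*n))) (\<Phi> f (end_point n z) - \<Phi> f (base_part n z)) = \<Phi>1 f z"
          unfolding b q1[OF f z'(2-4), symmetric] by (simp add: z'(1))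
      qed
    qed
    moreover have "?V1 \<subseteq> (?I P \<union> ?I Q) \<union> ?R"
    proof
      fix z assume z: "z \<in> ?V1"
      show "z \<in> (?I P \<union> ?I Q) \<union> ?R"
      proof (cases "z (2*n) = 0")
        case True
        then have "end_point n z = base_part n z" by (simp add: end_point_def vadd_0 base_part_def)
        then show ?thesis using z Suc.prems(4) unfolding mem_V1_iff[OF Ve] by auto
      qed (use z V1_extensional in blast)
    qed
    \<comment> \<open>Second use of the induction hypothesis: glue that union with the part where t
      is nonzero.\<close>
    ultimately have "Ck_family T k (2*n+1) ?V1 \<Phi>1"
      by (intro Suc.IH[OF dense_interior_V1[OF V] oU oR])
    from Ck_family_SucI[OF Ck_family_continuous[OF \<Phi>] ext this] show ?case .
  }
qed

section \<open>Families versus the recursive definitions of C^k_BGN and f^[j]\<close>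

lemma Ck_family_imp_BGN:
  assumes "dense_interior n V" "Ck_family T k n V \<Phi>"
  shows "(\<forall>f\<in>topspace T. BGN_Ck TK TF sc k n V (\<Phi> f)) \<and>
    (\<forall>j\<le>k. continuous_map T (compact_open (Ksub (BGN_dim j n) (BGN_Vk TK j n V)) TF)
        (\<lambda>f. BGN_gk TK TF sc j n V (\<Phi> f)))"
  using assms
proof (induction k arbitrary: n V \<Phi>)
  case 0 then show ?case by (auto simp: continuous_map_compact_open_iff)
next
  case (Suc k)
  from Suc.prems obtain \<Phi>1 where H: "\<And>f. f\<in>topspace T \<Longrightarrow> quotient_ext n V (\<Phi> f) (\<Phi>1 f)"
      "Ck_family T k (2*n+1) (BGN_V1 TK n V) \<Phi>1" unfolding Ck_family.simps by blast
  have Ve: "V \<subseteq> extensional {..<n}" using Suc.prems by (simp add: dense_interior_def)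
  have ext: "BGN_ext TK TF sc n V (\<Phi> f) (\<Phi>1 f)" if "f \<in> topspace T" for f
    using H(1)[OF that] Ck_family_continuous[OF H(2)] that
    unfolding BGN_ext_iff[OF Ve] continuous_map_compact_open_iff by auto
  have ext1: "BGN_ext TK TF sc n V (\<Phi> f) (BGN_g1 TK TF sc n V (\<Phi> f))" if "f \<in> topspace T" for f
    unfolding BGN_g1_def by (rule someI[of _ "\<Phi>1 f"]) (rule ext[OF that])
  \<comment> \<open>The witness may be exchanged for the chosen quotient, since the two agree on
    V^[1].\<close>
  have "Ck_family T k (2*n+1) (BGN_V1 TK n V) (\<lambda>f. BGN_g1 TK TF sc n V (\<Phi> f))"
  proof (rule Ck_family_cong[OF H(2)])
    show "\<Phi>1 f z = BGN_g1 TK TF sc n V (\<Phi> f) z" if "f \<in> topspace T" "z \<in> BGN_V1 TK n V" for f z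
      using ext[OF that(1)] ext1[OF that(1)] that(2) unfolding BGN_ext_iff[OF Ve]
      by (intro quotient_ext_unique[OF Suc.prems(1), of "\<Phi>1 f" "\<Phi> f"]) auto
  qed
  note IH = Suc.IH[OF dense_interior_V1[OF Suc.prems(1)] this]
  have cont: "continuous_map T (compact_open (Ksub n V) TF) \<Phi>"
    by (rule Ck_family_continuous[OF Suc.prems(2)])
  have "BGN_Ck TK TF sc (Suc k) n V (\<Phi> f)" if f: "f \<in> topspace T" for f
  proof -
    have "continuous_map (Ksub n V) TF (\<Phi> f)" using cont f by (simp add: continuous_map_compact_open_iff)
    moreover have "BGN_Ck TK TF sc k (2*n+1) (BGN_V1 TK n V) (BGN_g1 TK TF sc n V (\<Phi> f))" using IH f by blast
    ultimately show ?thesis using ext[OF f] unfolding BGN_Ck.simps by blast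
  qed
  moreover have "continuous_map T (compact_open (Ksub (BGN_dim j n) (BGN_Vk TK j n V)) TF)
        (\<lambda>f. BGN_gk TK TF sc j n V (\<Phi> f))" if "j \<le> Suc k" for j
    using that IH cont by (cases j) auto
  ultimately show ?case by blast
qed

text \<open>Here \<open>BGN_g1\<close> itself serves as witness; order j + 1 for f is order j for
  \<open>BGN_g1\<close>, so the hypotheses pass to the induction hypothesis by a shift of j.\<close>

lemma BGN_imp_Ck_family:
  assumes "V \<subseteq> extensional {..<n}" "\<forall>f\<in>topspace T. BGN_Ck TK TF sc k n V (\<Phi> f)"
    "\<forall>j\<le>k. continuous_map T (compact_open (Ksub (BGN_dim j n) (BGN_Vk TK j n V)) TF)
        (\<lambda>f. BGN_gk TK TF sc j n V (\<Phi> f))"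
  shows "Ck_family T k n V \<Phi>"
  using assms
proof (induction k arbitrary: n V \<Phi>)
  case 0 then show ?case by simp
next
  case (Suc k)
  have "BGN_ext TK TF sc n V (\<Phi> f) (BGN_g1 TK TF sc n V (\<Phi> f))" if "f \<in> topspace T" for f
  proof -
    have "\<exists>h. BGN_ext TK TF sc n V (\<Phi> f) h" using Suc.prems(2) that by simp
    then show ?thesis unfolding BGN_g1_def by (rule someI_ex)
  qed
  then have "\<forall>f\<in>topspace T. quotient_ext n V (\<Phi> f) (BGN_g1 TK TF sc n V (\<Phi> f))"
    using BGN_ext_iff[OF Suc.prems(1)] by blast
  moreover have "Ck_family T k (2*n+1) (BGN_V1 TK n V) (\<lambda>f. BGN_g1 TK TF sc n V (\<Phi> f))"
    using Suc.prems(2) Suc.prems(3)[rule_format, of "Suc _"] by (intro Suc.IH V1_extensional) auto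
  moreover have "continuous_map T (compact_open (Ksub n V) TF) \<Phi>"
    using Suc.prems(3)[rule_format, of 0] by simp
  ultimately show ?case by (intro Ck_family_SucI[of T n V \<Phi> "\<lambda>f. BGN_g1 TK TF sc n V (\<Phi> f)"]) auto
qed

end

section \<open>Divided differences over blocks of coordinates\<close>

text \<open>The increasing injection of the indices that misses \<open>j\<close>; composing with it
  deletes the entry at position \<open>j\<close>.\<close>

definition skip :: "nat \<Rightarrow> nat \<Rightarrow> nat" where
  "skip j l = (if l < j then l else Suc l)"

text \<open>Blocks are sets of absolute positions in the flat vector. Cutting a block then changes
  only these sets and leaves the vector as it is; offsets relative to a block would all have to be
  rewritten.\<close>

definition block :: "(nat \<Rightarrow> nat) \<Rightarrow> nat \<Rightarrow> nat set" where
  "block \<alpha> l = {blk_off \<alpha> l..<blk_off \<alpha> (Suc l)}"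

definition pick :: "nat \<Rightarrow> (nat \<Rightarrow> 'k) \<Rightarrow> (nat \<Rightarrow> nat) \<Rightarrow> (nat \<Rightarrow> 'k)" where
  "pick d x c = (\<lambda>l\<in>{..<d}. x (c l))"

text \<open>The coefficient of the value at the node x_a in the one-variable divided difference over
  the nodes indexed by \<open>S\<close>.\<close>

definition node_weight :: "(nat \<Rightarrow> 'k::field) \<Rightarrow> nat set \<Rightarrow> nat \<Rightarrow> 'k" where
  "node_weight x S a = (\<Prod>m\<in>S - {a}. inverse (x a - x m))"

lemma blk_off_Suc [simp]: "blk_off \<alpha> (Suc l) = blk_off \<alpha> l + Suc (\<alpha> l)"
  by (simp add: blk_off_def)

lemma blk_off_mabs: "blk_off \<alpha> d = d + mabs d \<alpha>"
  by (induction d) (auto simp: blk_off_def mabs_def)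

lemma finite_block [simp]: "finite (block \<alpha> l)"
  by (simp add: block_def)

lemma mem_block_iff: "m \<in> block \<alpha> l \<longleftrightarrow> (\<exists>j\<le>\<alpha> l. m = blk_off \<alpha> l + j)"
  by (auto simp: block_def less_Suc_eq_le intro: exI[of _ "m - blk_off \<alpha> l"])

lemma blk_off_mono: "l \<le> l' \<Longrightarrow> blk_off \<alpha> l \<le> blk_off \<alpha> l'"
  by (induction l' rule: dec_induct) auto

lemma block_less: "m \<in> block \<alpha> l \<Longrightarrow> l < d \<Longrightarrow> m < d + mabs d \<alpha>"
  using blk_off_mono[of "Suc l" d \<alpha>] by (simp add: block_def blk_off_mabs[symmetric])

lemma block_disjoint: "l \<noteq> l' \<Longrightarrow> block \<alpha> l \<inter> block \<alpha> l' = {}"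
proof -
  have "block \<alpha> l \<inter> block \<alpha> l' = {}" if "l < l'" for l l'
    using blk_off_mono[of "Suc l" l' \<alpha>] that by (auto simp: block_def)
  then show "l \<noteq> l' \<Longrightarrow> block \<alpha> l \<inter> block \<alpha> l' = {}" by (metis inf_commute nat_neq_iff)
qed

lemma dd_high_choice:
  "dd_high sc d \<alpha> f x = (\<Sum>c\<in>PiE {..<d} (block \<alpha>). sc (\<Prod>l<d. node_weight x (block \<alpha> l) (c l)) (f (pick d x c)))"
  unfolding dd_high_def
proof (rule sum.reindex_bij_witness[where i="\<lambda>c. \<lambda>l\<in>{..<d}. c l - blk_off \<alpha> l"
      and j="\<lambda>\<iota>. \<lambda>l\<in>{..<d}. blk_off \<alpha> l + \<iota> l"])
  fix \<iota> assume \<iota>: "\<iota> \<in> (\<Pi>\<^sub>E l\<in>{..<d}. {..\<alpha> l})"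
  show "(\<lambda>l\<in>{..<d}. (\<lambda>l\<in>{..<d}. blk_off \<alpha> l + \<iota> l) l - blk_off \<alpha> l) = \<iota>"
    using \<iota> by (auto simp: fun_eq_iff PiE_iff extensional_def)
  show "(\<lambda>l\<in>{..<d}. blk_off \<alpha> l + \<iota> l) \<in> PiE {..<d} (block \<alpha>)"
    using \<iota> by (auto simp: PiE_iff mem_block_iff)
  have w: "node_weight x (block \<alpha> l) (blk_off \<alpha> l + \<iota> l) =
      (\<Prod>m\<in>{..\<alpha> l} - {\<iota> l}. inverse (x (blk_off \<alpha> l + \<iota> l) - x (blk_off \<alpha> l + m)))" for l
    unfolding node_weight_def
    by (rule prod.reindex_bij_witness[where i="\<lambda>m. blk_off \<alpha> l + m" and j="\<lambda>m. m - blk_off \<alpha> l"])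
      (auto simp: mem_block_iff)
  have p: "pick d x (\<lambda>l\<in>{..<d}. blk_off \<alpha> l + \<iota> l) = sel_pt d \<alpha> x \<iota>"
    by (auto simp: pick_def sel_pt_def)
  show "sc (\<Prod>l<d. node_weight x (block \<alpha> l) ((\<lambda>l\<in>{..<d}. blk_off \<alpha> l + \<iota> l) l))
      (f (pick d x (\<lambda>l\<in>{..<d}. blk_off \<alpha> l + \<iota> l))) =
    sc (\<Prod>l<d. \<Prod>m\<in>{..\<alpha> l} - {\<iota> l}. inverse (x (blk_off \<alpha> l + \<iota> l) - x (blk_off \<alpha> l + m)))
      (f (sel_pt d \<alpha> x \<iota>))"
    unfolding p by (rule arg_cong2[where f=sc, OF prod.cong]) (auto simp: w)
next
  fix c assume c: "c \<in> PiE {..<d} (block \<alpha>)"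
  show "(\<lambda>l\<in>{..<d}. blk_off \<alpha> l + (\<lambda>l\<in>{..<d}. c l - blk_off \<alpha> l) l) = c"
  proof
    fix l show "(\<lambda>l\<in>{..<d}. blk_off \<alpha> l + (\<lambda>l\<in>{..<d}. c l - blk_off \<alpha> l) l) l = c l"
      using c by (cases "l < d") (auto simp: PiE_iff extensional_def block_def)
  qed
  have "c l - blk_off \<alpha> l \<le> \<alpha> l" if "l < d" for l
  proof -
    have "c l \<in> block \<alpha> l" using c that by (auto simp: PiE_iff)
    then show ?thesis by (auto simp: mem_block_iff)
  qed
  then show "(\<lambda>l\<in>{..<d}. c l - blk_off \<alpha> l) \<in> (\<Pi>\<^sub>E l\<in>{..<d}. {..\<alpha> l})" by auto
qed

lemma U_low_choice:
  assumes "topspace TK = UNIV"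
  shows "x \<in> U_low TK d \<alpha> U \<longleftrightarrow> x \<in> extensional {..<d + mabs d \<alpha>} \<and> (\<forall>c\<in>PiE {..<d} (block \<alpha>). pick d x c \<in> U)"
proof -
  have "(\<forall>\<iota>. (\<forall>l<d. \<iota> l \<le> \<alpha> l) \<longrightarrow> sel_pt d \<alpha> x \<iota> \<in> U) \<longleftrightarrow> (\<forall>c\<in>PiE {..<d} (block \<alpha>). pick d x c \<in> U)"
    (is "?L \<longleftrightarrow> ?R")
  proof
    assume L: ?L
    show ?R
    proof
      fix c assume c: "c \<in> PiE {..<d} (block \<alpha>)"
      have b: "c l \<in> block \<alpha> l" if "l < d" for l using c that by (auto simp: PiE_iff)
      have "sel_pt d \<alpha> x (\<lambda>l. c l - blk_off \<alpha> l) \<in> U"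
        using L b by (metis (no_types, lifting) add_diff_cancel_left' mem_block_iff)
      moreover have "sel_pt d \<alpha> x (\<lambda>l. c l - blk_off \<alpha> l) = pick d x c"
      proof
        fix l show "sel_pt d \<alpha> x (\<lambda>l. c l - blk_off \<alpha> l) l = pick d x c l"
          using b[of l] by (auto simp: sel_pt_def pick_def block_def)
      qed
      ultimately show "pick d x c \<in> U" by simp
    qed
  next
    assume R: ?R
    show ?L
    proof (intro allI impI)
      fix \<iota> assume "\<forall>l<d. \<iota> l \<le> \<alpha> l"
      then have "(\<lambda>l\<in>{..<d}. blk_off \<alpha> l + \<iota> l) \<in> PiE {..<d} (block \<alpha>)" by (auto simp: mem_block_iff)
      with R have "pick d x (\<lambda>l\<in>{..<d}. blk_off \<alpha> l + \<iota> l) \<in> U" by blast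
      moreover have "pick d x (\<lambda>l\<in>{..<d}. blk_off \<alpha> l + \<iota> l) = sel_pt d \<alpha> x \<iota>"
        by (auto simp: pick_def sel_pt_def)
      ultimately show "sel_pt d \<alpha> x \<iota> \<in> U" by simp
    qed
  qed
  then show ?thesis using assms unfolding U_low_def by (auto simp: Kpow_def PiE_def)
qed

lemma U_high_inj:
  "x \<in> U_high TK d \<alpha> U \<longleftrightarrow> x \<in> U_low TK d \<alpha> U \<and> (\<forall>l<d. inj_on x (block \<alpha> l))"
proof -
  have "(\<forall>j\<le>\<alpha> l. \<forall>m\<le>\<alpha> l. j \<noteq> m \<longrightarrow> x (blk_off \<alpha> l + j) \<noteq> x (blk_off \<alpha> l + m)) \<longleftrightarrow> inj_on x (block \<alpha> l)" for l
  proof -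
    have b: "block \<alpha> l = (\<lambda>j. blk_off \<alpha> l + j) ` {..\<alpha> l}" by (auto simp: mem_block_iff)
    show ?thesis unfolding b inj_on_def by auto
  qed
  then show ?thesis unfolding U_high_def by auto
qed

text \<open>Partial fraction expansion of the product of the 1/(z - x_a), by adding one node b at a
  time. The identity \<open>e\<close> separates the pole at x_b from the others, which leaves the
  expansion over \<open>S\<close> evaluated at z and at x_b.\<close>

lemma partial_fractions:
  fixes x :: "nat \<Rightarrow> 'k::field"
  assumes "finite S" "S \<noteq> {}" "inj_on x S" "z \<notin> x ` S"
  shows "(\<Sum>a\<in>S. node_weight x S a * inverse (z - x a)) = (\<Prod>a\<in>S. inverse (z - x a))"
  using assms
proof (induction S arbitrary: z rule: finite_ne_induct)
  case (singleton a)
  then show ?case by (simp add: node_weight_def)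
next
  case (insert b S)
  have inj: "inj_on x S" and zb: "z \<noteq> x b" and zS: "z \<notin> x ` S" using insert.prems by auto
  have bS: "x b \<notin> x ` S" using insert.prems(1) insert.hyps(3) by (auto simp: inj_on_def)
  have w: "node_weight x (insert b S) a = node_weight x S a * inverse (x a - x b)" if "a \<in> S" for a
  proof -
    have "insert b S - {a} = insert b (S - {a})" using that insert.hyps by auto
    then show ?thesis using insert.hyps by (simp add: node_weight_def)
  qed
  have wb: "node_weight x (insert b S) b = (\<Prod>a\<in>S. inverse (x b - x a))"
    using insert.hyps by (simp add: node_weight_def)
  have e: "inverse (x a - x b) * inverse (z - x a) = inverse (z - x b) * (inverse (z - x a) - inverse (x b - x a))"
    if "a \<in> S" for a
  proof -
    have *: "inverse u * inverse v = inverse (u + v) * (inverse v - inverse (- u))"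
      if "u \<noteq> 0" "v \<noteq> 0" "u + v \<noteq> 0" for u v :: 'k
      using that by (simp add: field_simps)
    have "x b \<noteq> x a" "z \<noteq> x a" using that bS zS by (metis imageI)+
    then have "x a - x b \<noteq> 0" "z - x a \<noteq> 0" "(x a - x b) + (z - x a) \<noteq> 0" using zb by auto
    from *[OF this] show ?thesis by simp
  qed
  have "(\<Sum>a\<in>insert b S. node_weight x (insert b S) a * inverse (z - x a)) =
     (\<Prod>a\<in>S. inverse (x b - x a)) * inverse (z - x b) +
     (\<Sum>a\<in>S. node_weight x S a * (inverse (x a - x b) * inverse (z - x a)))"
    using insert.hyps by (simp add: wb w mult.assoc)
  also have "(\<Sum>a\<in>S. node_weight x S a * (inverse (x a - x b) * inverse (z - x a))) =
     inverse (z - x b) * ((\<Sum>a\<in>S. node_weight x S a * inverse (z - x a)) - (\<Sum>a\<in>S. node_weight x S a * inverse (x b - x a)))"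
    unfolding sum_subtractf[symmetric] sum_distrib_left
  proof (rule sum.cong[OF refl])
    fix a assume "a \<in> S"
    from e[OF this] show "node_weight x S a * (inverse (x a - x b) * inverse (z - x a)) =
       inverse (z - x b) * (node_weight x S a * inverse (z - x a) - node_weight x S a * inverse (x b - x a))"
      by (simp add: right_diff_distrib mult.left_commute)
  qed
  also have "(\<Sum>a\<in>S. node_weight x S a * inverse (z - x a)) = (\<Prod>a\<in>S. inverse (z - x a))"
    by (rule insert.IH[OF inj zS])
  \<comment> \<open>The induction hypothesis is used a second time with z = x_b; the result cancels
    against the term of the new node.\<close>
  also have "(\<Sum>a\<in>S. node_weight x S a * inverse (x b - x a)) = (\<Prod>a\<in>S. inverse (x b - x a))"
    by (rule insert.IH[OF inj bS])
  finally show ?case using insert.hyps by (simp add: algebra_simps)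
qed

lemma node_weight_Un:
  assumes "finite A" "finite B" "A \<inter> B = {}" "a \<in> A"
  shows "node_weight x (A \<union> B) a = node_weight x A a * (\<Prod>b\<in>B. inverse (x a - x b))"
proof -
  have "A \<union> B - {a} = (A - {a}) \<union> B" using assms by auto
  moreover have "(A - {a}) \<inter> B = {}" using assms by auto
  ultimately show ?thesis using assms unfolding node_weight_def by (simp add: prod.union_disjoint)
qed

context vector_space
begin

text \<open>Compare coefficients. That of F b on the right is its weight in \<open>B\<close> times a
  sum over \<open>A\<close>, which partial fractions turn into exactly the factors missing from its
  weight in A \<union> B; for F a the roles are exchanged. Both sets must be nonempty, since an
  empty sum is 0 but an empty product is 1.\<close>

lemma divided_difference_split:
  fixes x :: "nat \<Rightarrow> 'a" and F :: "nat \<Rightarrow> 'b"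
  assumes A: "finite A" "A \<noteq> {}" and B: "finite B" "B \<noteq> {}" and AB: "A \<inter> B = {}" and inj: "inj_on x (A \<union> B)"
  shows "(\<Sum>a\<in>A \<union> B. scale (node_weight x (A \<union> B) a) (F a)) =
    (\<Sum>a\<in>A. \<Sum>b\<in>B. scale (node_weight x A a * node_weight x B b * inverse (x b - x a)) (F b - F a))"
proof -
  have inA: "inj_on x A" and inB: "inj_on x B" using inj by (auto simp: inj_on_def)
  have "(\<Sum>a\<in>A. \<Sum>b\<in>B. scale (node_weight x A a * node_weight x B b * inverse (x b - x a)) (F b - F a)) =
     (\<Sum>a\<in>A. \<Sum>b\<in>B. scale (node_weight x B b * (node_weight x A a * inverse (x b - x a))) (F b)) +
     (\<Sum>a\<in>A. \<Sum>b\<in>B. scale (node_weight x A a * (node_weight x B b * inverse (x a - x b))) (F a))"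
    unfolding sum.distrib[symmetric]
  proof (intro sum.cong refl)
    fix a b
    have "inverse (x a - x b) = - inverse (x b - x a)"
      by (metis inverse_minus_eq minus_diff_eq)
    then show "scale (node_weight x A a * node_weight x B b * inverse (x b - x a)) (F b - F a) =
       scale (node_weight x B b * (node_weight x A a * inverse (x b - x a))) (F b) +
       scale (node_weight x A a * (node_weight x B b * inverse (x a - x b))) (F a)"
      by (simp add: scale_right_diff_distrib scale_minus_left algebra_simps)
  qed
  also have "(\<Sum>a\<in>A. \<Sum>b\<in>B. scale (node_weight x B b * (node_weight x A a * inverse (x b - x a))) (F b)) =
     (\<Sum>b\<in>B. scale (node_weight x B b * (\<Sum>a\<in>A. node_weight x A a * inverse (x b - x a))) (F b))"
    by (subst sum.swap) (simp add: scale_sum_left sum_distrib_left)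
  also have "\<dots> = (\<Sum>b\<in>B. scale (node_weight x (A \<union> B) b) (F b))"
  proof (intro sum.cong refl)
    fix b assume b: "b \<in> B"
    then have "x b \<notin> x ` A" using inj AB by (auto simp: inj_on_def)
    from partial_fractions[OF A inA this]
    show "scale (node_weight x B b * (\<Sum>a\<in>A. node_weight x A a * inverse (x b - x a))) (F b) = scale (node_weight x (A \<union> B) b) (F b)"
      using node_weight_Un[of B A b x] A B AB b by (simp add: Un_commute Int_commute)
  qed
  also have "(\<Sum>a\<in>A. \<Sum>b\<in>B. scale (node_weight x A a * (node_weight x B b * inverse (x a - x b))) (F a)) =
     (\<Sum>a\<in>A. scale (node_weight x A a * (\<Sum>b\<in>B. node_weight x B b * inverse (x a - x b))) (F a))"
    by (simp add: scale_sum_left sum_distrib_left)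
  also have "\<dots> = (\<Sum>a\<in>A. scale (node_weight x (A \<union> B) a) (F a))"
  proof (intro sum.cong refl)
    fix a assume a: "a \<in> A"
    then have "x a \<notin> x ` B" using inj AB by (auto simp: inj_on_def)
    from partial_fractions[OF B inB this]
    show "scale (node_weight x A a * (\<Sum>b\<in>B. node_weight x B b * inverse (x a - x b))) (F a) = scale (node_weight x (A \<union> B) a) (F a)"
      using node_weight_Un[of A B a x] A B AB a by simp
  qed
  finally show ?thesis using A B AB by (simp add: sum.union_disjoint add.commute)
qed

end

text \<open>Block i of \<alpha> is cut into the consecutive blocks i and i + 1 of \<beta>. A block
  for the entry n has n + 1 positions, whence the \<open>Suc\<close>: the total order drops by one
  while the number of variables grows by one.\<close>

definition block_split :: "nat \<Rightarrow> (nat \<Rightarrow> nat) \<Rightarrow> (nat \<Rightarrow> nat) \<Rightarrow> bool" where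
  "block_split i \<alpha> \<beta> \<longleftrightarrow> (\<forall>l<i. \<beta> l = \<alpha> l) \<and> \<alpha> i = Suc (\<beta> i + \<beta> (Suc i)) \<and> (\<forall>l>i. \<beta> (Suc l) = \<alpha> l)"

lemma block_split_off:
  assumes "block_split i \<alpha> \<beta>"
  shows "l \<le> i \<Longrightarrow> blk_off \<beta> l = blk_off \<alpha> l" and "l > i \<Longrightarrow> blk_off \<beta> (Suc l) = blk_off \<alpha> l"
proof -
  show 1: "l \<le> i \<Longrightarrow> blk_off \<beta> l = blk_off \<alpha> l" for l
    using assms unfolding blk_off_def block_split_def by (intro sum.cong) auto
  have "i < l \<Longrightarrow> blk_off \<beta> (Suc l) = blk_off \<alpha> l"
  proof (induction l)
    case (Suc l)
    show ?case
    proof (cases "l = i")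
      case True
      then show ?thesis using 1[of i] assms by (simp add: block_split_def)
    next
      case False
      then show ?thesis using Suc assms by (simp add: block_split_def del: blk_off_Suc) (simp add: block_split_def)
    qed
  qed simp
  then show "l > i \<Longrightarrow> blk_off \<beta> (Suc l) = blk_off \<alpha> l" .
qed

lemma block_split_blocks:
  assumes "block_split i \<alpha> \<beta>"
  shows "l < i \<Longrightarrow> block \<beta> l = block \<alpha> l" and "l > i \<Longrightarrow> block \<beta> (Suc l) = block \<alpha> l"
    and "block \<alpha> i = block \<beta> i \<union> block \<beta> (Suc i)"
proof -
  show "l < i \<Longrightarrow> block \<beta> l = block \<alpha> l"
    unfolding block_def using block_split_off(1)[OF assms, of l] block_split_off(1)[OF assms, of "Suc l"] by simp
  show "l > i \<Longrightarrow> block \<beta> (Suc l) = block \<alpha> l"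
    unfolding block_def using block_split_off(2)[OF assms, of l] block_split_off(2)[OF assms, of "Suc l"] by simp
  show "block \<alpha> i = block \<beta> i \<union> block \<beta> (Suc i)"
    unfolding block_def using block_split_off(1)[OF assms, of i] block_split_off(2)[OF assms, of "Suc i"] by auto
qed

lemma block_split_mabs: "block_split i \<alpha> \<beta> \<Longrightarrow> i < d \<Longrightarrow> mabs d \<alpha> = Suc (mabs (Suc d) \<beta>)"
  using block_split_off(2)[of i \<alpha> \<beta> d] blk_off_mabs[of \<alpha> d] blk_off_mabs[of \<beta> "Suc d"] by linarith

lemma block_nonempty [simp]: "block \<alpha> l \<noteq> {}"
  by (simp add: block_def)

definition insert_pair :: "nat \<Rightarrow> (nat \<Rightarrow> nat) \<Rightarrow> nat \<Rightarrow> nat \<Rightarrow> (nat \<Rightarrow> nat)" where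
  "insert_pair i r a b = (\<lambda>l. if l < i then r l else if l = i then a else if l = Suc i then b else r (l - 1))"

text \<open>Deleting position i removes \<open>a\<close> and leaves \<open>b\<close>, so
  \<open>skip i\<close> belongs to the second node and \<open>skip (Suc i)\<close> to the
  first.\<close>

lemma insert_pair_skip:
  "insert_pair i r a b \<circ> skip i = r(i := b)"
  "insert_pair i r a b \<circ> skip (Suc i) = r(i := a)"
  by (auto simp: fun_eq_iff skip_def insert_pair_def)

lemma insert_pair_PiE:
  assumes sp: "block_split i \<alpha> \<beta>" and i: "i < d" and r: "r(i := a) \<in> PiE {..<d} (block \<alpha>)"
    and a: "a \<in> block \<beta> i" and b: "b \<in> block \<beta> (Suc i)"
  shows "insert_pair i r a b \<in> PiE {..<Suc d} (block \<beta>)"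
proof (rule PiE_I)
  note bl = block_split_blocks[OF sp]
  fix l assume l: "l \<in> {..<Suc d}"
  have rl: "r l \<in> block \<alpha> l" if "l < d" "l \<noteq> i" for l using PiE_mem[OF r, of l] that by auto
  consider "l < i" | "l = i" | "l = Suc i" | "l > Suc i" by linarith
  then show "insert_pair i r a b l \<in> block \<beta> l"
  proof cases
    case 1 then show ?thesis using rl[of l] bl(1)[of l] i by (auto simp: insert_pair_def)
  next
    case 4 then show ?thesis using rl[of "l - 1"] bl(2)[of "l - 1"] l by (auto simp: insert_pair_def)
  qed (use a b in \<open>auto simp: insert_pair_def\<close>)
next
  fix l assume "l \<notin> {..<Suc d}"
  then show "insert_pair i r a b l = undefined"
    using i PiE_arb[OF r, of "l - 1"] by (auto simp: insert_pair_def)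
qed

text \<open>With the choices in all blocks other than i frozen, the sum over block i is a
  one-variable divided difference, to which \<open>divided_difference_split\<close> applies. The
  equation for \<open>g\<close> is multiplied out, so any continuous extension of the first-order
  divided difference can be inserted.\<close>

lemma (in vector_space) dd_high_split:
  fixes x :: "nat \<Rightarrow> 'a" and f g :: "(nat \<Rightarrow> 'a) \<Rightarrow> 'b"
  assumes sp: "block_split i \<alpha> \<beta>" and i: "i < d" and inj: "inj_on x (block \<alpha> i)"
    and g: "\<And>c. c \<in> PiE {..<Suc d} (block \<beta>) \<Longrightarrow>
      scale (x (c (Suc i)) - x (c i)) (g (pick (Suc d) x c)) = f (pick d x (c \<circ> skip i)) - f (pick d x (c \<circ> skip (Suc i)))"
  shows "dd_high scale d \<alpha> f x = dd_high scale (Suc d) \<beta> g x"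
proof -
  define R where "R = PiE ({..<d} - {i}) (block \<alpha>)"
  define P where "P r = (\<Prod>l\<in>{..<d} - {i}. node_weight x (block \<alpha> l) (r l))" for r :: "nat \<Rightarrow> nat"
  let ?A = "block \<beta> i" and ?B = "block \<beta> (Suc i)"
  let ?ins = "insert_pair i"
  note bl = block_split_blocks[OF sp]
  \<comment> \<open>A choice is encoded as the pair of its values off i and its value at i; the
    first component is padded with \<open>undefined\<close> at i to make this a bijection.\<close>
  have lhs: "dd_high scale d \<alpha> f x =
      (\<Sum>(r,a)\<in>R \<times> block \<alpha> i. scale (P r * node_weight x (block \<alpha> i) a) (f (pick d x (r(i:=a)))))"
    unfolding dd_high_choice
  proof (rule sum.reindex_bij_witness[where i="\<lambda>(r,a). r(i:=a)" and j="\<lambda>c. (c(i:=undefined), c i)"])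
    fix c assume c: "c \<in> PiE {..<d} (block \<alpha>)"
    show "(case (c(i := undefined), c i) of (r, a) \<Rightarrow> r(i := a)) = c" by simp
    show "(c(i := undefined), c i) \<in> R \<times> block \<alpha> i"
      using c i by (auto simp: R_def PiE_iff extensional_def)
    have "(\<Prod>l<d. node_weight x (block \<alpha> l) (c l)) = node_weight x (block \<alpha> i) (c i) * (\<Prod>l\<in>{..<d} - {i}. node_weight x (block \<alpha> l) (c l))"
      using i by (intro prod.remove) auto
    moreover have "P (c(i := undefined)) = (\<Prod>l\<in>{..<d} - {i}. node_weight x (block \<alpha> l) (c l))"
      unfolding P_def by (intro prod.cong) auto
    ultimately show "(case (c(i := undefined), c i) of
         (r, a) \<Rightarrow> scale (P r * node_weight x (block \<alpha> i) a) (f (pick d x (r(i := a))))) =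
         scale (\<Prod>l<d. node_weight x (block \<alpha> l) (c l)) (f (pick d x c))"
      by (simp add: mult.commute)
  next
    fix p assume p: "p \<in> R \<times> block \<alpha> i"
    then obtain r a where ra: "p = (r, a)" "r \<in> R" "a \<in> block \<alpha> i" by auto
    have "r i = undefined" using ra(2) by (auto simp: R_def PiE_iff extensional_def)
    then show "((case p of (r, a) \<Rightarrow> r(i := a))(i := undefined), (case p of (r, a) \<Rightarrow> r(i := a)) i) = p"
      using ra by (auto simp: fun_eq_iff)
    show "(case p of (r, a) \<Rightarrow> r(i := a)) \<in> PiE {..<d} (block \<alpha>)"
      using ra i by (auto simp: R_def PiE_iff extensional_def)
  qed
  have rhs: "dd_high scale (Suc d) \<beta> g x =
      (\<Sum>(r,a,b)\<in>R \<times> ?A \<times> ?B. scale (P r * (node_weight x ?A a * node_weight x ?B b)) (g (pick (Suc d) x (?ins r a b))))"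
    unfolding dd_high_choice
  proof (rule sum.reindex_bij_witness[where i="\<lambda>(r,a,b). ?ins r a b"
        and j="\<lambda>c. ((\<lambda>l. if l < i then c l else if l = i then undefined else c (Suc l)), c i, c (Suc i))"])
    fix c assume c: "c \<in> PiE {..<Suc d} (block \<beta>)"
    let ?r = "\<lambda>l. if l < i then c l else if l = i then undefined else c (Suc l)"
    have ins: "?ins ?r (c i) (c (Suc i)) = c"
    proof
      fix l consider "l < i" | "l = i" | "l = Suc i" | "l > Suc i" by linarith
      then show "?ins ?r (c i) (c (Suc i)) l = c l" by cases (auto simp: insert_pair_def)
    qed
    then show "(case (?r, c i, c (Suc i)) of (r,a,b) \<Rightarrow> ?ins r a b) = c" by simp
    have cl: "c l \<in> block \<beta> l" if "l < Suc d" for l using c that by (auto simp: PiE_iff)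
    have "?r \<in> R" unfolding R_def
    proof (rule PiE_I)
      fix l assume "l \<in> {..<d} - {i}"
      then show "?r l \<in> block \<alpha> l" using cl[of l] cl[of "Suc l"] bl(1)[of l] bl(2)[of l] by auto
    next
      fix l assume "l \<notin> {..<d} - {i}"
      then have "l = i \<or> Suc l \<notin> {..<Suc d} \<and> \<not> l < i" using i by auto
      then show "?r l = undefined" using PiE_arb[OF c, of "Suc l"] by auto
    qed
    then show "(?r, c i, c (Suc i)) \<in> R \<times> ?A \<times> ?B" using cl i by auto
    \<comment> \<open>Apart from i and i + 1, the indices of the new blocks are the images under
      \<open>skip i\<close> of the old indices other than i, so the remaining weights match those in
      \<open>P\<close>.\<close>
    have D: "{..<Suc d} = insert i (insert (Suc i) (skip i ` ({..<d} - {i})))"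
    proof (intro set_eqI iffI)
      fix l assume l: "l \<in> {..<Suc d}"
      consider "l < i" | "l = i" | "l = Suc i" | "l > Suc i" by linarith
      then show "l \<in> insert i (insert (Suc i) (skip i ` ({..<d} - {i})))"
      proof cases
        case 1
        then have "l = skip i l" "l \<in> {..<d} - {i}" using i by (auto simp: skip_def)
        then show ?thesis by blast
      next
        case 4
        then have "l = skip i (l - 1)" "l - 1 \<in> {..<d} - {i}" using l by (auto simp: skip_def)
        then show ?thesis by blast
      qed auto
    next
      fix l assume "l \<in> insert i (insert (Suc i) (skip i ` ({..<d} - {i})))"
      then show "l \<in> {..<Suc d}" using i by (auto simp: skip_def)
    qed
    have "i \<notin> insert (Suc i) (skip i ` ({..<d} - {i}))" "Suc i \<notin> skip i ` ({..<d} - {i})"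
      by (auto simp: skip_def split: if_splits)
    moreover have "inj_on (skip i) ({..<d} - {i})" by (auto simp: inj_on_def skip_def split: if_splits)
    ultimately have "(\<Prod>l<Suc d. node_weight x (block \<beta> l) (c l)) = node_weight x ?A (c i) * (node_weight x ?B (c (Suc i)) *
       (\<Prod>l\<in>{..<d} - {i}. node_weight x (block \<beta> (skip i l)) (c (skip i l))))"
      unfolding D by (simp add: prod.reindex)
    also have "(\<Prod>l\<in>{..<d} - {i}. node_weight x (block \<beta> (skip i l)) (c (skip i l))) = P ?r"
      unfolding P_def
    proof (intro prod.cong refl)
      fix l assume "l \<in> {..<d} - {i}"
      then show "node_weight x (block \<beta> (skip i l)) (c (skip i l)) = node_weight x (block \<alpha> l) (?r l)"
        using bl(1)[of l] bl(2)[of l] by (auto simp: skip_def)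
    qed
    finally show "(case (?r, c i, c (Suc i)) of (r, a, b) \<Rightarrow>
        scale (P r * (node_weight x ?A a * node_weight x ?B b)) (g (pick (Suc d) x (?ins r a b)))) =
        scale (\<Prod>l<Suc d. node_weight x (block \<beta> l) (c l)) (g (pick (Suc d) x c))"
      unfolding prod.case ins by (simp add: algebra_simps)
  next
    fix p assume p: "p \<in> R \<times> ?A \<times> ?B"
    then obtain r a b where ra: "p = (r, a, b)" "r \<in> R" "a \<in> ?A" "b \<in> ?B" by auto
    have ri: "r i = undefined" using ra(2) by (auto simp: R_def PiE_iff extensional_def)
    have "(\<lambda>l. if l < i then ?ins r a b l else if l = i then undefined else ?ins r a b (Suc l)) = r"
      using ri by (auto simp: fun_eq_iff insert_pair_def)
    moreover have "?ins r a b i = a" "?ins r a b (Suc i) = b" by (auto simp: insert_pair_def)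
    ultimately show "((\<lambda>l. if l < i then (case p of (r, a, b) \<Rightarrow> ?ins r a b) l else if l = i then undefined else (case p of (r, a, b) \<Rightarrow> ?ins r a b) (Suc l)),
       (case p of (r, a, b) \<Rightarrow> ?ins r a b) i, (case p of (r, a, b) \<Rightarrow> ?ins r a b) (Suc i)) = p"
      unfolding ra(1) prod.case by simp
    have "r(i := a) \<in> PiE {..<d} (block \<alpha>)"
      using ra i bl(3) by (auto simp: R_def PiE_iff extensional_def)
    from insert_pair_PiE[OF sp i this ra(3,4)]
    show "(case p of (r, a, b) \<Rightarrow> ?ins r a b) \<in> PiE {..<Suc d} (block \<beta>)" unfolding ra(1) prod.case .
  qed
  have gi: "g (pick (Suc d) x (?ins r a b)) = scale (inverse (x b - x a)) (f (pick d x (r(i:=b))) - f (pick d x (r(i:=a))))"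
    if r: "r \<in> R" and a: "a \<in> ?A" and b: "b \<in> ?B" for r a b
  proof -
    have "r(i := a) \<in> PiE {..<d} (block \<alpha>)"
      using r a i bl(3) by (auto simp: R_def PiE_iff extensional_def)
    note insert_pair_PiE[OF sp i this a b]
    from g[OF this] have gb: "scale (x b - x a) (g (pick (Suc d) x (?ins r a b))) = f (pick d x (r(i:=b))) - f (pick d x (r(i:=a)))"
      unfolding insert_pair_skip by (simp add: insert_pair_def)
    have "x b \<noteq> x a"
    proof
      assume "x b = x a"
      then have "b = a" using inj a b bl(3) by (auto simp: inj_on_def)
      then show False using a b block_disjoint[of i "Suc i" \<beta>] by auto
    qed
    then show ?thesis unfolding gb[symmetric] by simp
  qed
  have "dd_high scale d \<alpha> f x = (\<Sum>r\<in>R. \<Sum>a\<in>?A \<union> ?B. scale (P r) (scale (node_weight x (?A \<union> ?B) a) (f (pick d x (r(i:=a))))))"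
    unfolding lhs bl(3) by (simp add: sum.cartesian_product)
  also have "\<dots> = (\<Sum>r\<in>R. scale (P r) (\<Sum>a\<in>?A. \<Sum>b\<in>?B. scale (node_weight x ?A a * node_weight x ?B b * inverse (x b - x a))
       (f (pick d x (r(i:=b))) - f (pick d x (r(i:=a))))))"
    unfolding scale_sum_right[symmetric]
    by (subst divided_difference_split) (use inj bl(3) block_disjoint[of i "Suc i" \<beta>] in auto)
  also have "\<dots> = (\<Sum>r\<in>R. \<Sum>a\<in>?A. \<Sum>b\<in>?B. scale (P r * (node_weight x ?A a * node_weight x ?B b)) (g (pick (Suc d) x (?ins r a b))))"
    unfolding scale_sum_right by (intro sum.cong refl) (simp add: gi mult.assoc)
  also have "\<dots> = dd_high scale (Suc d) \<beta> g x"
    unfolding rhs by (simp add: sum.cartesian_product split_def)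
  finally show ?thesis .
qed

section \<open>From difference quotients to divided differences\<close>

definition drop_coord :: "nat \<Rightarrow> nat \<Rightarrow> (nat \<Rightarrow> 'k) \<Rightarrow> (nat \<Rightarrow> 'k)" where
  "drop_coord d j y = (\<lambda>l\<in>{..<d}. y (skip j l))"

text \<open>With \<open>e_i\<close> the multi-index having the single entry 1 at position \<open>i\<close>, \<open>pair_set d i U\<close> is
  \<open>U^{<e_i>}\<close>; its points carry the two coordinates of the block \<open>i\<close> at the positions \<open>i\<close> and
  \<open>Suc i\<close>.\<close>

definition pair_set :: "nat \<Rightarrow> nat \<Rightarrow> (nat \<Rightarrow> 'k) set \<Rightarrow> (nat \<Rightarrow> 'k) set" where
  "pair_set d i U = {y \<in> extensional {..<Suc d}. drop_coord d i y \<in> U \<and> drop_coord d (Suc i) y \<in> U}"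

lemma drop_coord_pick: "drop_coord d j (pick (Suc d) x c) = pick d x (c \<circ> skip j)"
  by (auto simp: drop_coord_def pick_def skip_def fun_eq_iff)

lemma pick_restrict: "pick d x (restrict c {..<d}) = pick d x c"
  by (auto simp: pick_def fun_eq_iff)

lemma poly_map_drop: "poly_map (Suc d) d (drop_coord d j)"
  by (auto simp: poly_map_def drop_coord_def skip_def intro!: poly_fun.intros)

lemma skip_PiE:
  assumes sp: "block_split i \<alpha> \<beta>" and i: "i < d" and c: "c \<in> PiE {..<Suc d} (block \<beta>)"
  shows "restrict (c \<circ> skip i) {..<d} \<in> PiE {..<d} (block \<alpha>)"
    and "restrict (c \<circ> skip (Suc i)) {..<d} \<in> PiE {..<d} (block \<alpha>)"
proof -
  note bl = block_split_blocks[OF sp]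
  have cl: "c l \<in> block \<beta> l" if "l < Suc d" for l using PiE_mem[OF c, of l] that by auto
  have "c (skip i l) \<in> block \<alpha> l \<and> c (skip (Suc i) l) \<in> block \<alpha> l" if "l < d" for l
    using that cl[of l] cl[of "Suc l"] bl(1)[of l] bl(2)[of l] bl(3)
    by (cases l i rule: linorder_cases) (auto simp: skip_def)
  then show "restrict (c \<circ> skip i) {..<d} \<in> PiE {..<d} (block \<alpha>)"
    "restrict (c \<circ> skip (Suc i)) {..<d} \<in> PiE {..<d} (block \<alpha>)" by auto
qed

text \<open>In one direction, a choice for \<beta> contains two choices for \<alpha>, obtained by
  deleting either of its entries at i and i + 1. In the other, a choice for \<alpha> takes its entry
  at i from one half of the cut block and is completed by an arbitrary entry of the other
  half.\<close>

lemma U_low_split: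
  assumes sp: "block_split i \<alpha> \<beta>" and i: "i < d" and TK: "topspace TK = UNIV"
  shows "U_low TK d \<alpha> U = U_low TK (Suc d) \<beta> (pair_set d i U)"
proof (intro set_eqI iffI)
  have dim: "Suc d + mabs (Suc d) \<beta> = d + mabs d \<alpha>" using block_split_mabs[OF sp i] by simp
  note bl = block_split_blocks[OF sp]
  {
    fix x assume x: "x \<in> U_low TK d \<alpha> U"
    show "x \<in> U_low TK (Suc d) \<beta> (pair_set d i U)"
      unfolding U_low_choice[OF TK] dim
    proof (intro conjI ballI)
      show "x \<in> extensional {..<d + mabs d \<alpha>}" using x by (simp add: U_low_choice[OF TK])
      fix c assume c: "c \<in> PiE {..<Suc d} (block \<beta>)"
      have "pick d x (c \<circ> skip i) \<in> U" "pick d x (c \<circ> skip (Suc i)) \<in> U"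
        using x skip_PiE[OF sp i c] unfolding U_low_choice[OF TK] by (metis pick_restrict)+
      then show "pick (Suc d) x c \<in> pair_set d i U"
        by (auto simp: pair_set_def drop_coord_pick) (auto simp: pick_def)
    qed
  next
    fix x assume x: "x \<in> U_low TK (Suc d) \<beta> (pair_set d i U)"
    show "x \<in> U_low TK d \<alpha> U"
      unfolding U_low_choice[OF TK]
    proof (intro conjI ballI)
      show "x \<in> extensional {..<d + mabs d \<alpha>}" using x unfolding U_low_choice[OF TK] dim by blast
      fix c assume c: "c \<in> PiE {..<d} (block \<alpha>)"
      have "c i \<in> block \<alpha> i" using PiE_mem[OF c, of i] i by simp
      then consider "c i \<in> block \<beta> i" | "c i \<in> block \<beta> (Suc i)" using bl(3) by auto
      then show "pick d x c \<in> U"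
      proof cases
        case 1
        obtain b where b: "b \<in> block \<beta> (Suc i)" using block_nonempty by blast
        have "c(i := c i) \<in> PiE {..<d} (block \<alpha>)" using c by simp
        from insert_pair_PiE[OF sp i this 1 b] x
        have "pick (Suc d) x (insert_pair i c (c i) b) \<in> pair_set d i U" unfolding U_low_choice[OF TK] by blast
        then have "pick d x (insert_pair i c (c i) b \<circ> skip (Suc i)) \<in> U" by (simp add: pair_set_def drop_coord_pick)
        then show ?thesis by (simp add: insert_pair_skip)
      next
        case 2
        obtain a where a: "a \<in> block \<beta> i" using block_nonempty by blast
        have "c(i := a) \<in> PiE {..<d} (block \<alpha>)"
          using c a bl(3) i by (auto simp: PiE_iff extensional_def)
        from insert_pair_PiE[OF sp i this a 2] x
        have "pick (Suc d) x (insert_pair i c a (c i)) \<in> pair_set d i U" unfolding U_low_choice[OF TK] by blast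
        then have "pick d x (insert_pair i c a (c i) \<circ> skip i) \<in> U" by (simp add: pair_set_def drop_coord_pick)
        then show ?thesis by (simp add: insert_pair_skip)
      qed
    qed
  }
qed

lemma block_split_exists:
  assumes "\<alpha> i > 0"
  obtains \<beta> where "block_split i \<alpha> \<beta>"
  \<comment> \<open>Any cut would do; here the first entry of block i becomes a block of its
    own.\<close>
  using assms by (intro that[of "\<lambda>l. if l < i then \<alpha> l else if l = i then 0 else if l = Suc i then \<alpha> i - 1 else \<alpha> (l - 1)"])
    (auto simp: block_split_def)

lemma block_merge_exists:
  assumes "i < d" "\<beta> \<in> multi_idx (Suc d)"
  obtains \<alpha> where "block_split i \<alpha> \<beta>" "\<alpha> \<in> multi_idx d"
  using assms by (intro that[of "\<lambda>l. if l < i then \<beta> l else if l = i then Suc (\<beta> i + \<beta> (Suc i)) else \<beta> (Suc l)"])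
    (auto simp: block_split_def multi_idx_def)

lemma mabs_0_block:
  assumes "mabs d \<alpha> = 0"
  shows "PiE {..<d} (block \<alpha>) = {\<lambda>l\<in>{..<d}. l}" "l < d \<Longrightarrow> block \<alpha> l = {l}"
proof -
  have \<alpha>: "\<forall>l<d. \<alpha> l = 0" using assms by (simp add: mabs_def)
  have off: "l \<le> d \<Longrightarrow> blk_off \<alpha> l = l" for l
  proof (induction l)
    case 0 then show ?case by (simp add: blk_off_def)
  next
    case (Suc l) then show ?case using \<alpha> by simp
  qed
  show b: "l < d \<Longrightarrow> block \<alpha> l = {l}" for l
    using off[of l] \<alpha> by (auto simp: block_def)
  have "PiE {..<d} (block \<alpha>) = PiE {..<d} (\<lambda>l. {(\<lambda>l\<in>{..<d}. l) l})"
    by (rule PiE_cong) (simp add: b)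
  also have "\<dots> = {\<lambda>l\<in>{..<d}. l}" by (rule PiE_singleton) (rule restrict_extensional)
  finally show "PiE {..<d} (block \<alpha>) = {\<lambda>l\<in>{..<d}. l}" .
qed

lemma U_low_0:
  assumes "mabs d \<alpha> = 0" "U \<subseteq> extensional {..<d}" "topspace TK = UNIV"
  shows "U_low TK d \<alpha> U = U"
proof -
  have "pick d x (\<lambda>l\<in>{..<d}. l) = x" if "x \<in> extensional {..<d}" for x :: "nat \<Rightarrow> 'a"
    using that by (auto simp: pick_def fun_eq_iff extensional_def)
  then show ?thesis using assms(2) by (auto simp: U_low_choice[OF assms(3)] mabs_0_block[OF assms(1)] assms(1))
qed

lemma (in vector_space) dd_high_0:
  assumes "mabs d \<alpha> = 0" "x \<in> extensional {..<d}"
  shows "dd_high scale d \<alpha> f x = f x"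
proof -
  have "pick d x (\<lambda>l\<in>{..<d}. l) = x" using assms(2) by (auto simp: pick_def fun_eq_iff extensional_def)
  then show ?thesis by (simp add: dd_high_choice mabs_0_block[OF assms(1)] node_weight_def)
qed

lemma U_high_split:
  assumes sp: "block_split i \<alpha> \<beta>" and i: "i < d" and TK: "topspace TK = UNIV" and x: "x \<in> U_high TK d \<alpha> U"
  shows "x \<in> U_high TK (Suc d) \<beta> (pair_set d i U)"
proof -
  note bl = block_split_blocks[OF sp]
  have inj: "inj_on x (block \<alpha> l)" if "l < d" for l using x that by (auto simp: U_high_inj)
  have "inj_on x (block \<beta> l)" if l: "l < Suc d" for l
  proof -
    consider "l < i" | "l = i" | "l = Suc i" | "l > Suc i" by linarith
    then show ?thesis
    proof cases
      case 1 then show ?thesis using inj[of l] bl(1)[of l] i by simp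
    next
      case 4 then show ?thesis using inj[of "l - 1"] bl(2)[of "l - 1"] l by simp
    qed (use inj[OF i] bl(3) inj_on_subset in blast)+
  qed
  then show ?thesis using x U_low_split[OF sp i TK] by (auto simp: U_high_inj)
qed

context top_vec
begin

text \<open>The affine substitution turning g^[1] into a divided difference: the base point omits
  the entry at i + 1, the direction is the unit vector e_i, and t is the gap y_{i+1} - y_i. The end
  point then omits the entry at i.\<close>

definition unit_step :: "nat \<Rightarrow> nat \<Rightarrow> (nat \<Rightarrow> 'k) \<Rightarrow> (nat \<Rightarrow> 'k)" where
  "unit_step d i y = cat3 d (drop_coord d (Suc i) y) (\<lambda>l\<in>{..<d}. if l = i then 1 else 0) (y (Suc i) - y i)"

lemma unit_step_end:
  assumes "i < d"
  shows "vadd d (drop_coord d (Suc i) y) (y (Suc i) - y i) (\<lambda>l\<in>{..<d}. if l = i then 1 else 0) = drop_coord d i y"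
  using assms by (auto simp: vadd_def drop_coord_def skip_def fun_eq_iff)

lemma unit_step_V1: "i < d \<Longrightarrow> y \<in> pair_set d i U \<Longrightarrow> unit_step d i y \<in> BGN_V1 TK d U"
  unfolding unit_step_def pair_set_def by (rule cat3_in_V1) (auto simp: unit_step_end)

lemma unit_step_quotient:
  assumes "quotient_ext d U g h" "i < d" "y \<in> pair_set d i U"
  shows "sc (y (Suc i) - y i) (h (unit_step d i y)) = g (drop_coord d i y) - g (drop_coord d (Suc i) y)"
proof -
  let ?x = "drop_coord d (Suc i) y" and ?e = "\<lambda>l\<in>{..<d}. if l = i then 1 else 0 :: 'k"
  have "?x \<in> U" "vadd d ?x (y (Suc i) - y i) ?e \<in> U" "?e \<in> extensional {..<d}"
    using assms(3) by (simp_all add: unit_step_end[OF assms(2)] pair_set_def)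
  then show ?thesis using assms(1) unfolding quotient_ext_def unit_step_def
    unfolding unit_step_end[OF assms(2), symmetric] by blast
qed

lemma dd_high_split_pair:
  assumes "block_split i \<alpha> \<beta>" "i < d" "x \<in> U_low TK d \<alpha> U" "inj_on x (block \<alpha> i)"
    and g: "\<And>y. y \<in> pair_set d i U \<Longrightarrow> sc (y (Suc i) - y i) (g y) = f (drop_coord d i y) - f (drop_coord d (Suc i) y)"
  shows "dd_high sc d \<alpha> f x = dd_high sc (Suc d) \<beta> g x"
proof (rule dd_high_split[OF assms(1,2,4)])
  fix c assume c: "c \<in> PiE {..<Suc d} (block \<beta>)"
  have "x \<in> U_low TK (Suc d) \<beta> (pair_set d i U)" using assms(3) U_low_split[OF assms(1,2) topspace_TK] by simp
  then have "pick (Suc d) x c \<in> pair_set d i U" using c unfolding U_low_choice[OF topspace_TK] by blast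
  from g[OF this] show "sc (x (c (Suc i)) - x (c i)) (g (pick (Suc d) x c)) =
      f (pick d x (c \<circ> skip i)) - f (pick d x (c \<circ> skip (Suc i)))"
    using assms(2) unfolding drop_coord_pick by (simp add: pick_def)
qed

lemma pair_set_extensional: "pair_set d i U \<subseteq> extensional {..<Suc d}"
  by (auto simp: pair_set_def)

text \<open>For nonzero \<alpha> a block of positive order is cut. The quotient family composed with
  \<open>unit_step\<close> has class k - 1 on U^{<e_i>} in d + 1 variables, and the induction
  hypothesis for \<beta> gives an extension over the same set of vectors.\<close>

lemma Ck_family_imp_SDS:
  assumes "Ck_family T k d U \<Phi>" "U \<subseteq> extensional {..<d}" "mabs d \<alpha> \<le> k"
  shows "\<exists>\<Psi>. continuous_map T (compact_open (Ksub (d + mabs d \<alpha>) (U_low TK d \<alpha> U)) TF) \<Psi> \<and>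
    (\<forall>f\<in>topspace T. \<forall>x\<in>U_high TK d \<alpha> U. \<Psi> f x = dd_high sc d \<alpha> (\<Phi> f) x)"
  using assms
proof (induction k arbitrary: d U \<Phi> \<alpha>)
  have zero: "\<exists>\<Psi>. continuous_map T (compact_open (Ksub (d + mabs d \<alpha>) (U_low TK d \<alpha> U)) TF) \<Psi> \<and>
      (\<forall>f\<in>topspace T. \<forall>x\<in>U_high TK d \<alpha> U. \<Psi> f x = dd_high sc d \<alpha> (\<Phi> f) x)"
    if "mabs d \<alpha> = 0" "U \<subseteq> extensional {..<d}" "continuous_map T (compact_open (Ksub d U) TF) \<Phi>"
    for d U \<alpha> and \<Phi> :: "'a \<Rightarrow> (nat \<Rightarrow> 'k) \<Rightarrow> 'f"
    using that by (intro exI[of _ \<Phi>]) (auto simp: U_low_0 U_high_inj dd_high_0 subset_iff)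
  {
    case 0 then show ?case using zero by simp
  next
    case (Suc k)
    show ?case
    proof (cases "mabs d \<alpha> = 0")
      case True then show ?thesis by (rule zero[OF _ Suc.prems(2) Ck_family_continuous[OF Suc.prems(1)]])
    next
      case False
      then obtain i where i: "i < d" "\<alpha> i > 0" by (auto simp: mabs_def)
      obtain \<beta> where sp: "block_split i \<alpha> \<beta>" using block_split_exists[of \<alpha> i] i(2) by blast
      have dim: "Suc d + mabs (Suc d) \<beta> = d + mabs d \<alpha>" using block_split_mabs[OF sp i(1)] by simp
      obtain \<Phi>1 where \<Phi>1: "\<And>f. f\<in>topspace T \<Longrightarrow> quotient_ext d U (\<Phi> f) (\<Phi>1 f)"
        "Ck_family T k (2*d+1) (BGN_V1 TK d U) \<Phi>1" using Suc.prems(1) unfolding Ck_family.simps by blast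
      have "poly_map (Suc d) (2*d+1) (unit_step d i)"
        unfolding unit_step_def using i
        by (intro poly_map_cat3 poly_map_drop) (auto simp: poly_map_def intro!: poly_fun_intros)
      then have "Ck_family T k (Suc d) (pair_set d i U) (\<lambda>f y. \<Phi>1 f (unit_step d i y))"
        using unit_step_V1[OF i(1)] by (intro Ck_family_compose[OF \<Phi>1(2)] pair_set_extensional) auto
      moreover have "mabs (Suc d) \<beta> \<le> k" using dim Suc.prems(3) by simp
      ultimately obtain \<Psi> where \<Psi>: "continuous_map T (compact_open (Ksub (d + mabs d \<alpha>) (U_low TK (Suc d) \<beta> (pair_set d i U))) TF) \<Psi>"
          "\<forall>f\<in>topspace T. \<forall>x\<in>U_high TK (Suc d) \<beta> (pair_set d i U). \<Psi> f x = dd_high sc (Suc d) \<beta> (\<lambda>y. \<Phi>1 f (unit_step d i y)) x"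
        using Suc.IH[of "Suc d" "pair_set d i U" "\<lambda>f y. \<Phi>1 f (unit_step d i y)" \<beta>] pair_set_extensional
        unfolding dim by blast
      have "\<Psi> f x = dd_high sc d \<alpha> (\<Phi> f) x" if f: "f \<in> topspace T" and x: "x \<in> U_high TK d \<alpha> U" for f x
      proof -
        have "dd_high sc d \<alpha> (\<Phi> f) x = dd_high sc (Suc d) \<beta> (\<lambda>y. \<Phi>1 f (unit_step d i y)) x"
          using x i by (intro dd_high_split_pair[OF sp, of d x U] unit_step_quotient[OF \<Phi>1(1)[OF f]])
            (auto simp: U_high_inj)
        then show ?thesis using \<Psi>(2) f U_high_split[OF sp i(1) topspace_TK x] by simp
      qed
      then show ?thesis using \<Psi>(1) unfolding U_low_split[OF sp i(1) topspace_TK] by blast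
    qed
  }
qed

section \<open>The two permitted shapes of U and their stability\<close>

definition admissible :: "nat \<Rightarrow> (nat \<Rightarrow> 'k) set \<Rightarrow> bool" where
  "admissible d U \<longleftrightarrow> U \<subseteq> extensional {..<d} \<and> (openin (Kpow TK d) U \<or>
     (\<exists>Us. (\<forall>i<d. Us i \<subseteq> TK closure_of (TK interior_of (Us i))) \<and> U = PiE {..<d} Us))"

lemma admissible_dense_interior:
  assumes "admissible d U"
  shows "dense_interior d U"
  unfolding dense_interior_def
proof (intro conjI allI impI)
  show "U \<subseteq> extensional {..<d}" using assms by (simp add: admissible_def)
  fix Q assume Q: "openin (Kpow TK d) Q \<and> U \<inter> Q \<noteq> {}"
  consider "openin (Kpow TK d) U" | Us where "\<forall>i<d. Us i \<subseteq> TK closure_of (TK interior_of (Us i))" "U = PiE {..<d} Us"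
    using assms by (auto simp: admissible_def)
  then show "\<exists>O''. openin (Kpow TK d) O'' \<and> O'' \<noteq> {} \<and> O'' \<subseteq> U \<inter> Q"
  proof cases
    case 1 then show ?thesis using Q by (intro exI[of _ "U \<inter> Q"]) auto
  next
    case 2
    obtain x where x: "x \<in> U" "x \<in> Q" using Q by auto
    obtain B where B: "\<forall>i<d. openin TK (B i)" "x \<in> Pi\<^sub>E {..<d} B" "Pi\<^sub>E {..<d} B \<subseteq> Q"
      using Q x(2) unfolding Kpow_def openin_product_topology_alt by (metis lessThan_iff)
    let ?C = "\<lambda>i. B i \<inter> TK interior_of (Us i)"
    have ne: "?C i \<noteq> {}" if i: "i < d" for i
    proof -
      have "x i \<in> TK closure_of (TK interior_of (Us i))" using x(1) 2 i by (auto simp: PiE_iff)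
      moreover have "x i \<in> B i" using B(2) i by (auto simp: PiE_iff)
      ultimately show ?thesis using B(1) i unfolding in_closure_of by blast
    qed
    have "openin (Kpow TK d) (PiE {..<d} ?C)"
      unfolding Kpow_def using B(1) by (simp add: openin_PiE openin_Int)
    moreover have "PiE {..<d} ?C \<noteq> {}" using ne by (simp add: PiE_eq_empty_iff)
    moreover have "PiE {..<d} ?C \<subseteq> Q" using B(3) PiE_mono[of "{..<d}" ?C B] by blast
    moreover have "PiE {..<d} ?C \<subseteq> U" unfolding 2(2)
      by (rule PiE_mono) (rule le_infI2[OF interior_of_subset])
    ultimately show ?thesis by blast
  qed
qed

text \<open>An open U gives an intersection of two open preimages; a box gives the box with its i-th
  factor repeated. Both alternatives therefore survive in d + 1 variables, as the inductions over
  divided differences require.\<close>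

lemma admissible_pair_set:
  assumes "admissible d U" and i: "i < d"
  shows "admissible (Suc d) (pair_set d i U)"
proof -
  consider "openin (Kpow TK d) U" | Us where "\<forall>i<d. Us i \<subseteq> TK closure_of (TK interior_of (Us i))" "U = PiE {..<d} Us"
    using assms by (auto simp: admissible_def)
  then show ?thesis
  proof cases
    case 1
    have "pair_set d i U = {y \<in> extensional {..<Suc d}. drop_coord d i y \<in> U} \<inter> {y \<in> extensional {..<Suc d}. drop_coord d (Suc i) y \<in> U}"
      by (auto simp: pair_set_def)
    then have "openin (Kpow TK (Suc d)) (pair_set d i U)"
      using openin_poly_preimage[OF poly_map_drop 1] by (simp only:) (intro openin_Int)
    then show ?thesis unfolding admissible_def using pair_set_extensional by blast
  next
    case 2
    let ?Vs = "\<lambda>l. Us (if l \<le> i then l else l - 1)"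
    have "pair_set d i U = PiE {..<Suc d} ?Vs"
    proof (intro set_eqI iffI)
      fix y assume y: "y \<in> pair_set d i U"
      then have e: "y \<in> extensional {..<Suc d}" by (simp add: pair_set_def)
      have *: "y (skip i l) \<in> Us l" "y (skip (Suc i) l) \<in> Us l" if "l < d" for l
        using y that unfolding pair_set_def 2(2) drop_coord_def by (auto simp: PiE_iff)
      have "y l \<in> ?Vs l" if "l < Suc d" for l
      proof (cases "l \<le> i")
        case True then show ?thesis using *(2)[of l] i by (simp add: skip_def)
      next
        case False
        then obtain m where "l = Suc m" "i \<le> m" by (cases l) auto
        then show ?thesis using *(1)[of m] that by (simp add: skip_def)
      qed
      then show "y \<in> PiE {..<Suc d} ?Vs" using e by (simp add: PiE_iff)
    next
      fix y assume y: "y \<in> PiE {..<Suc d} ?Vs"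
      have yl: "y l \<in> ?Vs l" if "l < Suc d" for l using PiE_mem[OF y, of l] that by simp
      have "y (skip i l) \<in> Us l" "y (skip (Suc i) l) \<in> Us l" if "l < d" for l
        using yl[of l] yl[of "Suc l"] that by (cases l i rule: linorder_cases; simp add: skip_def)+
      then show "y \<in> pair_set d i U" using y by (auto simp: pair_set_def 2(2) drop_coord_def PiE_iff)
    qed
    moreover have "\<forall>l<Suc d. ?Vs l \<subseteq> TK closure_of (TK interior_of (?Vs l))" using 2(1) i by auto
    ultimately show ?thesis unfolding admissible_def
      by (intro conjI pair_set_extensional disjI2 exI[of _ ?Vs])
  qed
qed

text \<open>U^{<\<alpha>} arises from U by |\<alpha>| passages to pairs. It thus has dense interior,
  which makes f^{<\<alpha>} unique.\<close>

lemma admissible_U_low: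
  assumes "admissible d U"
  shows "admissible (d + mabs d \<alpha>) (U_low TK d \<alpha> U)"
  using assms
proof (induction "mabs d \<alpha>" arbitrary: d \<alpha> U)
  case 0
  then show ?case by (simp add: U_low_0 admissible_def)
next
  case (Suc m)
  then have "mabs d \<alpha> \<noteq> 0" by linarith
  then obtain i where i: "i < d" "\<alpha> i > 0" by (auto simp: mabs_def)
  obtain \<beta> where sp: "block_split i \<alpha> \<beta>" using block_split_exists[of \<alpha> i] i(2) by blast
  have dim: "Suc d + mabs (Suc d) \<beta> = d + mabs d \<alpha>" "m = mabs (Suc d) \<beta>"
    using block_split_mabs[OF sp i(1)] Suc(2) by simp_all
  show ?case using Suc(1)[OF dim(2) admissible_pair_set[OF Suc(3) i(1)]]
    unfolding dim(1) U_low_split[OF sp i(1) topspace_TK] .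
qed

end

section \<open>From divided differences to difference quotients\<close>

text \<open>The first i coordinates are those of x + ty, the others those of x: the path from x to x
  + ty that changes one coordinate at a time.\<close>

definition mixed_point :: "nat \<Rightarrow> nat \<Rightarrow> (nat \<Rightarrow> 'k::field) \<Rightarrow> (nat \<Rightarrow> 'k)" where
  "mixed_point d i z = (\<lambda>l\<in>{..<d}. if l < i then z l + z (2*d) * z (d + l) else z l)"

text \<open>The point of K^(d+1) joining two successive mixed points: positions i and i + 1 hold x_i
  and x_i + t y_i, so their gap is t y_i.\<close>

definition mixed_pair :: "nat \<Rightarrow> nat \<Rightarrow> (nat \<Rightarrow> 'k::field) \<Rightarrow> (nat \<Rightarrow> 'k)" where
  "mixed_pair d i z = (\<lambda>l\<in>{..<Suc d}. if l \<le> i then mixed_point d i z l else mixed_point d (Suc i) z (l - 1))"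

lemma poly_map_mixed_point: "poly_map (2*d+1) d (mixed_point d i :: (nat \<Rightarrow> 'a::field) \<Rightarrow> _)"
  unfolding poly_map_def
proof (intro conjI allI impI)
  show "mixed_point d i x \<in> extensional {..<d}" for x :: "nat \<Rightarrow> 'a" by (simp add: mixed_point_def)
  show "poly_fun (2*d+1) (\<lambda>z :: nat \<Rightarrow> 'a. mixed_point d i z l)" if "l < d" for l
    using that by (cases "l < i") (auto simp: mixed_point_def intro!: poly_fun.intros)
qed

lemma poly_map_mixed_pair:
  assumes "i < d"
  shows "poly_map (2*d+1) (Suc d) (mixed_pair d i)"
  unfolding poly_map_def
proof (intro conjI allI impI)
  show "mixed_pair d i x \<in> extensional {..<Suc d}" for x :: "nat \<Rightarrow> 'a" by (simp add: mixed_pair_def)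
  fix l assume l: "l < Suc d"
  have p: "poly_fun (2*d+1) (\<lambda>z::nat \<Rightarrow> 'a. mixed_point d j z m)" if "m < d" for j m
    using that poly_map_mixed_point unfolding poly_map_def by blast
  show "poly_fun (2*d+1) (\<lambda>z::nat \<Rightarrow> 'a. mixed_pair d i z l)"
    using p[of l i] p[of "l - 1" "Suc i"] l assms by (cases "l \<le> i") (auto simp: mixed_pair_def)
qed

lemma drop_mixed_pair:
  assumes "i < d"
  shows "drop_coord d i (mixed_pair d i z) = mixed_point d (Suc i) z"
    "drop_coord d (Suc i) (mixed_pair d i z) = mixed_point d i z"
  using assms by (auto simp: drop_coord_def mixed_pair_def mixed_point_def skip_def fun_eq_iff)

lemma mixed_pair_diff:
  "i < d \<Longrightarrow> mixed_pair d i z (Suc i) - mixed_pair d i z i = z (2*d) * z (d + i)"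
  by (simp add: mixed_pair_def mixed_point_def)

lemma mixed_point_ends: "mixed_point d 0 z = base_part d z" "mixed_point d d z = end_point d z"
  by (auto simp: mixed_point_def base_part_def end_point_def vadd_def dir_part_def fun_eq_iff)

lemma mixed_point_0: "z (2*d) = 0 \<Longrightarrow> mixed_point d i z = base_part d z"
  by (auto simp: mixed_point_def base_part_def fun_eq_iff)

context top_vec
begin

text \<open>Requiring the formula for divided differences only at points all of whose coordinates are
  distinct, across blocks as well, makes the notion pass from \<open>\<Phi>\<close> to its first-order divided
  differences without any continuity argument.\<close>

definition SDS_family :: "'a topology \<Rightarrow> nat \<Rightarrow> nat \<Rightarrow> (nat \<Rightarrow> 'k) set \<Rightarrow> ('a \<Rightarrow> (nat \<Rightarrow> 'k) \<Rightarrow> 'f) \<Rightarrow> bool" where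
  "SDS_family T k d U \<Phi> \<longleftrightarrow> continuous_map T (compact_open (Ksub d U) TF) \<Phi> \<and>
    (\<forall>\<alpha>\<in>multi_idx d. 1 \<le> mabs d \<alpha> \<and> mabs d \<alpha> \<le> k \<longrightarrow>
      (\<exists>\<Psi>. continuous_map T (compact_open (Ksub (d + mabs d \<alpha>) (U_low TK d \<alpha> U)) TF) \<Psi> \<and>
        (\<forall>f\<in>topspace T. \<forall>x\<in>U_low TK d \<alpha> U. inj_on x {..<d + mabs d \<alpha>} \<longrightarrow>
           \<Psi> f x = dd_high sc d \<alpha> (\<Phi> f) x)))"

lemma Ck_family_0_continuous:
  "Ck_family T 0 n V \<Phi> \<Longrightarrow> f \<in> topspace T \<Longrightarrow> continuous_map (Ksub n V) TF (\<Phi> f)"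
  by (simp add: continuous_map_compact_open_iff)

text \<open>The family \<open>\<Psi>\<close> is the given extension for \<alpha> = e_i. Its divided
  differences of order \<beta> are those of \<Phi> of the order in which blocks i and i + 1 are
  merged, over the same vectors, so the extensions already given for \<Phi> serve for
  \<open>\<Psi>\<close>.\<close>

lemma SDS_family_pair:
  assumes U: "admissible d U" and S: "SDS_family T (Suc k) d U \<Phi>" and i: "i < d"
  obtains \<Psi> where "SDS_family T k (Suc d) (pair_set d i U) \<Psi>"
    "\<And>f y. f \<in> topspace T \<Longrightarrow> y \<in> pair_set d i U \<Longrightarrow>
       sc (y (Suc i) - y i) (\<Psi> f y) = \<Phi> f (drop_coord d i y) - \<Phi> f (drop_coord d (Suc i) y)"
proof -
  let ?P = "pair_set d i U"
  define \<epsilon> where "\<epsilon> = (\<lambda>l. if l = i then 1 else 0 :: nat)"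
  have sp0: "block_split i \<epsilon> (\<lambda>_. 0)" by (auto simp: block_split_def \<epsilon>_def)
  have z0: "mabs (Suc d) (\<lambda>_. 0) = 0" by (simp add: mabs_def)
  have m1: "mabs d \<epsilon> = 1" using block_split_mabs[OF sp0 i] z0 by simp
  have low: "U_low TK d \<epsilon> U = ?P"
    using U_low_split[OF sp0 i topspace_TK] U_low_0[OF z0 pair_set_extensional topspace_TK] by simp
  have "\<epsilon> \<in> multi_idx d" using i by (auto simp: multi_idx_def \<epsilon>_def)
  then obtain \<Psi> where \<Psi>: "continuous_map T (compact_open (Ksub (Suc d) ?P) TF) \<Psi>"
      "\<And>f x. f\<in>topspace T \<Longrightarrow> x\<in>?P \<Longrightarrow> inj_on x {..<Suc d} \<Longrightarrow> \<Psi> f x = dd_high sc d \<epsilon> (\<Phi> f) x"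
    using S m1 low unfolding SDS_family_def by fastforce
  have \<Phi>: "Ck_family T 0 d U \<Phi>" using S by (simp add: SDS_family_def)
  \<comment> \<open>Both sides are continuous in y, so the formula for the divided difference at
    distinct coordinates extends to all of U^{<e_i>}, coinciding nodes included.\<close>
  have quot: "sc (y (Suc i) - y i) (\<Psi> f y) = \<Phi> f (drop_coord d i y) - \<Phi> f (drop_coord d (Suc i) y)"
    if f: "f \<in> topspace T" and y: "y \<in> ?P" for f y
  proof (rule dense_interior_unique[OF admissible_dense_interior[OF admissible_pair_set[OF U i]] _ Hausdorff_TF _ _ y])
    have "Ck_family T 0 (Suc d) ?P (\<lambda>f y. sc (y (Suc i) - y i) (\<Psi> f y))"
      using \<Psi>(1) i by (intro Ck_family_scale pair_set_extensional) (auto intro!: poly_fun_intros)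
    then show "continuous_map (Ksub (Suc d) ?P) TF (\<lambda>y. sc (y (Suc i) - y i) (\<Psi> f y))"
      using f by (rule Ck_family_0_continuous)
    have "Ck_family T 0 (Suc d) ?P (\<lambda>f y. \<Phi> f (drop_coord d i y) - \<Phi> f (drop_coord d (Suc i) y))"
      by (intro Ck_family_diff pair_set_extensional Ck_family_compose[OF \<Phi> poly_map_drop]) (auto simp: pair_set_def)
    then show "continuous_map (Ksub (Suc d) ?P) TF (\<lambda>y. \<Phi> f (drop_coord d i y) - \<Phi> f (drop_coord d (Suc i) y))"
      using f by (rule Ck_family_0_continuous)
    fix y assume y: "y \<in> ?P" and inj: "inj_on y {..<Suc d}"
    let ?g = "\<lambda>y. sc (inverse (y (Suc i) - y i)) (\<Phi> f (drop_coord d i y) - \<Phi> f (drop_coord d (Suc i) y))"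
    have ye: "y \<in> extensional {..<Suc d}" using y by (simp add: pair_set_def)
    have ne: "y (Suc i) \<noteq> y i" using inj_on_eq_iff[OF inj, of "Suc i" i] i by simp
    have "dd_high sc d \<epsilon> (\<Phi> f) y = dd_high sc (Suc d) (\<lambda>_. 0) ?g y"
    proof (rule dd_high_split[OF sp0 i])
      have "block \<epsilon> i \<subseteq> {..<Suc d}" using block_less[of _ \<epsilon> i d] i m1 by auto
      then show "inj_on y (block \<epsilon> i)" using inj inj_on_subset by blast
      fix c assume "c \<in> PiE {..<Suc d} (block (\<lambda>_. 0))"
      then have "c = (\<lambda>l\<in>{..<Suc d}. l)" unfolding mabs_0_block[OF z0] by simp
      then have "c (Suc i) = Suc i" "c i = i" using i by auto
      then show "sc (y (c (Suc i)) - y (c i)) (?g (pick (Suc d) y c)) =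
         \<Phi> f (pick d y (c \<circ> skip i)) - \<Phi> f (pick d y (c \<circ> skip (Suc i)))"
        using ne i unfolding drop_coord_pick by (simp add: pick_def)
    qed
    also have "\<dots> = ?g y" by (rule dd_high_0[OF z0 ye])
    finally show "sc (y (Suc i) - y i) (\<Psi> f y) = \<Phi> f (drop_coord d i y) - \<Phi> f (drop_coord d (Suc i) y)"
      unfolding \<Psi>(2)[OF f y inj] using ne by simp
  qed
  have "SDS_family T k (Suc d) ?P \<Psi>"
    unfolding SDS_family_def
  proof (intro conjI ballI impI)
    fix \<beta> assume \<beta>: "\<beta> \<in> multi_idx (Suc d)" and m: "1 \<le> mabs (Suc d) \<beta> \<and> mabs (Suc d) \<beta> \<le> k"
    obtain \<alpha> where sp: "block_split i \<alpha> \<beta>" and \<alpha>: "\<alpha> \<in> multi_idx d" using block_merge_exists[OF i \<beta>] .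
    have dim: "Suc d + mabs (Suc d) \<beta> = d + mabs d \<alpha>" and md: "1 \<le> mabs d \<alpha>" "mabs d \<alpha> \<le> Suc k"
      using block_split_mabs[OF sp i] m by simp_all
    obtain \<Xi> where \<Xi>: "continuous_map T (compact_open (Ksub (d + mabs d \<alpha>) (U_low TK d \<alpha> U)) TF) \<Xi>"
      "\<And>f x. f\<in>topspace T \<Longrightarrow> x\<in>U_low TK d \<alpha> U \<Longrightarrow> inj_on x {..<d + mabs d \<alpha>} \<Longrightarrow> \<Xi> f x = dd_high sc d \<alpha> (\<Phi> f) x"
      using S \<alpha> md unfolding SDS_family_def by meson
    have "\<Xi> f x = dd_high sc (Suc d) \<beta> (\<Psi> f) x"
      if f: "f \<in> topspace T" and x: "x \<in> U_low TK d \<alpha> U" and inj: "inj_on x {..<d + mabs d \<alpha>}" for f x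
    proof -
      have "block \<alpha> i \<subseteq> {..<d + mabs d \<alpha>}" using block_less[of _ \<alpha> i d] i by auto
      then have "inj_on x (block \<alpha> i)" using inj inj_on_subset by blast
      from dd_high_split_pair[OF sp i x this quot[OF f]] show ?thesis using \<Xi>(2)[OF f x inj] by simp
    qed
    then show "\<exists>\<Psi>'. continuous_map T (compact_open (Ksub (Suc d + mabs (Suc d) \<beta>) (U_low TK (Suc d) \<beta> ?P)) TF) \<Psi>' \<and>
        (\<forall>f\<in>topspace T. \<forall>x\<in>U_low TK (Suc d) \<beta> ?P. inj_on x {..<Suc d + mabs (Suc d) \<beta>} \<longrightarrow>
           \<Psi>' f x = dd_high sc (Suc d) \<beta> (\<Psi> f) x)"
      using \<Xi>(1) unfolding dim U_low_split[OF sp i topspace_TK, symmetric] by blast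
  qed (rule \<Psi>(1))
  then show ?thesis using quot by (rule that)
qed

text \<open>For open U the set \<open>P\<close> is an intersection of preimages of U; when t = 0 all
  mixed points equal x, so \<open>P\<close> contains these points. For a box, each coordinate of a
  mixed point comes from x or from x + ty, so all mixed points lie in U and \<open>P\<close> can be
  everything.\<close>

lemma mixed_points_open:
  assumes "admissible d U"
  obtains P where "openin (Kpow TK (2*d+1)) P"
    "\<And>z i. z \<in> BGN_V1 TK d U \<Longrightarrow> z \<in> P \<Longrightarrow> i \<le> d \<Longrightarrow> mixed_point d i z \<in> U"
    "\<And>z. z \<in> BGN_V1 TK d U \<Longrightarrow> z (2*d) = 0 \<Longrightarrow> z \<in> P"
proof -
  have Ue: "U \<subseteq> extensional {..<d}" using assms by (simp add: admissible_def)
  consider "openin (Kpow TK d) U" | Us where "U = PiE {..<d} Us"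
    using assms by (auto simp: admissible_def)
  then show ?thesis
  proof cases
    case 1
    let ?P = "\<Inter>i\<in>{..d}. {z \<in> extensional {..<2*d+1}. mixed_point d i z \<in> U}"
    show ?thesis
    proof (rule that[of ?P])
      show "openin (Kpow TK (2*d+1)) ?P"
        by (intro openin_INT2 openin_poly_preimage[OF poly_map_mixed_point 1]) auto
      show "z \<in> ?P" if "z \<in> BGN_V1 TK d U" "z (2*d) = 0" for z
        using that mixed_point_0[of z d] by (auto simp: mem_V1_iff[OF Ue])
    qed auto
  next
    case 2
    show ?thesis
    proof (rule that[OF openin_topspace])
      fix z i assume z: "z \<in> BGN_V1 TK d U"
      then have "base_part d z \<in> U" "end_point d z \<in> U" by (auto simp: mem_V1_iff[OF Ue])
      then have "z l \<in> Us l" "z l + z (2*d) * z (d + l) \<in> Us l" if "l < d" for l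
        using that unfolding 2 by (auto simp: base_part_def end_point_def vadd_def dir_part_def PiE_iff)
      then show "mixed_point d i z \<in> U" unfolding 2 mixed_point_def by auto
    qed (use V1_extensional in auto)
  qed
qed

text \<open>The induction hypothesis is used twice: for U^{<e_i>} in d + 1 variables, to get the
  first-order divided differences as families of class k, and for U itself, because away from t = 0
  the quotient is formed from \<Phi>, which must then have class k.\<close>

lemma SDS_imp_Ck_family:
  assumes "admissible d U" "SDS_family T k d U \<Phi>"
  shows "Ck_family T k d U \<Phi>"
  using assms
proof (induction k arbitrary: d U \<Phi>)
  case 0 then show ?case by (simp add: SDS_family_def)
next
  case (Suc k)
  note U = Suc.prems(1)
  have Ue: "U \<subseteq> extensional {..<d}" using U by (simp add: admissible_def)
  have "SDS_family T k d U \<Phi>" using Suc.prems(2) unfolding SDS_family_def by (meson le_Suc_eq)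
  then have \<Phi>: "Ck_family T k d U \<Phi>" by (rule Suc.IH[OF U])
  have "\<forall>i. \<exists>\<Psi>. i < d \<longrightarrow> SDS_family T k (Suc d) (pair_set d i U) \<Psi> \<and>
    (\<forall>f\<in>topspace T. \<forall>y\<in>pair_set d i U.
       sc (y (Suc i) - y i) (\<Psi> f y) = \<Phi> f (drop_coord d i y) - \<Phi> f (drop_coord d (Suc i) y))"
    using SDS_family_pair[OF Suc.prems] by metis
  then obtain \<Psi> where \<Psi>: "\<And>i. i < d \<Longrightarrow> SDS_family T k (Suc d) (pair_set d i U) (\<Psi> i)"
    "\<And>i f y. i < d \<Longrightarrow> f \<in> topspace T \<Longrightarrow> y \<in> pair_set d i U \<Longrightarrow>
       sc (y (Suc i) - y i) (\<Psi> i f y) = \<Phi> f (drop_coord d i y) - \<Phi> f (drop_coord d (Suc i) y)"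
    by metis
  have \<Psi>k: "Ck_family T k (Suc d) (pair_set d i U) (\<Psi> i)" if "i < d" for i
    using Suc.IH[OF admissible_pair_set[OF U that] \<Psi>(1)[OF that]] .
  obtain P where P: "openin (Kpow TK (2*d+1)) P"
    "\<And>z i. z \<in> BGN_V1 TK d U \<Longrightarrow> z \<in> P \<Longrightarrow> i \<le> d \<Longrightarrow> mixed_point d i z \<in> U"
    "\<And>z. z \<in> BGN_V1 TK d U \<Longrightarrow> z (2*d) = 0 \<Longrightarrow> z \<in> P"
    using mixed_points_open[OF U] by metis
  let ?V1 = "BGN_V1 TK d U"
  let ?R = "{z \<in> extensional {..<2*d+1}. z (2*d) \<noteq> 0}"
  have oR: "openin (Kpow TK (2*d+1)) ?R" by (rule openin_last_nonzero)
  define S where "S f z = (\<Sum>i<d. sc (z (d + i)) (\<Psi> i f (mixed_pair d i z)))" for f z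
  define D where "D f z = sc (inverse (z (2*d))) (\<Phi> f (end_point d z) - \<Phi> f (base_part d z))" for f z
  define \<Phi>1 where "\<Phi>1 f z = (if z \<in> P then S f z else D f z)" for f z
  have mp: "mixed_pair d i z \<in> pair_set d i U" if "z \<in> ?V1" "z \<in> P" "i < d" for z i
    using P(2)[OF that(1,2), of i] P(2)[OF that(1,2), of "Suc i"] that(3)
    by (simp add: pair_set_def drop_mixed_pair) (simp add: mixed_pair_def)
  have tS: "sc (z (2*d)) (S f z) = \<Phi> f (end_point d z) - \<Phi> f (base_part d z)"
    if f: "f \<in> topspace T" and z: "z \<in> ?V1" "z \<in> P" for f z
  proof -
    \<comment> \<open>Multiplication by t turns each factor y_i into the gap of the i-th pair, so
      every term becomes a difference of \<Phi> at successive mixed points.\<close>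
    have "sc (z (2*d)) (S f z) = (\<Sum>i<d. sc (mixed_pair d i z (Suc i) - mixed_pair d i z i) (\<Psi> i f (mixed_pair d i z)))"
      unfolding S_def scale_sum_right by (rule sum.cong) (simp_all add: mixed_pair_diff)
    also have "\<dots> = (\<Sum>i<d. \<Phi> f (mixed_point d (Suc i) z) - \<Phi> f (mixed_point d i z))"
      by (rule sum.cong) (simp_all add: \<Psi>(2)[OF _ f mp[OF z]] drop_mixed_pair)
    also have "\<dots> = \<Phi> f (mixed_point d d z) - \<Phi> f (mixed_point d 0 z)"
      by (rule sum_lessThan_telescope)
    finally show ?thesis by (simp add: mixed_point_ends)
  qed
  have tD: "sc (z (2*d)) (D f z) = \<Phi> f (end_point d z) - \<Phi> f (base_part d z)" if "z (2*d) \<noteq> 0" for f z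
    using that by (simp add: D_def)
  have ext: "quotient_ext d U (\<Phi> f) (\<Phi>1 f)" if f: "f \<in> topspace T" for f
    unfolding quotient_ext_def
  proof (intro ballI allI impI)
    fix x y t assume x: "x \<in> U" and y: "y \<in> extensional {..<d}" and w: "vadd d x t y \<in> U"
    let ?z = "cat3 d x y t"
    have b: "base_part d ?z = x" "end_point d ?z = vadd d x t y" using x y Ue by (auto simp: cat3_parts)
    \<comment> \<open>A point outside \<open>P\<close> has t nonzero, so the branch \<open>D\<close>
      is never evaluated at t = 0 here.\<close>
    show "sc t (\<Phi>1 f ?z) = \<Phi> f (vadd d x t y) - \<Phi> f x"
      using tS[OF f cat3_in_V1[OF x y w]] tD[of ?z f] P(3)[OF cat3_in_V1[OF x y w]]
      unfolding b by (auto simp: \<Phi>1_def)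
  qed
  have "Ck_family T k (2*d+1) ?V1 \<Phi>1"
  proof (rule Ck_family_local[OF dense_interior_V1[OF admissible_dense_interior[OF U]] P(1) oR])
    show "?V1 \<subseteq> P \<union> ?R" using P(3) V1_extensional by auto
    have e: "?V1 \<inter> P \<subseteq> extensional {..<2*d+1}" "?V1 \<inter> ?R \<subseteq> extensional {..<2*d+1}" using V1_extensional by auto
    have "Ck_family T k (2*d+1) (?V1 \<inter> P) S"
      unfolding S_def
    proof (rule Ck_family_sum[OF e(1)])
      show "Ck_family T k (2*d+1) (?V1 \<inter> P) (\<lambda>f z. \<Phi> f (base_part d z))"
        by (rule Ck_family_subset[OF Ck_family_base[OF \<Phi> Ue] _ e(1)]) blast
      fix i assume "i \<in> {..<d}"
      then have i: "i < d" by simp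
      show "Ck_family T k (2*d+1) (?V1 \<inter> P) (\<lambda>f z. sc (z (d + i)) (\<Psi> i f (mixed_pair d i z)))"
        using i mp by (intro Ck_family_scale Ck_family_compose[OF \<Psi>k[OF i] poly_map_mixed_pair[OF i]] e(1))
          (auto intro: poly_fun.intros)
    qed simp
    then show "Ck_family T k (2*d+1) (?V1 \<inter> P) \<Phi>1"
      by (rule Ck_family_cong) (simp add: \<Phi>1_def)
    have "Ck_family T k (2*d+1) (?V1 \<inter> ?R) (\<lambda>f z. \<Phi> f (end_point d z) - \<Phi> f (base_part d z))"
      by (rule Ck_family_subset[OF Ck_family_diff[OF Ck_family_end[OF \<Phi> Ue] Ck_family_base[OF \<Phi> Ue] V1_extensional] _ e(2)])
        blast
    then have "Ck_family T k (2*d+1) (?V1 \<inter> ?R) D"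
      unfolding D_def by (rule Ck_family_divide) (use e in \<open>auto intro: poly_fun.intros\<close>)
    then show "Ck_family T k (2*d+1) (?V1 \<inter> ?R) \<Phi>1"
    proof (rule Ck_family_cong)
      fix f z assume f: "f \<in> topspace T" and z: "z \<in> ?V1 \<inter> ?R"
      \<comment> \<open>On the overlap both expressions multiplied by t give the same increment, and
        t is nonzero.\<close>
      have "S f z = D f z" if "z \<in> P"
      proof -
        have "sc (z (2*d)) (S f z) = sc (z (2*d)) (D f z)" using tS[OF f _ that] tD z by simp
        then show ?thesis using z by simp
      qed
      then show "D f z = \<Phi>1 f z" by (auto simp: \<Phi>1_def)
    qed
  qed
  from Ck_family_SucI[OF Ck_family_continuous[OF \<Phi>] ext this] show ?case .
qed

section \<open>Comparison of the two function spaces\<close>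

lemma continuous_BGN_gk:
  "BGN_Ck TK TF sc j n V g \<Longrightarrow> continuous_map (Ksub (BGN_dim j n) (BGN_Vk TK j n V)) TF (BGN_gk TK TF sc j n V g)"
  by (induction j arbitrary: n V g) auto

lemma is_BGN_continuous_gk:
  "continuous_map (BGN_top TK TF sc k d U)
     (compact_open (Ksub (BGN_dim j d) (BGN_Vk TK j d U)) TF) (\<lambda>f. BGN_gk TK TF sc j d U f)"
  if "enat j \<le> k"
  unfolding BGN_top_def
  by (rule continuous_map_from_initial_top[where \<phi>="\<lambda>j f. BGN_gk TK TF sc j d U f" and i=j])
    (use that in \<open>auto simp: topspace_compact_open is_BGN_def intro: continuous_BGN_gk\<close>)

lemma SDS_fa_ext:
  assumes "\<exists>h. SDS_ext TK TF sc d U \<alpha> f h" "mabs d \<alpha> \<noteq> 0"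
  shows "SDS_ext TK TF sc d U \<alpha> f (SDS_fa TK TF sc d U \<alpha> f)"
  using someI_ex[OF assms(1)] assms(2) by (simp add: SDS_fa_def)

lemma U_low_distinct_high:
  assumes "x \<in> U_low TK d \<alpha> U" "inj_on x {..<d + mabs d \<alpha>}"
  shows "x \<in> U_high TK d \<alpha> U"
  using assms block_less[of _ \<alpha> _ d] by (auto simp: U_high_inj intro!: inj_on_subset[OF assms(2)])

lemma is_SDS_continuous_fa:
  assumes \<alpha>: "\<alpha> \<in> multi_idx d" "enat (mabs d \<alpha>) \<le> k" and U: "U \<subseteq> extensional {..<d}"
  shows "continuous_map (SDS_top TK TF sc k d U)
     (compact_open (Ksub (d + mabs d \<alpha>) (U_low TK d \<alpha> U)) TF) (\<lambda>f. SDS_fa TK TF sc d U \<alpha> f)"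
  unfolding SDS_top_def
proof (rule continuous_map_from_initial_top[where \<phi>="\<lambda>\<alpha> f. SDS_fa TK TF sc d U \<alpha> f" and i=\<alpha>])
  show "\<alpha> \<in> {\<alpha> \<in> multi_idx d. enat (mabs d \<alpha>) \<le> k}" using \<alpha> by simp
  fix f assume "f \<in> {f. is_SDS TK TF sc k d U f}"
  then have f: "is_SDS TK TF sc k d U f" by simp
  show "SDS_fa TK TF sc d U \<alpha> f \<in> topspace (compact_open (Ksub (d + mabs d \<alpha>) (U_low TK d \<alpha> U)) TF)"
  proof (cases "mabs d \<alpha> = 0")
    case True
    then show ?thesis using f U_low_0[OF True U topspace_TK]
      by (simp add: topspace_compact_open SDS_fa_def is_SDS_def)
  next
    case False
    then have "\<exists>h. SDS_ext TK TF sc d U \<alpha> f h" using f \<alpha> by (simp add: is_SDS_def)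
    from SDS_fa_ext[OF this False] show ?thesis by (simp add: SDS_ext_def topspace_compact_open)
  qed
qed

text \<open>The parameter space is the function space with its own initial topology, and the family
  is the identity; continuity of f |-> f^{<\<alpha>} is then the hypothesis on families. Finite
  orders m suffice, also for infinite k.\<close>

lemma SDS_top_Ck_family:
  assumes U: "admissible d U" and m: "enat m \<le> k"
  shows "Ck_family (SDS_top TK TF sc k d U) m d U (\<lambda>f. f)"
proof (rule SDS_imp_Ck_family[OF U])
  have Ue: "U \<subseteq> extensional {..<d}" using U by (simp add: admissible_def)
  show "SDS_family (SDS_top TK TF sc k d U) m d U (\<lambda>f. f)"
    unfolding SDS_family_def
  proof (intro conjI ballI impI)
    \<comment> \<open>The order zero belongs to the initial topology and, since
      \<open>SDS_fa\<close> is then f itself, yields continuity of the identity into the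
      compact-open topology.\<close>
    have z: "(\<lambda>_. 0) \<in> multi_idx d" "mabs d (\<lambda>_. 0) = 0" by (auto simp: multi_idx_def mabs_def)
    then show "continuous_map (SDS_top TK TF sc k d U) (compact_open (Ksub d U) TF) (\<lambda>f. f)"
      using is_SDS_continuous_fa[of "\<lambda>_. 0" d k U] Ue U_low_0[OF z(2) Ue topspace_TK]
      by (simp add: SDS_fa_def zero_enat_def[symmetric])
    fix \<alpha> assume \<alpha>: "\<alpha> \<in> multi_idx d" and ma: "1 \<le> mabs d \<alpha> \<and> mabs d \<alpha> \<le> m"
    have mk: "enat (mabs d \<alpha>) \<le> k" using ma m by (meson enat_ord_simps(1) order_trans)
    have "SDS_fa TK TF sc d U \<alpha> f x = dd_high sc d \<alpha> f x"
      if f: "is_SDS TK TF sc k d U f" and x: "x \<in> U_low TK d \<alpha> U" "inj_on x {..<d + mabs d \<alpha>}" for f x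
    proof -
      have "\<exists>h. SDS_ext TK TF sc d U \<alpha> f h" using f \<alpha> ma mk by (simp add: is_SDS_def)
      from SDS_fa_ext[OF this] ma have "SDS_ext TK TF sc d U \<alpha> f (SDS_fa TK TF sc d U \<alpha> f)" by simp
      then show ?thesis using U_low_distinct_high[OF x] by (simp add: SDS_ext_def)
    qed
    then show "\<exists>\<Psi>. continuous_map (SDS_top TK TF sc k d U) (compact_open (Ksub (d + mabs d \<alpha>) (U_low TK d \<alpha> U)) TF) \<Psi> \<and>
        (\<forall>f\<in>topspace (SDS_top TK TF sc k d U). \<forall>x\<in>U_low TK d \<alpha> U. inj_on x {..<d + mabs d \<alpha>} \<longrightarrow>
          \<Psi> f x = dd_high sc d \<alpha> f x)"
      using is_SDS_continuous_fa[OF \<alpha> mk Ue]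
      by (intro exI[of _ "\<lambda>f. SDS_fa TK TF sc d U \<alpha> f"]) (auto simp: SDS_top_def)
  qed
qed

lemma BGN_top_Ck_family:
  assumes U: "admissible d U" and m: "enat m \<le> k"
  shows "Ck_family (BGN_top TK TF sc k d U) m d U (\<lambda>f. f)"
proof (rule BGN_imp_Ck_family)
  show "U \<subseteq> extensional {..<d}" using U by (simp add: admissible_def)
  show "\<forall>f\<in>topspace (BGN_top TK TF sc k d U). BGN_Ck TK TF sc m d U f"
    using m by (auto simp: BGN_top_def is_BGN_def)
  show "\<forall>j\<le>m. continuous_map (BGN_top TK TF sc k d U) (compact_open (Ksub (BGN_dim j d) (BGN_Vk TK j d U)) TF)
      (\<lambda>f. BGN_gk TK TF sc j d U f)"
    using m by (intro allI impI is_BGN_continuous_gk) (meson enat_ord_simps(1) order_trans)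
qed

text \<open>Uniqueness of the extension on U^{<\<alpha>}: it lets the chosen f^{<\<alpha>} be
  replaced by the one built from difference quotients.\<close>

lemma SDS_fa_eq:
  assumes U: "admissible d U" and h: "SDS_ext TK TF sc d U \<alpha> f h" and m: "mabs d \<alpha> \<noteq> 0"
    and x: "x \<in> U_low TK d \<alpha> U"
  shows "SDS_fa TK TF sc d U \<alpha> f x = h x"
proof (rule dense_interior_unique[OF admissible_dense_interior[OF admissible_U_low[OF U]] _ Hausdorff_TF _ _ x])
  have e: "SDS_ext TK TF sc d U \<alpha> f (SDS_fa TK TF sc d U \<alpha> f)" using SDS_fa_ext h m by blast
  show "continuous_map (Ksub (d + mabs d \<alpha>) (U_low TK d \<alpha> U)) TF (SDS_fa TK TF sc d U \<alpha> f)"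
    "continuous_map (Ksub (d + mabs d \<alpha>) (U_low TK d \<alpha> U)) TF h" using e h by (simp_all add: SDS_ext_def)
  fix y assume "y \<in> U_low TK d \<alpha> U" "inj_on y {..<d + mabs d \<alpha>}"
  from U_low_distinct_high[OF this] show "SDS_fa TK TF sc d U \<alpha> f y = h y" using e h by (simp add: SDS_ext_def)
qed

lemma BGN_top_continuous_fa:
  assumes U: "admissible d U" and \<alpha>: "enat (mabs d \<alpha>) \<le> k"
  shows "continuous_map (BGN_top TK TF sc k d U)
     (compact_open (Ksub (d + mabs d \<alpha>) (U_low TK d \<alpha> U)) TF) (\<lambda>f. SDS_fa TK TF sc d U \<alpha> f)"
    and "mabs d \<alpha> \<noteq> 0 \<Longrightarrow> is_BGN TK TF sc k d U f \<Longrightarrow> \<exists>h. SDS_ext TK TF sc d U \<alpha> f h"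
proof -
  have Ue: "U \<subseteq> extensional {..<d}" using U by (simp add: admissible_def)
  note F = BGN_top_Ck_family[OF U \<alpha>]
  obtain \<Psi> where \<Psi>: "continuous_map (BGN_top TK TF sc k d U) (compact_open (Ksub (d + mabs d \<alpha>) (U_low TK d \<alpha> U)) TF) \<Psi>"
    "\<And>f x. is_BGN TK TF sc k d U f \<Longrightarrow> x \<in> U_high TK d \<alpha> U \<Longrightarrow> \<Psi> f x = dd_high sc d \<alpha> f x"
    using Ck_family_imp_SDS[OF F Ue order_refl] by (auto simp: BGN_top_def)
  have ext: "SDS_ext TK TF sc d U \<alpha> f (\<Psi> f)" if "is_BGN TK TF sc k d U f" for f
    using \<Psi> that unfolding SDS_ext_def continuous_map_compact_open_iff by (auto simp: BGN_top_def)
  then show "is_BGN TK TF sc k d U f \<Longrightarrow> \<exists>h. SDS_ext TK TF sc d U \<alpha> f h" by blast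
  show "continuous_map (BGN_top TK TF sc k d U)
     (compact_open (Ksub (d + mabs d \<alpha>) (U_low TK d \<alpha> U)) TF) (\<lambda>f. SDS_fa TK TF sc d U \<alpha> f)"
  proof (cases "mabs d \<alpha> = 0")
    case True
    then show ?thesis using Ck_family_continuous[OF F] U_low_0[OF True Ue topspace_TK]
      by (simp add: SDS_fa_def)
  next
    case False
    show ?thesis
      by (rule co_continuous_cong[OF \<Psi>(1)]) (use SDS_fa_eq[OF U ext False] in \<open>auto simp: BGN_top_def\<close>)
  qed
qed

text \<open>Each function is a point of the parameter space of an identity family, and the results
  on families are read off at that point.\<close>

lemma is_BGN_iff_is_SDS:
  assumes U: "admissible d U"
  shows "is_BGN TK TF sc k d U f \<longleftrightarrow> is_SDS TK TF sc k d U f"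
proof
  assume f: "is_BGN TK TF sc k d U f"
  have "enat 0 \<le> k" by (simp add: zero_enat_def[symmetric])
  then have "BGN_Ck TK TF sc 0 d U f" using f by (simp add: is_BGN_def del: BGN_Ck.simps)
  moreover have "\<exists>h. SDS_ext TK TF sc d U \<alpha> f h" if "1 \<le> mabs d \<alpha>" "enat (mabs d \<alpha>) \<le> k" for \<alpha>
    by (rule BGN_top_continuous_fa(2)[OF U that(2) _ f]) (use that in simp)
  ultimately show "is_SDS TK TF sc k d U f" using f by (auto simp: is_SDS_def is_BGN_def)
next
  assume f: "is_SDS TK TF sc k d U f"
  then have "f \<in> topspace (SDS_top TK TF sc k d U)" by (simp add: SDS_top_def)
  then have "BGN_Ck TK TF sc m d U f" if "enat m \<le> k" for m
    using Ck_family_imp_BGN[OF admissible_dense_interior[OF U] SDS_top_Ck_family[OF U that]] by blast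
  then show "is_BGN TK TF sc k d U f" using f by (auto simp: is_SDS_def is_BGN_def)
qed

text \<open>The vector space operations on both sides are pointwise, so the comparison of
  topological vector spaces reduces to this equality, which includes that of the underlying sets.
  Continuity of the identity is tested on the maps defining the target topology.\<close>

lemma BGN_top_eq_SDS_top:
  assumes U: "admissible d U"
  shows "BGN_top TK TF sc k d U = SDS_top TK TF sc k d U"
proof (rule topology_eq_id)
  have "topspace (BGN_top TK TF sc k d U) = {f. is_SDS TK TF sc k d U f}"
    using is_BGN_iff_is_SDS[OF U] by (simp add: BGN_top_def)
  then show "continuous_map (BGN_top TK TF sc k d U) (SDS_top TK TF sc k d U) (\<lambda>f. f)"
    unfolding SDS_top_def[of TK TF] using BGN_top_continuous_fa(1)[OF U]
    by (intro continuous_map_id_initial_top) auto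
  have gk: "continuous_map (SDS_top TK TF sc k d U) (compact_open (Ksub (BGN_dim j d) (BGN_Vk TK j d U)) TF)
      (\<lambda>f. BGN_gk TK TF sc j d U f)" if "enat j \<le> k" for j
    using Ck_family_imp_BGN[OF admissible_dense_interior[OF U] SDS_top_Ck_family[OF U that]] by blast
  have "topspace (SDS_top TK TF sc k d U) = {f. is_BGN TK TF sc k d U f}"
    using is_BGN_iff_is_SDS[OF U] by (simp add: SDS_top_def)
  then show "continuous_map (SDS_top TK TF sc k d U) (BGN_top TK TF sc k d U) (\<lambda>f. f)"
    unfolding BGN_top_def[of TK TF] using gk by (intro continuous_map_id_initial_top) auto
qed

end

theorem theoremB2:
  fixes TK :: "'k::field topology" and TF :: "'f::ab_group_add topology"
    and sc :: "'k \<Rightarrow> 'f \<Rightarrow> 'f" and d :: nat and k :: enat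
    and U :: "(nat \<Rightarrow> 'k) set"
  assumes "topological_field TK"
    and "topological_vector_space TK sc TF"
    and "d \<ge> 1"
    and "U \<subseteq> topspace (Kpow TK d)"
    and "openin (Kpow TK d) U \<or>
         (\<exists>Us. (\<forall>i<d. Us i \<subseteq> TK closure_of (TK interior_of (Us i)))
               \<and> U = PiE {..<d} Us)"
  shows "BGN_top TK TF sc k d U = SDS_top TK TF sc k d U"
proof -
  interpret top_vec TK TF sc
    by unfold_locales (fact assms(1) assms(2))+
  show ?thesis
    by (rule BGN_top_eq_SDS_top) (use assms(4,5) in \<open>simp add: admissible_def\<close>)
qed

end
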